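(* Let $d\ge1$ and let $Y=(Y_i)_{i\in\mathbb{Z}^d}$ be a shift-invariant Markov random field taking values in a finite set $B$. If $Y$ satisfies exponential strong spatial mixing, then $Y$ satisfies Gaussian concentration. If $d=2$ and $Y$ satisfies exponential weak spatial mixing for squares and has no hard constraints, that is, if the topological support of its law is $B^{\mathbb{Z}^d}$, then $Y$ also satisfies Gaussian concentration.
   Context: For finite $\Lambda\subset\mathbb{Z}^d$, $\partial\Lambda=\{i\notin\Lambda:\mathrm{dist}(i,\Lambda)=1\}$, distances being in the $\ell^1$-metric. A shift-invariant probability measure $\nu$ on $B^{\mathbb{Z}^d}$ (law of $Y$) is a Markov random field if for every finite $\Lambda$ the conditional law of $Y_\Lambda$ given $Y_{\Lambda^c}$ depends only on $Y_{\partial\Lambda}$. Let $\mathsf Y=\mathrm{supp}(\nu)$ be the set of feasible configurations and $\mathsf Y_{\partial\Lambda}$ its restriction to $\partial\Lambda$ (feasible boundary configurations). For finite $\Lambda'\subset\Lambda$ and $z\in\mathsf Y_{\partial\Lambda}$, $\nu^z_{\Lambda,\Lambda'}$ is the conditional law of $Y_{\Lambda'}$ given $Y_{\partial\Lambda}=z$. Weak spatial mixing with rate $\varrho:\mathbb{N}\to[0,\infty)$ (nonincreasing, $\varrho(n)\to0$): for every finite $\Lambda$, every $\Lambda'\subset\Lambda$ and all $z,z'\in\mathsf Y_{\partial\Lambda}$, $$\|\nu^z_{\Lambda,\Lambda'}-\nu^{z'}_{\Lambda,\Lambda'}\|_{\mathrm{TV}}\le|\Lambda'|\,\varrho(\mathrm{dist}(\Lambda',\partial\Lambda)).$$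 "For squares" ($d=2$) means that this is required only for $\Lambda$ ranging over squares (boxes with equal side lengths). Strong spatial mixing with rate $\varrho$: same, with the right-hand side replaced by $|\Lambda'|\,\varrho\big(\mathrm{dist}(\Lambda',\{i\in\partial\Lambda:z_i\ne z'_i\})\big)$. Either is called exponential if $\varrho(n)\le Ce^{-cn}$ for some $c,C>0$ and all $n\ge1$. Gaussian concentration. For $f:B^{\mathbb{Z}^d}\to\mathbb{R}$, $\delta_jf=\sup\{|f(y)-f(y')|: y_\ell=y'_\ell\ \forall \ell\ne j\}$; $f$ is local if it depends on finitely many coordinates; $\|\delta f\|_2^2=\sum_j(\delta_jf)^2$. $Y$ satisfies Gaussian concentration if there is $C>0$ such that for every local $f$ with $\delta_jf<\infty$ for all $j$, and every $\lambda>0$, $\log\mathbb{E}\big(e^{\lambda(f(Y)-\mathbb{E}[f(Y)])}\big)\le\frac C2\lambda^2\|\delta f\|_2^2$. *)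

theory Defs
  imports "HOL-Probability.Probability"
begin

text \<open>The lattice $\mathbb{Z}^d$ is the type \<open>int ^ 'd\<close> with $d$ = \<open>CARD('d)\<close>, the alphabet is a finite
  type \<open>'b\<close>, and a configuration is a function \<open>int ^ 'd \<Rightarrow> 'b\<close>. Patterns on a set of sites
  are extensional functions, that is, restrictions of configurations.\<close>

definition l1_dist :: "int ^ 'd \<Rightarrow> int ^ 'd \<Rightarrow> nat" where
  "l1_dist i j = (\<Sum>k\<in>UNIV. nat \<bar>i $ k - j $ k\<bar>)"

text \<open>The distance to the empty set is \<open>\<infinity>\<close>.\<close>

definition l1_setdist :: "(int ^ 'd) set \<Rightarrow> (int ^ 'd) set \<Rightarrow> enat" where
  "l1_setdist A B = Inf {enat (l1_dist i j) | i j. i \<in> A \<and> j \<in> B}"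

definition outer_boundary :: "(int ^ 'd) set \<Rightarrow> (int ^ 'd) set" where
  "outer_boundary \<Lambda> = {i. i \<notin> \<Lambda> \<and> l1_setdist {i} \<Lambda> = 1}"

definition squares :: "(int ^ 'd) set set" where
  "squares = {{i. \<forall>k. a $ k \<le> i $ k \<and> i $ k < a $ k + int n} | a n. n \<ge> 1}"

abbreviation pattern_space :: "(int ^ 'd) set \<Rightarrow> (int ^ 'd \<Rightarrow> 'b) measure" where
  "pattern_space \<Delta> \<equiv> PiM \<Delta> (\<lambda>_. count_space UNIV)"

definition field_law :: "'w measure \<Rightarrow> (int ^ 'd \<Rightarrow> 'w \<Rightarrow> 'b) \<Rightarrow> (int ^ 'd \<Rightarrow> 'b) measure" where
  "field_law M Y = distr M (pattern_space UNIV) (\<lambda>\<omega> i. Y i \<omega>)"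

definition shift_invariant :: "(int ^ 'd \<Rightarrow> 'b) measure \<Rightarrow> bool" where
  "shift_invariant \<nu> \<longleftrightarrow> (\<forall>k. distr \<nu> (pattern_space UNIV) (\<lambda>y i. y (i + k)) = \<nu>)"

text \<open>The sub-sigma-algebra generated by the coordinates in \<open>\<Delta>\<close>.\<close>

definition coordinate_algebra :: "(int ^ 'd) set \<Rightarrow> (int ^ 'd \<Rightarrow> 'b) measure" where
  "coordinate_algebra \<Delta> = vimage_algebra UNIV (\<lambda>y. restrict y \<Delta>) (pattern_space \<Delta>)"

text \<open>Since \<open>\<Lambda>\<close> and the alphabet are finite, the conditional law of $Y_\Lambda$ given $Y_{\Lambda^c}$ is
  described by the conditional probabilities of the finitely many cylinder events
  $\{Y_\Lambda = a_\Lambda\}$. No measurability of \<open>g\<close> is demanded: it is a function of finitely many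
  coordinates with finitely many values.\<close>

definition markov_random_field :: "(int ^ 'd \<Rightarrow> 'b) measure \<Rightarrow> bool" where
  "markov_random_field \<nu> \<longleftrightarrow>
     (\<forall>\<Lambda>. finite \<Lambda> \<longrightarrow>
       (\<forall>a. \<exists>g. AE y in \<nu>.
          real_cond_exp \<nu> (coordinate_algebra (- \<Lambda>)) (indicator {x. \<forall>i\<in>\<Lambda>. x i = a i}) y
            = g (restrict y (outer_boundary \<Lambda>))))"

definition configuration_topology :: "(int ^ 'd \<Rightarrow> 'b) topology" where
  "configuration_topology = product_topology (\<lambda>_. discrete_topology UNIV) UNIV"

text \<open>For a finite alphabet every open set is a countable union of cylinders, hence measurable.\<close>

definition topological_support :: "(int ^ 'd \<Rightarrow> 'b) measure \<Rightarrow> (int ^ 'd \<Rightarrow> 'b) set" where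
  "topological_support \<nu> =
     {y. \<forall>U. openin configuration_topology U \<and> y \<in> U \<longrightarrow> measure \<nu> U > 0}"

definition feasible_on :: "(int ^ 'd \<Rightarrow> 'b) measure \<Rightarrow> (int ^ 'd) set \<Rightarrow> (int ^ 'd \<Rightarrow> 'b) set" where
  "feasible_on \<nu> \<Delta> = (\<lambda>y. restrict y \<Delta>) ` topological_support \<nu>"

text \<open>The conditional law of $Y_{\Lambda'}$ given $Y_{\partial\Lambda} = z$. For a feasible \<open>z\<close>
  the conditioning event has positive probability, because \<open>outer_boundary \<Lambda>\<close> is finite.\<close>

definition conditional_law ::
  "(int ^ 'd \<Rightarrow> 'b) measure \<Rightarrow> (int ^ 'd) set \<Rightarrow> (int ^ 'd) set \<Rightarrow> (int ^ 'd \<Rightarrow> 'b)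
     \<Rightarrow> (int ^ 'd \<Rightarrow> 'b) measure" where
  "conditional_law \<nu> \<Lambda> \<Lambda>' z =
     distr (uniform_measure \<nu> {y. \<forall>i\<in>outer_boundary \<Lambda>. y i = z i})
       (pattern_space \<Lambda>') (\<lambda>y. restrict y \<Lambda>')"

definition tv_dist :: "'a measure \<Rightarrow> 'a measure \<Rightarrow> real" where
  "tv_dist \<mu> \<mu>' = (SUP A\<in>sets \<mu>. \<bar>measure \<mu> A - measure \<mu>' A\<bar>)"

definition mixing_rate :: "(nat \<Rightarrow> real) \<Rightarrow> bool" where
  "mixing_rate \<rho> \<longleftrightarrow> (\<forall>n. \<rho> n \<ge> 0) \<and> antimono \<rho> \<and> \<rho> \<longlonglongrightarrow> 0"

text \<open>A rate is extended by its limit 0 to infinite distances. These occur for an empty \<open>\<Lambda>'\<close>, or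
  for equal boundary configurations in strong mixing; in both cases the two conditional laws agree.\<close>

definition rate_at :: "(nat \<Rightarrow> real) \<Rightarrow> enat \<Rightarrow> real" where
  "rate_at \<rho> D = (case D of enat n \<Rightarrow> \<rho> n | \<infinity> \<Rightarrow> 0)"

definition exponential_rate :: "(nat \<Rightarrow> real) \<Rightarrow> bool" where
  "exponential_rate \<rho> \<longleftrightarrow> (\<exists>c>0. \<exists>C>0. \<forall>n\<ge>1. \<rho> n \<le> C * exp (- c * real n))"

text \<open>Weak spatial mixing required only for volumes in the collection \<open>\<V>\<close>; the unrestricted notion
  is the case \<open>\<V> = {\<Lambda>. finite \<Lambda>}\<close>, and the version for squares is \<open>\<V> = squares\<close>.\<close>

definition weak_spatial_mixing ::
  "(int ^ 'd) set set \<Rightarrow> (int ^ 'd \<Rightarrow> 'b) measure \<Rightarrow> (nat \<Rightarrow> real) \<Rightarrow> bool" where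
  "weak_spatial_mixing \<V> \<nu> \<rho> \<longleftrightarrow> mixing_rate \<rho> \<and>
     (\<forall>\<Lambda>\<in>\<V>. \<forall>\<Lambda>'\<subseteq>\<Lambda>. \<forall>z\<in>feasible_on \<nu> (outer_boundary \<Lambda>). \<forall>z'\<in>feasible_on \<nu> (outer_boundary \<Lambda>).
        tv_dist (conditional_law \<nu> \<Lambda> \<Lambda>' z) (conditional_law \<nu> \<Lambda> \<Lambda>' z')
          \<le> real (card \<Lambda>') * rate_at \<rho> (l1_setdist \<Lambda>' (outer_boundary \<Lambda>)))"

definition strong_spatial_mixing :: "(int ^ 'd \<Rightarrow> 'b) measure \<Rightarrow> (nat \<Rightarrow> real) \<Rightarrow> bool" where
  "strong_spatial_mixing \<nu> \<rho> \<longleftrightarrow> mixing_rate \<rho> \<and>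
     (\<forall>\<Lambda>. finite \<Lambda> \<longrightarrow>
       (\<forall>\<Lambda>'\<subseteq>\<Lambda>. \<forall>z\<in>feasible_on \<nu> (outer_boundary \<Lambda>). \<forall>z'\<in>feasible_on \<nu> (outer_boundary \<Lambda>).
        tv_dist (conditional_law \<nu> \<Lambda> \<Lambda>' z) (conditional_law \<nu> \<Lambda> \<Lambda>' z')
          \<le> real (card \<Lambda>') * rate_at \<rho> (l1_setdist \<Lambda>' {i \<in> outer_boundary \<Lambda>. z i \<noteq> z' i})))"

definition exponential_strong_spatial_mixing :: "(int ^ 'd \<Rightarrow> 'b) measure \<Rightarrow> bool" where
  "exponential_strong_spatial_mixing \<nu> \<longleftrightarrow>
     (\<exists>\<rho>. strong_spatial_mixing \<nu> \<rho> \<and> exponential_rate \<rho>)"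

definition exponential_weak_spatial_mixing_for_squares :: "(int ^ 'd \<Rightarrow> 'b) measure \<Rightarrow> bool" where
  "exponential_weak_spatial_mixing_for_squares \<nu> \<longleftrightarrow>
     (\<exists>\<rho>. weak_spatial_mixing squares \<nu> \<rho> \<and> exponential_rate \<rho>)"

definition no_hard_constraints :: "(int ^ 'd \<Rightarrow> 'b) measure \<Rightarrow> bool" where
  "no_hard_constraints \<nu> \<longleftrightarrow> topological_support \<nu> = UNIV"

definition local_function :: "((int ^ 'd \<Rightarrow> 'b) \<Rightarrow> real) \<Rightarrow> bool" where
  "local_function f \<longleftrightarrow>
     (\<exists>\<Delta>. finite \<Delta> \<and> (\<forall>y y'. (\<forall>i\<in>\<Delta>. y i = y' i) \<longrightarrow> f y = f y'))"

definition oscillations :: "((int ^ 'd \<Rightarrow> 'b) \<Rightarrow> real) \<Rightarrow> int ^ 'd \<Rightarrow> real set" where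
  "oscillations f j = {\<bar>f y - f y'\<bar> | y y'. \<forall>l. l \<noteq> j \<longrightarrow> y l = y' l}"

text \<open>\<open>delta f j\<close> is meaningful where the supremum is finite, that is, under \<open>bdd_above (oscillations f j)\<close>.\<close>

definition delta :: "((int ^ 'd \<Rightarrow> 'b) \<Rightarrow> real) \<Rightarrow> int ^ 'd \<Rightarrow> real" where
  "delta f j = Sup (oscillations f j)"

definition delta_norm_sq :: "((int ^ 'd \<Rightarrow> 'b) \<Rightarrow> real) \<Rightarrow> real" where
  "delta_norm_sq f = (\<Sum>\<^sub>\<infinity>j\<in>UNIV. (delta f j)\<^sup>2)"

definition gaussian_concentration :: "(int ^ 'd \<Rightarrow> 'b) measure \<Rightarrow> bool" where
  "gaussian_concentration \<nu> \<longleftrightarrow>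
     (\<exists>C>0. \<forall>f. local_function f \<and> (\<forall>j. bdd_above (oscillations f j)) \<longrightarrow>
       (\<forall>t>0. ln (\<integral>y. exp (t * (f y - (\<integral>x. f x \<partial>\<nu>))) \<partial>\<nu>) \<le> C / 2 * t\<^sup>2 * delta_norm_sq f))"

end

theory Submission
  imports Defs "HOL-Real_Asymp.Real_Asymp"
begin

text \<open>Reveal the sites of a finite set one at a time. By Hoeffding's lemma, the exponential moment of a
  local function is controlled by the oscillations of its successive conditional expectations, and
  the oscillation caused by revealing \<open>v\<close> is at most $2\sum_j \Phi(v,j)\,\delta_j f$ as soon as the
  laws of the field on $\{j : |j - v| \ge r\}$, conditioned on two revealed patterns that differ only
  at \<open>v\<close>, are close in total variation. If this distance decays fast in \<open>r\<close>, then Schur's test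
  concludes.

  Under strong mixing any order works: the sphere of radius \<open>r\<close> around \<open>v\<close> screens off everything
  beyond it, so that its number of sites is the only loss.

  Under weak mixing for squares in the plane, sites of a large square are revealed in lexicographic
  order, so that the unrevealed region is locally a half plane bounded by a straight line near \<open>v\<close>. A
  change at \<open>v\<close> does not reach a segment \<open>J\<close> parallel to this line at distance \<open>K\<close>, by weak mixing in
  squares of the half plane. Once the patterns on \<open>J\<close> agree, the change can only travel along the
  strip between the line and \<open>J\<close>. This is a one-dimensional chain of cross sections, whose laws
  overlap: all but \<open>O(k)\<close> sites of a cross section are at distance \<open>k\<close> from the walls, where
  weak mixing in a square of side \<open>K - 1\<close> applies, and the others are handled by positivity. With \<open>k\<close>
  much smaller than \<open>K\<close> the overlap is large enough for the influence to die out.\<close>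

section \<open>Conditioning on patterns of finite sets\<close>

text \<open>Weak mixing charges the distance to the whole boundary, so by itself it says nothing
  about unrevealed sites next to the line. Positivity alone is too weak as well: with an exponential
  rate, \<open>\<rho> K\<close> is guaranteed to beat a fixed power of \<open>1 / r\<close> only if
  \<open>K\<close> is at least of order \<open>ln r\<close>. Forcing a whole cross section to agree
  then costs about \<open>\<epsilon> ^ K\<close>, a power of \<open>1 / r\<close> which the
  \<open>r / K\<close> available steps need not make up for. Hence the splitting of a cross section:
  weak mixing carries its middle as soon as \<open>K * \<rho> k \<le> 1 / 2\<close>, and this allows
  a \<open>k\<close> so small that \<open>\<epsilon> ^ k\<close> is larger than every negative power
  of \<open>r\<close>.

  The second obstacle is geometric. Sites of the support of the function taken in any order would
  leave irregular unrevealed regions, so a much larger square is revealed. Near its sides the line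
  is cut off and no strip has both walls. Such sites are far from the support, and their influence
  only has to be small against one over the number of revealed sites. The additive error
  \<open>e\<close> in the general criterion absorbs it; the square and \<open>e\<close> depend on
  the function, the final constant does not.\<close>

definition depends_on :: "((int ^ 'd \<Rightarrow> 'b) \<Rightarrow> 'c) \<Rightarrow> (int ^ 'd) set \<Rightarrow> bool" where
  "depends_on g S \<longleftrightarrow> (\<forall>y y'. (\<forall>i\<in>S. y i = y' i) \<longrightarrow> g y = g y')"

definition cyl :: "(int ^ 'd) set \<Rightarrow> (int ^ 'd \<Rightarrow> 'b) \<Rightarrow> (int ^ 'd \<Rightarrow> 'b) set" where
  "cyl A \<eta> = {y. \<forall>i\<in>A. y i = \<eta> i}"

lemma depends_onD: "depends_on g S \<Longrightarrow> (\<And>i. i \<in> S \<Longrightarrow> y i = y' i) \<Longrightarrow> g y = g y'"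
  unfolding depends_on_def by blast

lemma depends_on_mono: "depends_on g S \<Longrightarrow> S \<subseteq> T \<Longrightarrow> depends_on g T"
  unfolding depends_on_def by blast

lemma depends_on_comp: "depends_on g S \<Longrightarrow> depends_on (\<lambda>y. h (g y)) S"
  unfolding depends_on_def by metis

lemma depends_on_comp2: "depends_on g S \<Longrightarrow> depends_on g' S \<Longrightarrow> depends_on (\<lambda>y. h (g y) (g' y)) S"
  unfolding depends_on_def by metis

lemma depends_on_const [simp]: "depends_on (\<lambda>_. c) S"
  unfolding depends_on_def by blast

lemma depends_on_cyl: "depends_on (\<lambda>y. indicator (cyl A \<eta>) y :: real) A"
  unfolding depends_on_def cyl_def by (auto simp: indicator_def)

lemma mem_cyl_self [simp]: "\<eta> \<in> cyl A \<eta>"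
  by (auto simp: cyl_def)

lemma cyl_eq: "y \<in> cyl A \<eta> \<Longrightarrow> cyl A y = cyl A \<eta>"
  by (auto simp: cyl_def)

lemma cyl_eqI: "(\<And>i. i \<in> A \<Longrightarrow> y i = \<eta> i) \<Longrightarrow> cyl A y = cyl A \<eta>"
  by (auto simp: cyl_def)

lemma cyl_Un: "cyl (A \<union> B) \<eta> = cyl A \<eta> \<inter> cyl B \<eta>"
  by (auto simp: cyl_def)

lemma cyl_restrict [simp]: "cyl A (restrict \<eta> A) = cyl A \<eta>"
  by (auto simp: cyl_def)

locale random_field = prob_space \<nu> for \<nu> :: "(int ^ 'd \<Rightarrow> 'b :: finite) measure" +
  assumes sets_field [measurable_cong]: "sets \<nu> = sets (pattern_space UNIV)"
begin

lemma space_field [simp]: "space \<nu> = UNIV"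
  using sets_eq_imp_space_eq[OF sets_field] by (simp add: space_PiM)

lemma cyl_sets [measurable]: "finite A \<Longrightarrow> cyl A \<eta> \<in> sets \<nu>"
proof -
  assume "finite A"
  have "{y \<in> space \<nu>. \<forall>i\<in>A. y i = \<eta> i} \<in> sets \<nu>"
    using \<open>finite A\<close> by measurable
  then show ?thesis by (simp add: cyl_def)
qed

section \<open>Functions of finitely many coordinates\<close>

definition patterns :: "(int ^ 'd) set \<Rightarrow> (int ^ 'd \<Rightarrow> 'b) set" where
  "patterns A = PiE A (\<lambda>_. UNIV)"

lemma finite_patterns [simp]: "finite A \<Longrightarrow> finite (patterns A)"
  unfolding patterns_def by (intro finite_PiE) auto

text \<open>The cylinders over the patterns on \<open>A\<close> partition the configurations, so
  exactly one term survives. Local functions thereby become finite combinations of cylinder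
  indicators, which gives their measurability, boundedness and integrability.\<close>

lemma sum_patterns_indicator:
  assumes "finite A"
  shows "(\<Sum>s\<in>patterns A. indicator (cyl A s) y * c s) = (c (restrict y A) :: real)"
proof -
  have "(\<Sum>s\<in>patterns A. indicator (cyl A s) y * c s) = (\<Sum>s\<in>{restrict y A}. indicator (cyl A s) y * c s)"
  proof (rule sum.mono_neutral_right)
    show "\<forall>s\<in>patterns A - {restrict y A}. indicator (cyl A s) y * c s = 0"
    proof
      fix s assume s: "s \<in> patterns A - {restrict y A}"
      have "y \<notin> cyl A s"
      proof
        assume "y \<in> cyl A s"
        then have "restrict y A = s"
          using s by (auto simp: patterns_def cyl_def PiE_def extensional_def fun_eq_iff)
        with s show False by auto
      qed
      then show "indicator (cyl A s) y * c s = 0" by simp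
    qed
  qed (use assms in \<open>simp_all, simp add: patterns_def\<close>)
  also have "\<dots> = c (restrict y A)" by (auto simp: cyl_def indicator_def)
  finally show ?thesis .
qed

lemma depends_on_restrict: "depends_on g A \<Longrightarrow> g (restrict y A) = g (y :: int ^ 'd \<Rightarrow> 'b)"
  by (erule depends_onD) auto

lemma depends_on_expand:
  fixes g :: "(int ^ 'd \<Rightarrow> 'b) \<Rightarrow> real"
  assumes "finite A" "depends_on g A"
  shows "g y = (\<Sum>s\<in>patterns A. indicator (cyl A s) y * (g s :: real))"
  by (rule trans[OF depends_on_restrict[OF assms(2), symmetric] sum_patterns_indicator[OF assms(1), of y
      g, symmetric]])

lemma depends_on_measurable:
  fixes g :: "(int ^ 'd \<Rightarrow> 'b) \<Rightarrow> real"
  assumes "finite A" "depends_on g A"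
  shows "g \<in> borel_measurable \<nu>"
proof -
  have "(\<lambda>y. \<Sum>s\<in>patterns A. indicator (cyl A s) y * (g s :: real)) \<in> borel_measurable \<nu>"
    using assms(1) by measurable
  also have "(\<lambda>y. \<Sum>s\<in>patterns A. indicator (cyl A s) y * g s) = g"
    by (rule ext) (rule depends_on_expand[OF assms, symmetric])
  finally show ?thesis .
qed

lemma depends_on_bounded:
  fixes g :: "(int ^ 'd \<Rightarrow> 'b) \<Rightarrow> real"
  assumes "finite A" "depends_on g A"
  obtains b where "b > 0" "\<And>y. \<bar>g y\<bar> \<le> b"
proof
  show "(\<Sum>s\<in>patterns A. \<bar>g s\<bar>) + 1 > 0" by (simp add: add_nonneg_pos sum_nonneg)
  fix y
  have "\<bar>g y\<bar> \<le> (\<Sum>s\<in>patterns A. \<bar>indicator (cyl A s) y * g s\<bar>)"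
    by (subst depends_on_expand[OF assms]) (rule sum_abs)
  also have "\<dots> \<le> (\<Sum>s\<in>patterns A. \<bar>g s\<bar>)"
    by (intro sum_mono) (auto simp: indicator_def)
  finally show "\<bar>g y\<bar> \<le> (\<Sum>s\<in>patterns A. \<bar>g s\<bar>) + 1" by simp
qed

lemma depends_on_integrable:
  fixes g :: "(int ^ 'd \<Rightarrow> 'b) \<Rightarrow> real"
  assumes "finite A" "depends_on g A"
  shows "integrable \<nu> g"
proof -
  obtain b where b: "\<And>y. \<bar>g y\<bar> \<le> b" using depends_on_bounded[OF assms] by metis
  show ?thesis
    by (rule integrable_const_bound[where B = b]) (use b depends_on_measurable[OF assms] in auto)
qed

lemma integral_patterns:
  assumes "finite A" "integrable \<nu> (g :: _ \<Rightarrow> real)"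
  shows "(\<integral>y. g y \<partial>\<nu>) = (\<Sum>s\<in>patterns A. \<integral>y. indicator (cyl A s) y * g y \<partial>\<nu>)"
proof -
  have "(\<integral>y. g y \<partial>\<nu>) = (\<integral>y. (\<Sum>s\<in>patterns A. indicator (cyl A s) y * g y) \<partial>\<nu>)"
    using sum_patterns_indicator[OF assms(1), of _ "\<lambda>_. g _"] by (intro Bochner_Integration.integral_cong)
        auto
  also have "\<dots> = (\<Sum>s\<in>patterns A. \<integral>y. indicator (cyl A s) y * g y \<partial>\<nu>)"
    using integrable_real_mult_indicator[OF cyl_sets[OF assms(1)] assms(2)]
    by (intro Bochner_Integration.integral_sum) (simp add: mult.commute)
  finally show ?thesis .
qed

text \<open>An elementary quotient suffices, since all conditioning is on finitely many coordinates.
  On a null cylinder its value is 0 by the convention for division, so that several identities, the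
  tower property among them, hold without a positivity hypothesis.\<close>

definition cexp :: "(int ^ 'd) set \<Rightarrow> (int ^ 'd \<Rightarrow> 'b) \<Rightarrow> ((int ^ 'd \<Rightarrow> 'b) \<Rightarrow> real) \<Rightarrow> real" where
  "cexp A \<eta> g = (\<integral>y. indicator (cyl A \<eta>) y * g y \<partial>\<nu>) / measure \<nu> (cyl A \<eta>)"

abbreviation pos :: "(int ^ 'd) set \<Rightarrow> (int ^ 'd \<Rightarrow> 'b) \<Rightarrow> bool" where
  "pos A \<eta> \<equiv> measure \<nu> (cyl A \<eta>) > 0"

lemma pos_mono: "pos B \<eta> \<Longrightarrow> A \<subseteq> B \<Longrightarrow> finite B \<Longrightarrow> pos A \<eta>"
proof -
  assume a: "pos B \<eta>" "A \<subseteq> B" "finite B"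
  have "measure \<nu> (cyl B \<eta>) \<le> measure \<nu> (cyl A \<eta>)"
    using a by (intro finite_measure_mono cyl_sets finite_subset[of A B]) (auto simp: cyl_def)
  with a(1) show ?thesis by linarith
qed

lemma cexp_cyl: "y \<in> cyl A \<eta> \<Longrightarrow> cexp A y g = cexp A \<eta> g"
  by (simp add: cexp_def cyl_eq)

lemma cexp_eqI: "(\<And>i. i \<in> A \<Longrightarrow> y i = \<eta> i) \<Longrightarrow> cexp A y g = cexp A \<eta> g"
  unfolding cexp_def by (subst (1 2) cyl_eqI[of A y \<eta>]) auto

lemma depends_on_cexp: "depends_on (\<lambda>y. cexp B y g) B"
  unfolding depends_on_def by (intro allI impI cexp_eqI) simp

lemma cexp_empty [simp]: "cexp {} \<eta> g = (\<integral>y. g y \<partial>\<nu>)"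
  using prob_space by (simp add: cexp_def cyl_def)

lemma integrable_cyl_mult:
  assumes "finite A" "integrable \<nu> (g :: _ \<Rightarrow> real)"
  shows "integrable \<nu> (\<lambda>y. indicator (cyl A \<eta>) y * g y)"
  using integrable_real_mult_indicator[OF cyl_sets[OF assms(1)] assms(2), of \<eta>] by (simp add: mult.commute)

text \<open>There are only finitely many null patterns on \<open>B\<close>. This is why pointwise
  bounds on conditional expectations are only ever required at patterns of positive
  probability.\<close>

lemma AE_pos:
  assumes "finite B"
  shows "AE y in \<nu>. pos B y"
proof -
  let ?N = "\<Union>s\<in>{s\<in>patterns B. measure \<nu> (cyl B s) = 0}. cyl B s"
  have "?N \<in> null_sets \<nu>"
    using assms by (intro null_sets_UN' countable_finite) (auto simp: null_sets_def emeasure_eq_measure)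
  moreover have "{y \<in> space \<nu>. \<not> pos B y} \<subseteq> ?N"
  proof
    fix y assume "y \<in> {y \<in> space \<nu>. \<not> pos B y}"
    then have "measure \<nu> (cyl B y) = 0" using measure_nonneg[of \<nu> "cyl B y"] by simp
    then have "measure \<nu> (cyl B (restrict y B)) = 0" by simp
    moreover have "restrict y B \<in> patterns B" by (auto simp: patterns_def)
    moreover have "y \<in> cyl B (restrict y B)" by (auto simp: cyl_def)
    ultimately show "y \<in> ?N" by blast
  qed
  ultimately show ?thesis by (rule AE_I')
qed

lemma cexp_const: "pos A \<eta> \<Longrightarrow> finite A \<Longrightarrow> cexp A \<eta> (\<lambda>_. c) = c"
  by (simp add: cexp_def)

lemma cexp_mono_AE:
  assumes "pos A \<eta>" "finite A" "integrable \<nu> g" "integrable \<nu> g'"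
    and "AE y in \<nu>. y \<in> cyl A \<eta> \<longrightarrow> g y \<le> g' y"
  shows "cexp A \<eta> g \<le> cexp A \<eta> g'"
  unfolding cexp_def using assms
  by (intro divide_right_mono integral_mono_AE integrable_cyl_mult) (auto simp: indicator_def elim!: AE_mp)

lemma cexp_cong_AE:
  assumes "finite A" "integrable \<nu> g" "integrable \<nu> g'"
    and "AE y in \<nu>. y \<in> cyl A \<eta> \<longrightarrow> g y = g' y"
  shows "cexp A \<eta> g = cexp A \<eta> g'"
proof -
  have "(\<integral>y. indicator (cyl A \<eta>) y * g y \<partial>\<nu>) = (\<integral>y. indicator (cyl A \<eta>) y * g' y \<partial>\<nu>)"
    using assms by (intro integral_cong_AE borel_measurable_integrable integrable_cyl_mult)
      (auto simp: indicator_def elim!: AE_mp)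
  then show ?thesis by (simp add: cexp_def)
qed

lemma cexp_cong: "(\<And>y. y \<in> cyl A \<eta> \<Longrightarrow> g y = g' y) \<Longrightarrow> cexp A \<eta> g = cexp A \<eta> g'"
  unfolding cexp_def by (intro arg_cong2[where f = "(/)"] Bochner_Integration.integral_cong) (auto simp:
      indicator_def)

lemma cexp_add:
  assumes "finite A" "integrable \<nu> g" "integrable \<nu> g'"
  shows "cexp A \<eta> (\<lambda>y. g y + g' y) = cexp A \<eta> g + cexp A \<eta> g'"
  unfolding cexp_def using integrable_cyl_mult[OF assms(1,2), of \<eta>] integrable_cyl_mult[OF assms(1,3), of \<eta>]
  by (simp add: distrib_left add_divide_distrib)

lemma cexp_diff:
  assumes "finite A" "integrable \<nu> g" "integrable \<nu> g'"
  shows "cexp A \<eta> (\<lambda>y. g y - g' y) = cexp A \<eta> g - cexp A \<eta> g'"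
  unfolding cexp_def using integrable_cyl_mult[OF assms(1,2), of \<eta>] integrable_cyl_mult[OF assms(1,3), of \<eta>]
  by (simp add: right_diff_distrib diff_divide_distrib)

lemma cexp_cmult: "cexp A \<eta> (\<lambda>y. c * g y) = c * cexp A \<eta> g"
  unfolding cexp_def by (simp add: mult.left_commute[of _ c])

lemma cexp_ge:
  assumes "pos A \<eta>" "finite A" "integrable \<nu> g" "AE y in \<nu>. y \<in> cyl A \<eta> \<longrightarrow> l \<le> g y"
  shows "l \<le> cexp A \<eta> g"
  using cexp_mono_AE[OF assms(1,2) _ assms(3), of "\<lambda>_. l"] assms by (simp add: cexp_const)

lemma cexp_le:
  assumes "pos A \<eta>" "finite A" "integrable \<nu> g" "AE y in \<nu>. y \<in> cyl A \<eta> \<longrightarrow> g y \<le> u"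
  shows "cexp A \<eta> g \<le> u"
  using cexp_mono_AE[OF assms(1,2,3), of "\<lambda>_. u"] assms by (simp add: cexp_const)

lemma cexp_unit_range:
  assumes "finite A" "finite S" "depends_on g S" "\<And>y. 0 \<le> g y \<and> g y \<le> (1::real)"
  shows "0 \<le> cexp A \<eta> g \<and> cexp A \<eta> g \<le> 1"
proof (cases "pos A \<eta>")
  case True
  then show ?thesis using cexp_ge[of A \<eta> g 0] cexp_le[of A \<eta> g 1] assms depends_on_integrable[OF
      assms(2,3)] by auto
next
  case False
  then have "measure \<nu> (cyl A \<eta>) = 0" using measure_nonneg[of \<nu> "cyl A \<eta>"] by linarith
  then show ?thesis by (simp add: cexp_def)
qed

lemma cyl_integral:
  assumes "finite A" "integrable \<nu> g"
  shows "(\<integral>y. indicator (cyl A \<eta>) y * g y \<partial>\<nu>) = measure \<nu> (cyl A \<eta>) * cexp A \<eta> g"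
proof (cases "pos A \<eta>")
  case True
  then show ?thesis by (simp add: cexp_def)
next
  case False
  then have 0: "measure \<nu> (cyl A \<eta>) = 0" using measure_nonneg[of \<nu> "cyl A \<eta>"] by linarith
  then have "cyl A \<eta> \<in> null_sets \<nu>" using assms(1) by (auto simp: null_sets_def emeasure_eq_measure)
  then have "AE y in \<nu>. indicator (cyl A \<eta>) y * g y = 0"
    by (rule AE_I') (auto simp: indicator_def)
  then have "(\<integral>y. indicator (cyl A \<eta>) y * g y \<partial>\<nu>) = 0"
    by (rule integral_eq_zero_AE)
  then show ?thesis using 0 by simp
qed

text \<open>Both integrals are split along the patterns on \<open>B\<close>. On each such cylinder
  the indicator of \<open>cyl A \<eta>\<close> and the inner conditional expectation are constant,
  and \<open>cyl_integral\<close> gives back the integral of \<open>g\<close>.\<close>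

lemma cexp_tower:
  assumes "A \<subseteq> B" "finite B" "integrable \<nu> g"
  shows "cexp A \<eta> (\<lambda>y. cexp B y g) = cexp A \<eta> g"
proof -
  have fA: "finite A" using assms finite_subset by blast
  have int: "integrable \<nu> (\<lambda>y. cexp B y g)"
    by (rule depends_on_integrable[OF assms(2) depends_on_cexp])
  have *: "(\<integral>y. indicator (cyl B s) y * (indicator (cyl A \<eta>) y * cexp B y g) \<partial>\<nu>)
      = (\<integral>y. indicator (cyl B s) y * (indicator (cyl A \<eta>) y * g y) \<partial>\<nu>)" for s
  proof -
    have i: "(indicator (cyl A \<eta>) y :: real) = indicator (cyl A \<eta>) s" if "y \<in> cyl B s" for y
      using that assms(1) by (auto simp: cyl_def indicator_def subset_iff)
    have "(\<integral>y. indicator (cyl B s) y * (indicator (cyl A \<eta>) y * cexp B y g) \<partial>\<nu>)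
       = (\<integral>y. indicator (cyl A \<eta>) s * cexp B s g * indicator (cyl B s) y \<partial>\<nu>)"
    proof (intro Bochner_Integration.integral_cong refl)
      fix y show "indicator (cyl B s) y * (indicator (cyl A \<eta>) y * cexp B y g) =
         indicator (cyl A \<eta>) s * cexp B s g * indicator (cyl B s) y"
        using i[of y] cexp_cyl[of y B s g] by (auto simp: indicator_def)
    qed
    also have "\<dots> = indicator (cyl A \<eta>) s * (\<integral>y. indicator (cyl B s) y * g y \<partial>\<nu>)"
      by (simp add: cyl_integral[OF assms(2,3)])
    also have "\<dots> = (\<integral>y. indicator (cyl A \<eta>) s * (indicator (cyl B s) y * g y) \<partial>\<nu>)"
      by simp
    also have "\<dots> = (\<integral>y. indicator (cyl B s) y * (indicator (cyl A \<eta>) y * g y) \<partial>\<nu>)"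
    proof (intro Bochner_Integration.integral_cong refl)
      fix y show "indicator (cyl A \<eta>) s * (indicator (cyl B s) y * g y) =
         indicator (cyl B s) y * (indicator (cyl A \<eta>) y * g y)"
        using i[of y] by (cases "y \<in> cyl B s") simp_all
    qed
    finally show ?thesis .
  qed
  have "(\<integral>y. indicator (cyl A \<eta>) y * cexp B y g \<partial>\<nu>) = (\<integral>y. indicator (cyl A \<eta>) y * g y \<partial>\<nu>)"
    by (subst (1 2) integral_patterns[OF assms(2)]) (auto intro!: integrable_cyl_mult fA int assms(3)
        sum.cong *)
  then show ?thesis by (simp add: cexp_def)
qed

text \<open>Conditional expectations are averages: if every value of \<open>g\<close> is within
  \<open>w\<close> of every value of \<open>g'\<close>, so are their means, and no coupling of the
  two laws is needed. \<open>C\<close> and \<open>C'\<close> only discard null patterns.\<close>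

lemma cexp_close:
  assumes "finite A" "finite A'" "pos A \<eta>" "pos A' \<eta>'" "finite B" "finite B'"
    and "depends_on g B" "depends_on g' B'" "finite C" "finite C'"
    and *: "\<And>y y'. y \<in> cyl A \<eta> \<Longrightarrow> y' \<in> cyl A' \<eta>' \<Longrightarrow> pos C y \<Longrightarrow> pos C' y' \<Longrightarrow> \<bar>g y - g' y'\<bar> \<le> w"
  shows "\<bar>cexp A \<eta> g - cexp A' \<eta>' g'\<bar> \<le> w"
proof -
  have int: "integrable \<nu> g" "integrable \<nu> g'"
    using depends_on_integrable assms by blast+
  have AE: "AE y in \<nu>. P y" if "\<And>y. pos D y \<Longrightarrow> P y" "finite D" for P D
    using AE_pos[OF that(2)] by (rule AE_mp) (use that(1) in simp)
  have 1: "cexp A \<eta> g \<le> g' y' + w" if y': "y' \<in> cyl A' \<eta>'" "pos C' y'" for y'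
  proof (intro cexp_le assms int AE[OF _ \<open>finite C\<close>] impI)
    fix y assume "pos C y" "y \<in> cyl A \<eta>"
    with *[of y y'] y' show "g y \<le> g' y' + w" by (simp add: abs_le_iff)
  qed
  have "cexp A \<eta> g - w \<le> cexp A' \<eta>' g'"
  proof (intro cexp_ge assms int AE[OF _ \<open>finite C'\<close>] impI)
    fix y' assume "pos C' y'" "y' \<in> cyl A' \<eta>'"
    with 1[of y'] show "cexp A \<eta> g - w \<le> g' y'" by simp
  qed
  moreover
  have 2: "g' y' - w \<le> cexp A \<eta> g" if y': "y' \<in> cyl A' \<eta>'" "pos C' y'" for y'
  proof (intro cexp_ge assms int AE[OF _ \<open>finite C\<close>] impI)
    fix y assume "pos C y" "y \<in> cyl A \<eta>"
    with *[of y y'] y' show "g' y' - w \<le> g y" by (simp add: abs_le_iff)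
  qed
  have "cexp A' \<eta>' g' \<le> cexp A \<eta> g + w"
  proof (intro cexp_le assms int AE[OF _ \<open>finite C'\<close>] impI)
    fix y' assume "pos C' y'" "y' \<in> cyl A' \<eta>'"
    with 2[of y'] show "g' y' \<le> cexp A \<eta> g + w" by simp
  qed
  ultimately show ?thesis by linarith
qed

text \<open>The total variation distance on \<open>S\<close> of two conditional laws, in its functional form.\<close>

definition influence_le :: "(int ^ 'd) set \<Rightarrow> (int ^ 'd \<Rightarrow> 'b) \<Rightarrow> (int ^ 'd \<Rightarrow> 'b) \<Rightarrow> (int ^ 'd) set \<Rightarrow> real \<Rightarrow>
    bool" where
  "influence_le A \<eta> \<eta>' S \<tau> \<longleftrightarrow> (\<forall>g. depends_on g S \<and> (\<forall>y. 0 \<le> g y \<and> g y \<le> 1) \<longrightarrow>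
      \<bar>cexp A \<eta> g - cexp A \<eta>' g\<bar> \<le> \<tau>)"

lemma influence_leD: "influence_le A \<eta> \<eta>' S \<tau> \<Longrightarrow> depends_on g S \<Longrightarrow> (\<And>y. 0 \<le> g y \<and> g y \<le> 1) \<Longrightarrow>
    \<bar>cexp A \<eta> g - cexp A \<eta>' g\<bar> \<le> \<tau>"
  unfolding influence_le_def by blast

lemma influence_nonneg: "influence_le A \<eta> \<eta>' S \<tau> \<Longrightarrow> 0 \<le> \<tau>"
  using influence_leD[of A \<eta> \<eta>' S \<tau> "\<lambda>_. 0"] by (simp add: cexp_def)

lemma influence_mono: "influence_le A \<eta> \<eta>' S \<tau> \<Longrightarrow> T \<subseteq> S \<Longrightarrow> \<tau> \<le> \<tau>' \<Longrightarrow> influence_le A \<eta> \<eta>' T \<tau>'"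
  unfolding influence_le_def by (meson depends_on_mono order_trans)

lemma influence_one: "finite A \<Longrightarrow> finite S \<Longrightarrow> influence_le A \<eta> \<eta>' S 1"
  unfolding influence_le_def using cexp_unit_range[of A S] by (smt (verit, best))

text \<open>Sites of \<open>X\<close> are fixed to the common conditioning values, which loses nothing.\<close>

lemma influence_add_agree:
  assumes i: "influence_le A \<eta> \<eta>' S \<tau>" and "X \<subseteq> A" "\<And>i. i \<in> X \<Longrightarrow> \<eta> i = \<eta>' i"
  shows "influence_le A \<eta> \<eta>' (S \<union> X) \<tau>"
  unfolding influence_le_def
proof (intro allI impI)
  fix g :: "(int ^ 'd \<Rightarrow> 'b) \<Rightarrow> real" assume g: "depends_on g (S \<union> X) \<and> (\<forall>y. 0 \<le> g y \<and> g y \<le> 1)"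
  define h where "h y = g (\<lambda>i. if i \<in> X then \<eta> i else y i)" for y
  have "\<bar>cexp A \<eta> h - cexp A \<eta>' h\<bar> \<le> \<tau>"
  proof (rule influence_leD[OF i])
    show "depends_on h S" unfolding depends_on_def h_def
      using g by (auto intro!: depends_onD[of g "S \<union> X"])
  qed (use g h_def in auto)
  moreover have "cexp A \<eta> h = cexp A \<eta> g"
    unfolding h_def using assms g by (intro cexp_cong depends_onD[of g "S \<union> X"]) (auto simp: cyl_def)
  moreover have "cexp A \<eta>' h = cexp A \<eta>' g"
    unfolding h_def using assms g by (intro cexp_cong depends_onD[of g "S \<union> X"]) (auto simp: cyl_def)
  ultimately show "\<bar>cexp A \<eta> g - cexp A \<eta>' g\<bar> \<le> \<tau>" by simp
qed

text \<open>An affine map brings a function of oscillation \<open>w\<close> into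
  \<open>[0, 1]\<close>; the additive constant cancels because both conditioning patterns have
  positive probability.\<close>

lemma influence_scale:
  assumes i: "influence_le A \<eta> \<eta>' S \<tau>" and p: "pos A \<eta>" "pos A \<eta>'" and f: "finite A" "finite S"
      and d: "depends_on h S"
    and r: "\<And>y y'. \<bar>h y - h y'\<bar> \<le> w"
  shows "\<bar>cexp A \<eta> h - cexp A \<eta>' h\<bar> \<le> \<tau> * w"
proof -
  define l where "l = (INF y. h y)"
  obtain b where b: "\<And>y. \<bar>h y\<bar> \<le> b" using depends_on_bounded[OF f(2) d] by metis
  have bdd: "bdd_below (range h)" using b by (auto intro!: bdd_belowI[of _ "-b"] simp: abs_le_iff
      minus_le_iff)
  have l1: "l \<le> h y" for y unfolding l_def by (rule cINF_lower[OF bdd]) auto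
  have l2: "h y \<le> l + w" for y
  proof -
    have "h y - w \<le> h y'" for y' using r[of y y'] by linarith
    then have "h y - w \<le> l" unfolding l_def by (intro cINF_greatest) auto
    then show ?thesis by simp
  qed
  have w0: "0 \<le> w" using r[of undefined undefined] by simp
  show ?thesis
  \<comment> \<open>The rescaling divides by \<open>w\<close>, so constant functions are treated
    apart.\<close>
  proof (cases "w = 0")
    case True
    then have "h = (\<lambda>_. l)" using l1 l2 by (auto simp: fun_eq_iff intro: antisym)
    then show ?thesis using p f True by (simp add: cexp_const)
  next
    case False
    define g where "g y = (h y - l) / w" for y
    have g: "\<bar>cexp A \<eta> g - cexp A \<eta>' g\<bar> \<le> \<tau>"
    proof (rule influence_leD[OF i])
      show "depends_on g S" unfolding g_def using d by (rule depends_on_comp)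
      show "0 \<le> g y \<and> g y \<le> 1" for y using l1[of y] l2[of y] w0 False by (auto simp: g_def field_simps)
    qed
    have dg: "depends_on g S" unfolding g_def using d by (rule depends_on_comp)
    have hg: "h = (\<lambda>y. w * g y + l)" using False by (auto simp: g_def)
    have "cexp A z h = w * cexp A z g + l" if "pos A z" for z
      unfolding hg using that f depends_on_integrable[OF f(2) dg] by (subst cexp_add) (auto simp:
          cexp_cmult cexp_const)
    then have "cexp A \<eta> h - cexp A \<eta>' h = w * (cexp A \<eta> g - cexp A \<eta>' g)"
      using p by (simp add: algebra_simps)
    then show ?thesis using g w0 by (simp add: abs_mult mult.commute[of \<tau>] mult_left_mono)
  qed
qed

end

section \<open>From influences to Gaussian concentration\<close>

lemma l1_dist_commute: "l1_dist i j = l1_dist j i"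
  by (simp add: l1_dist_def abs_minus_commute)

lemma coord_le_l1_dist: "\<bar>i $ k - j $ k\<bar> \<le> int (l1_dist i j)"
proof -
  have "nat \<bar>i $ k - j $ k\<bar> \<le> l1_dist i j"
    unfolding l1_dist_def by (rule member_le_sum) auto
  then show ?thesis by linarith
qed

lemma l1_ball_bound:
  fixes v :: "int ^ 'd"
  shows "finite {j. l1_dist v j \<le> r}" (is "finite ?B")
    and "card {j. l1_dist v j \<le> r} \<le> (2 * r + 1) ^ CARD('d)"
proof -
  let ?P = "PiE (UNIV :: 'd set) (\<lambda>_. {- int r..int r})"
  let ?f = "\<lambda>j :: int ^ 'd. \<lambda>k. j $ k - v $ k"
  have inj: "inj_on ?f ?B" by (auto simp: inj_on_def fun_eq_iff vec_eq_iff)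
  have sub: "?f ` ?B \<subseteq> ?P"
  proof safe
    fix j k assume "l1_dist v j \<le> r"
    then have "\<bar>v $ k - j $ k\<bar> \<le> int r" using coord_le_l1_dist[of v k j] by linarith
    then show "j $ k - v $ k \<in> {- int r..int r}" by auto
  qed auto
  have fP: "finite ?P" by (intro finite_PiE) auto
  have cP: "card ?P = (2 * r + 1) ^ CARD('d)"
    by (subst card_PiE) (auto simp: nat_add_distrib nat_mult_distrib)
  show "finite ?B" using inj_on_finite[OF inj sub fP] .
  show "card ?B \<le> (2 * r + 1) ^ CARD('d)" using card_inj_on_le[OF inj sub fP] cP by simp
qed

lemma sum_inverse_squares_le: "(\<Sum>r\<le>R. 1 / (1 + real r)\<^sup>2) \<le> 2 - 1 / (1 + real R)"
proof (induction R)
  case (Suc R)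
  define x where "x = 1 + real R"
  have x: "x > 0" by (simp add: x_def)
  have "1 / (x + 1)\<^sup>2 \<le> 1 / (x * (x + 1))"
    using x by (intro divide_left_mono) (auto simp: power2_eq_square)
  also have "\<dots> = 1 / x - 1 / (x + 1)" using x by (simp add: field_simps)
  finally have "1 / (1 + real (Suc R))\<^sup>2 \<le> 1 / (1 + real R) - 1 / (1 + real (Suc R))"
    by (simp add: x_def add_ac)
  with Suc show ?case by simp
qed simp

text \<open>A sphere of radius \<open>r\<close> has at most \<open>(2 * r + 1) ^ d\<close> sites, so
  decay with exponent \<open>d + 2\<close> leaves the summable \<open>1 / (1 + r) ^ 2\<close>. This
  fixes the exponent required of influences throughout.\<close>

lemma sum_l1_dist_bound:
  fixes v :: "int ^ 'd"
  assumes "finite Q"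
  shows "(\<Sum>j\<in>Q. 1 / (1 + real (l1_dist v j)) ^ (CARD('d) + 2)) \<le> 2 ^ CARD('d) * 2"
proof -
  define R where "R = Max (insert 0 (l1_dist v ` Q))"
  have R: "l1_dist v ` Q \<subseteq> {..R}" unfolding R_def using assms by (auto intro!: Max_ge)
  have "(\<Sum>j\<in>Q. 1 / (1 + real (l1_dist v j)) ^ (CARD('d) + 2))
      = (\<Sum>r\<le>R. \<Sum>j\<in>{j\<in>Q. l1_dist v j = r}. 1 / (1 + real (l1_dist v j)) ^ (CARD('d) + 2))"
    using sum.group[OF assms _ R, of "\<lambda>j. 1 / (1 + real (l1_dist v j)) ^ (CARD('d) + 2)"] by simp
  also have "\<dots> \<le> (\<Sum>r\<le>R. 2 ^ CARD('d) * (1 / (1 + real r)\<^sup>2))"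
  proof (rule sum_mono)
    fix r
    have "card {j\<in>Q. l1_dist v j = r} \<le> card {j. l1_dist v j \<le> r}"
      by (intro card_mono l1_ball_bound) auto
    also have "\<dots> \<le> (2 * r + 1) ^ CARD('d)" by (rule l1_ball_bound)
    finally have "real (card {j\<in>Q. l1_dist v j = r}) \<le> real ((2 * r + 1) ^ CARD('d))"
      by (rule of_nat_mono)
    then have "real (card {j\<in>Q. l1_dist v j = r}) \<le> (2 * real r + 1) ^ CARD('d)"
      by (simp add: add.commute)
    also have "\<dots> \<le> (2 * (1 + real r)) ^ CARD('d)" by (intro power_mono) auto
    finally have c: "real (card {j\<in>Q. l1_dist v j = r}) \<le> 2 ^ CARD('d) * (1 + real r) ^ CARD('d)"
      by (simp only: power_mult_distrib)
    have "(\<Sum>j\<in>{j\<in>Q. l1_dist v j = r}. 1 / (1 + real (l1_dist v j)) ^ (CARD('d) + 2))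
       = real (card {j\<in>Q. l1_dist v j = r}) * (1 / (1 + real r) ^ (CARD('d) + 2))" by simp
    also have "\<dots> \<le> (2 ^ CARD('d) * (1 + real r) ^ CARD('d)) * (1 / (1 + real r) ^ (CARD('d) + 2))"
      by (intro mult_right_mono c) auto
    also have "\<dots> = 2 ^ CARD('d) * (1 / (1 + real r)\<^sup>2)"
      by (simp add: power_add power2_eq_square)
    finally show "(\<Sum>j\<in>{j\<in>Q. l1_dist v j = r}. 1 / (1 + real (l1_dist v j)) ^ (CARD('d) + 2)) \<le> \<dots>" .
  qed
  also have "\<dots> = 2 ^ CARD('d) * (\<Sum>r\<le>R. 1 / (1 + real r)\<^sup>2)" by (rule sum_distrib_left[symmetric])
  also have "\<dots> \<le> 2 ^ CARD('d) * 2"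
    using sum_inverse_squares_le[of R] by (intro mult_left_mono) (auto intro: order_trans)
  finally show ?thesis .
qed

text \<open>Each weight is written as a product of two square roots before Cauchy-Schwarz. The row
  sums bound one factor, and the column sums the other after the order of summation is
  exchanged.\<close>

lemma schur_test:
  fixes \<Phi> :: "'a \<Rightarrow> 'c \<Rightarrow> real"
  assumes "\<And>v j. \<Phi> v j \<ge> 0" "\<And>v. v \<in> Q \<Longrightarrow> (\<Sum>j\<in>D. \<Phi> v j) \<le> S" "\<And>j. j \<in> D \<Longrightarrow> (\<Sum>v\<in>Q. \<Phi> v j) \<le> S" "S \<ge> 0"
  shows "(\<Sum>v\<in>Q. (\<Sum>j\<in>D. \<Phi> v j * x j)\<^sup>2) \<le> S\<^sup>2 * (\<Sum>j\<in>D. (x j)\<^sup>2)"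
proof -
  have "(\<Sum>j\<in>D. \<Phi> v j * x j)\<^sup>2 \<le> S * (\<Sum>j\<in>D. \<Phi> v j * (x j)\<^sup>2)" if "v \<in> Q" for v
  proof -
    have "(\<Sum>j\<in>D. \<Phi> v j * x j)\<^sup>2 = (\<Sum>j\<in>D. sqrt (\<Phi> v j) * (sqrt (\<Phi> v j) * x j))\<^sup>2"
      using assms(1) by (simp add: mult.assoc[symmetric])
    also have "\<dots> \<le> (\<Sum>j\<in>D. (sqrt (\<Phi> v j))\<^sup>2) * (\<Sum>j\<in>D. (sqrt (\<Phi> v j) * x j)\<^sup>2)"
      by (rule Cauchy_Schwarz_ineq_sum)
    also have "\<dots> = (\<Sum>j\<in>D. \<Phi> v j) * (\<Sum>j\<in>D. \<Phi> v j * (x j)\<^sup>2)"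
      using assms(1) by (simp add: power_mult_distrib)
    also have "\<dots> \<le> S * (\<Sum>j\<in>D. \<Phi> v j * (x j)\<^sup>2)"
      using assms that by (intro mult_right_mono sum_nonneg) auto
    finally show ?thesis .
  qed
  then have "(\<Sum>v\<in>Q. (\<Sum>j\<in>D. \<Phi> v j * x j)\<^sup>2) \<le> (\<Sum>v\<in>Q. S * (\<Sum>j\<in>D. \<Phi> v j * (x j)\<^sup>2))"
    by (rule sum_mono)
  also have "\<dots> = S * (\<Sum>v\<in>Q. \<Sum>j\<in>D. \<Phi> v j * (x j)\<^sup>2)" by (rule sum_distrib_left[symmetric])
  also have "(\<Sum>v\<in>Q. \<Sum>j\<in>D. \<Phi> v j * (x j)\<^sup>2) = (\<Sum>j\<in>D. (\<Sum>v\<in>Q. \<Phi> v j) * (x j)\<^sup>2)"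
    by (subst sum.swap) (simp add: sum_distrib_right)
  also have "S * \<dots> \<le> S * (\<Sum>j\<in>D. S * (x j)\<^sup>2)"
    using assms by (intro mult_left_mono sum_mono mult_right_mono) auto
  also have "\<dots> = S\<^sup>2 * (\<Sum>j\<in>D. (x j)\<^sup>2)"
    by (simp add: power2_eq_square sum_distrib_left mult.assoc)
  finally show ?thesis .
qed

section \<open>Exponential moments along a revealing order\<close>

context random_field
begin

lemma integral_uniform_cyl:
  assumes "finite A" "pos A \<eta>" "g \<in> borel_measurable \<nu>"
  shows "(\<integral>y. g y \<partial>uniform_measure \<nu> (cyl A \<eta>)) = cexp A \<eta> g"
proof -
  have e: "uniform_measure \<nu> (cyl A \<eta>) = density \<nu> (\<lambda>y. ennreal (indicator (cyl A \<eta>) y / measure \<nu> (cyl A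
      \<eta>)))"
    unfolding uniform_measure_def using assms
    by (intro arg_cong2[where f = density] refl ext)
       (auto simp: emeasure_eq_measure divide_ennreal[symmetric] ennreal_indicator)
  have "(\<integral>y. g y \<partial>uniform_measure \<nu> (cyl A \<eta>)) = (\<integral>y. (indicator (cyl A \<eta>) y / measure \<nu> (cyl A \<eta>)) *\<^sub>R g
      y \<partial>\<nu>)"
    unfolding e using assms by (intro integral_density) auto
  also have "\<dots> = cexp A \<eta> g" by (simp add: cexp_def)
  finally show ?thesis .
qed

text \<open>This is Hoeffding's lemma under the measure conditioned on the cylinder. Bounds on
  \<open>h\<close> at patterns of positive probability are enough for the almost sure bounds which
  that lemma asks for.\<close>

lemma cexp_hoeffding:
  assumes "finite V" "pos V \<eta>" "finite W" "depends_on h W" "t > 0"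
    and rng: "\<And>y. y \<in> cyl V \<eta> \<Longrightarrow> pos W y \<Longrightarrow> a \<le> h y \<and> h y \<le> b"
  shows "cexp V \<eta> (\<lambda>y. exp (t * h y)) \<le> exp (t * cexp V \<eta> h) * exp (t\<^sup>2 * (b - a)\<^sup>2 / 8)"
proof -
  let ?U = "uniform_measure \<nu> (cyl V \<eta>)"
  have em: "emeasure \<nu> (cyl V \<eta>) \<noteq> 0" using assms(2) by (simp add: emeasure_eq_measure)
  interpret U: prob_space ?U
    using em by (intro prob_space_uniform_measure) (auto simp: emeasure_eq_measure)
  have hm: "h \<in> borel_measurable \<nu>" by (rule depends_on_measurable[OF assms(3,4)])
  interpret U: interval_bounded_random_variable ?U h a b
  proof
    show "h \<in> borel_measurable ?U" using hm by simp
    have "AE y in \<nu>. y \<in> cyl V \<eta> \<longrightarrow> h y \<in> {a..b}"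
      using AE_pos[OF assms(3)] by (rule AE_mp) (use rng in auto)
    then show "AE y in ?U. h y \<in> {a..b}"
      using assms(1) by (intro AE_uniform_measureI) auto
  qed
  have mean: "U.expectation h = cexp V \<eta> h"
    by (rule integral_uniform_cyl[OF assms(1,2) hm])
  define m where "m = cexp V \<eta> h"
  have d: "depends_on (\<lambda>y. exp (t * (h y - m))) W" by (rule depends_on_comp[OF assms(4)])
  obtain B where B: "\<And>y. \<bar>exp (t * (h y - m))\<bar> \<le> B" using depends_on_bounded[OF assms(3) d] by metis
  have int: "integrable ?U (\<lambda>y. exp (t * (h y - m)))"
    using hm by (intro U.integrable_const_bound[where B = B]) (use B in auto)
  have "ennreal (\<integral>y. exp (t * (h y - m)) \<partial>?U) = (\<integral>\<^sup>+y. exp (t * (h y - m)) \<partial>?U)"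
    by (rule nn_integral_eq_integral[OF int, symmetric]) auto
  also have "\<dots> \<le> ennreal (exp (t\<^sup>2 * (b - a)\<^sup>2 / 8))"
    using U.Hoeffdings_lemma_nn_integral[OF assms(5)] mean by (simp add: m_def)
  finally have 1: "(\<integral>y. exp (t * (h y - m)) \<partial>?U) \<le> exp (t\<^sup>2 * (b - a)\<^sup>2 / 8)"
    by simp
  have "cexp V \<eta> (\<lambda>y. exp (t * h y)) = cexp V \<eta> (\<lambda>y. exp (t * m) * exp (t * (h y - m)))"
    by (simp add: mult_exp_exp algebra_simps)
  also have "\<dots> = exp (t * m) * cexp V \<eta> (\<lambda>y. exp (t * (h y - m)))" by (rule cexp_cmult)
  also have "cexp V \<eta> (\<lambda>y. exp (t * (h y - m))) = (\<integral>y. exp (t * (h y - m)) \<partial>?U)"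
    by (rule integral_uniform_cyl[symmetric, OF assms(1,2) depends_on_measurable[OF assms(3) d]])
  finally show ?thesis using 1 by (simp add: m_def)
qed

text \<open>Given the pattern on \<open>V\<close>, the variable \<open>cexp W y f\<close> has mean
  \<open>cexp V y f\<close> by the tower property, so Hoeffding's lemma applies conditionally and
  the result is averaged over the patterns on \<open>V\<close>.\<close>

lemma martingale_step:
  assumes "finite W" "V \<subseteq> W" "finite \<Delta>" "depends_on f \<Delta>" "t > 0" "c \<ge> 0"
    and osc: "\<And>\<eta> \<eta>'. (\<forall>i\<in>V. \<eta> i = \<eta>' i) \<Longrightarrow> pos W \<eta> \<Longrightarrow> pos W \<eta>' \<Longrightarrow> \<bar>cexp W \<eta> f - cexp W \<eta>' f\<bar> \<le> c"
  shows "(\<integral>y. exp (t * cexp W y f) \<partial>\<nu>) \<le> exp (t\<^sup>2 * c\<^sup>2 / 8) * (\<integral>y. exp (t * cexp V y f) \<partial>\<nu>)"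
proof -
  have fV: "finite V" using assms finite_subset by blast
  let ?h = "\<lambda>y. cexp W y f" let ?e = "\<lambda>y. exp (t * cexp W y f)"
  have dh: "depends_on ?h W" by (rule depends_on_cexp)
  have de: "depends_on ?e W" by (rule depends_on_comp[OF dh])
  have dV: "depends_on (\<lambda>y. exp (t * cexp V y f)) V" by (rule depends_on_comp[OF depends_on_cexp])
  have inth: "integrable \<nu> ?h" "integrable \<nu> ?e"
    using dh de assms(1) depends_on_integrable by blast+
  have intf: "integrable \<nu> f" using assms(3,4) depends_on_integrable by blast
  have step: "cexp V \<eta> ?e \<le> exp (t\<^sup>2 * c\<^sup>2 / 8) * exp (t * cexp V \<eta> f)" if p: "pos V \<eta>" for \<eta>
  proof -
    define X where "X = ?h ` {y \<in> cyl V \<eta>. pos W y}"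
    have X: "\<bar>x - x'\<bar> \<le> c" if "x \<in> X" "x' \<in> X" for x x'
      using that unfolding X_def by (auto intro!: osc simp: cyl_def)
    have bdd: "bdd_below X"
    proof (cases "X = {}")
      case False
      then obtain x where "x \<in> X" by blast
      show ?thesis
      proof (rule bdd_belowI)
        fix x' assume "x' \<in> X"
        from X[OF \<open>x \<in> X\<close> this] show "x - c \<le> x'" by linarith
      qed
    qed simp
    \<comment> \<open>The values in \<open>X\<close> differ pairwise by at most \<open>c\<close>, so
      they lie in the interval of length exactly \<open>c\<close> that starts at their infimum. An
      interval around one of the values would have length \<open>2 * c\<close>.\<close>
    have "cexp V \<eta> ?e \<le> exp (t * cexp V \<eta> ?h) * exp (t\<^sup>2 * ((Inf X + c) - Inf X)\<^sup>2 / 8)"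
    proof (rule cexp_hoeffding[OF fV p assms(1) dh assms(5)])
      fix y assume y: "y \<in> cyl V \<eta>" "pos W y"
      then have yX: "?h y \<in> X" by (auto simp: X_def)
      moreover have "?h y - c \<le> Inf X"
        using yX X[OF yX] by (intro cInf_greatest) (auto simp: abs_le_iff algebra_simps)
      ultimately show "Inf X \<le> ?h y \<and> ?h y \<le> Inf X + c" using bdd by (auto intro: cInf_lower)
    qed
    also have "cexp V \<eta> ?h = cexp V \<eta> f" by (rule cexp_tower[OF assms(2,1) intf])
    finally show ?thesis by (simp add: mult.commute)
  qed
  have "(\<integral>y. ?e y \<partial>\<nu>) = (\<integral>y. cexp V y ?e \<partial>\<nu>)"
    using cexp_tower[of "{}" V ?e undefined] fV inth(2) by simp
  also have "\<dots> \<le> (\<integral>y. exp (t\<^sup>2 * c\<^sup>2 / 8) * exp (t * cexp V y f) \<partial>\<nu>)"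
  proof (rule integral_mono_AE)
    show "integrable \<nu> (\<lambda>y. cexp V y ?e)" using depends_on_integrable[OF fV depends_on_cexp] .
    show "integrable \<nu> (\<lambda>y. exp (t\<^sup>2 * c\<^sup>2 / 8) * exp (t * cexp V y f))"
      using depends_on_integrable[OF fV dV] by simp
    show "AE y in \<nu>. cexp V y ?e \<le> exp (t\<^sup>2 * c\<^sup>2 / 8) * exp (t * cexp V y f)"
      using AE_pos[OF fV] by (rule AE_mp) (use step in simp)
  qed
  finally show ?thesis by simp
qed

text \<open>The induction takes away the site of largest key, the last one revealed. The initial
  segments belonging to the other sites do not change, so the hypothesis on oscillations passes to
  the smaller set.\<close>

lemma martingale_bound:
  fixes \<kappa> :: "int ^ 'd \<Rightarrow> int"
  assumes "finite Q" "inj_on \<kappa> Q" "finite \<Delta>" "depends_on f \<Delta>" "t > 0" "\<And>v. c v \<ge> 0"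
    and osc: "\<And>v \<eta> \<eta>'. v \<in> Q \<Longrightarrow> (\<forall>i\<in>{i\<in>Q. \<kappa> i < \<kappa> v}. \<eta> i = \<eta>' i) \<Longrightarrow> pos {i\<in>Q. \<kappa> i \<le> \<kappa> v} \<eta> \<Longrightarrow>
        pos {i\<in>Q. \<kappa> i \<le> \<kappa> v} \<eta>'
       \<Longrightarrow> \<bar>cexp {i\<in>Q. \<kappa> i \<le> \<kappa> v} \<eta> f - cexp {i\<in>Q. \<kappa> i \<le> \<kappa> v} \<eta>' f\<bar> \<le> c v"
  shows "(\<integral>y. exp (t * cexp Q y f) \<partial>\<nu>) \<le> exp (t\<^sup>2 * (\<Sum>v\<in>Q. (c v)\<^sup>2) / 8) * exp (t * (\<integral>y. f y \<partial>\<nu>))"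
  using assms(1,2,7)
proof (induction "card Q" arbitrary: Q)
  case 0
  then show ?case using prob_space by simp
next
  case (Suc n)
  have ne: "Q \<noteq> {}" using Suc.hyps by auto
  define m where "m = Max (\<kappa> ` Q)"
  have "m \<in> \<kappa> ` Q" unfolding m_def using Suc.prems ne by (intro Max_in) auto
  then obtain v where v: "v \<in> Q" "\<kappa> v = m" by auto
  have le: "\<kappa> i \<le> \<kappa> v" if "i \<in> Q" for i using that v Suc.prems by (auto simp: m_def)
  have lt: "\<kappa> i < \<kappa> v" if "i \<in> Q - {v}" for i using
      le[of i] that v Suc.prems(2) by (auto simp: inj_on_def order_le_less)
  define V where "V = Q - {v}"
  have Qv: "{i\<in>Q. \<kappa> i \<le> \<kappa> v} = Q" "{i\<in>Q. \<kappa> i < \<kappa> v} = V"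
    using le lt by (auto simp: V_def)
  have cV: "card V = n" "finite V" "inj_on \<kappa> V" using Suc.hyps Suc.prems v by (auto simp: V_def inj_on_def)
  have same: "{i\<in>V. \<kappa> i \<le> \<kappa> u} = {i\<in>Q. \<kappa> i \<le> \<kappa> u}" "{i\<in>V. \<kappa> i < \<kappa> u} = {i\<in>Q. \<kappa> i < \<kappa> u}" if "u \<in> V" for u
    using lt[of u] that by (auto simp: V_def)
  have IH: "(\<integral>y. exp (t * cexp V y f) \<partial>\<nu>) \<le> exp (t\<^sup>2 * (\<Sum>v\<in>V. (c v)\<^sup>2) / 8) * exp (t * (\<integral>y. f y \<partial>\<nu>))"
  proof (rule Suc.hyps(1)[OF cV(1)[symmetric] cV(2,3)])
    fix u \<eta> \<eta>' assume a: "u \<in> V" "\<forall>i\<in>{i\<in>V. \<kappa> i < \<kappa> u}. \<eta> i = \<eta>' i" "pos {i\<in>V. \<kappa> i \<le> \<kappa> u} \<eta>"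
        "pos {i\<in>V. \<kappa> i \<le> \<kappa> u} \<eta>'"
    have "u \<in> Q" using a(1) by (simp add: V_def)
    from Suc.prems(3)[OF this a(2-)[unfolded same[OF a(1)]]]
    show "\<bar>cexp {i\<in>V. \<kappa> i \<le> \<kappa> u} \<eta> f - cexp {i\<in>V. \<kappa> i \<le> \<kappa> u} \<eta>' f\<bar> \<le> c u"
      unfolding same[OF a(1)] .
  qed
  have "(\<integral>y. exp (t * cexp Q y f) \<partial>\<nu>) \<le> exp (t\<^sup>2 * (c v)\<^sup>2 / 8) * (\<integral>y. exp (t * cexp V y f) \<partial>\<nu>)"
    using Suc.prems(3)[OF v(1), unfolded Qv] Suc.prems(1) assms(3-6)
    by (intro martingale_step[where \<Delta> = \<Delta>]) (auto simp: V_def)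
  also have "\<dots> \<le> exp (t\<^sup>2 * (c v)\<^sup>2 / 8) * (exp (t\<^sup>2 * (\<Sum>v\<in>V. (c v)\<^sup>2) / 8) * exp (t * (\<integral>y. f y \<partial>\<nu>)))"
    by (intro mult_left_mono IH) auto
  also have "\<dots> = exp (t\<^sup>2 * (\<Sum>v\<in>Q. (c v)\<^sup>2) / 8) * exp (t * (\<integral>y. f y \<partial>\<nu>))"
    using v(1) Suc.prems(1) by (simp add: V_def sum.remove[of Q v] mult_exp_exp distrib_left
        add_divide_distrib)
  finally show ?case .
qed

text \<open>Freezing the sites of \<open>\<Delta>\<close> one at a time, in order of increasing \<open>w\<close>, writes \<open>f\<close> as a sum of
  functions that each depend only on the sites beyond the frozen one.\<close>

lemma cexp_diff_le_sum:
  fixes w :: "int ^ 'd \<Rightarrow> nat" and f :: "(int ^ 'd \<Rightarrow> 'b) \<Rightarrow> real"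
  assumes p: "pos A \<eta>" "pos A \<eta>'" and A: "finite A"
  shows "finite \<Delta> \<Longrightarrow> depends_on f \<Delta> \<Longrightarrow>
     (\<And>j y y'. (\<forall>l. l \<noteq> j \<longrightarrow> y l = y' l) \<Longrightarrow> \<bar>f y - f y'\<bar> \<le> D j) \<Longrightarrow>
     (\<And>j. j \<in> \<Delta> \<Longrightarrow> influence_le A \<eta> \<eta>' {i\<in>\<Delta>. w j \<le> w i} (\<phi> j)) \<Longrightarrow>
     \<bar>cexp A \<eta> f - cexp A \<eta>' f\<bar> \<le> (\<Sum>j\<in>\<Delta>. \<phi> j * (2 * D j))"
proof (induction "card \<Delta>" arbitrary: \<Delta> f)
  case 0
  then have "f = (\<lambda>_. f undefined)" by (auto simp: depends_on_def)
  then have "cexp A z f = f undefined" if "pos A z" for z using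
      cexp_const[OF that A, of "f undefined"] by simp
  then show ?case using p 0 by simp
next
  case (Suc n)
  have ne: "\<Delta> \<noteq> {}" using Suc.hyps by auto
  define m where "m = Min (w ` \<Delta>)"
  have "m \<in> w ` \<Delta>" unfolding m_def using Suc.prems ne by (intro Min_in) auto
  then obtain j where j: "j \<in> \<Delta>" "w j = m" by auto
  have le: "w j \<le> w i" if "i \<in> \<Delta>" for i using that j Suc.prems by (auto simp: m_def)
  \<comment> \<open>\<open>undefined\<close> is an arbitrary fixed letter. The difference
    \<open>f - f'\<close> vanishes when \<open>j\<close> carries this letter; each of its values is
    at most \<open>D j\<close> in absolute value, whence the oscillation
    \<open>2 * D j\<close>.\<close>
  define f' where "f' y = f (y(j := undefined))" for y
  define \<Delta>' where "\<Delta>' = \<Delta> - {j}"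
  have d': "depends_on f' \<Delta>'"
    unfolding depends_on_def f'_def \<Delta>'_def by (auto intro!: depends_onD[OF Suc.prems(2)])
  have f\<Delta>': "finite \<Delta>'" "card \<Delta>' = n" using Suc.hyps Suc.prems j by (auto simp: \<Delta>'_def)
  have dd: "depends_on (\<lambda>y. f y - f' y) \<Delta>"
    using depends_on_comp2[OF Suc.prems(2) depends_on_mono[OF d', of \<Delta>]] by (auto simp: \<Delta>'_def)
  have i: "influence_le A \<eta> \<eta>' \<Delta> (\<phi> j)"
  proof -
    have "{i\<in>\<Delta>. w j \<le> w i} = \<Delta>" using le by auto
    then show ?thesis using Suc.prems(4)[OF j(1)] by simp
  qed
  have r: "\<bar>(f y - f' y) - (f y' - f' y')\<bar> \<le> 2 * D j" for y y'
    using Suc.prems(3)[of j y "y(j := undefined)"] Suc.prems(3)[of j y' "y'(j := undefined)"]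
    by (simp add: f'_def abs_le_iff)
  have 1: "\<bar>cexp A \<eta> (\<lambda>y. f y - f' y) - cexp A \<eta>' (\<lambda>y. f y - f' y)\<bar> \<le> \<phi> j * (2 * D j)"
    by (rule influence_scale[OF i p A Suc.prems(1) dd r])
  have 2: "\<bar>cexp A \<eta> f' - cexp A \<eta>' f'\<bar> \<le> (\<Sum>j\<in>\<Delta>'. \<phi> j * (2 * D j))"
  proof (rule Suc.hyps(1)[OF f\<Delta>'(2)[symmetric] f\<Delta>'(1) d'])
    fix k and y y' :: "int ^ 'd \<Rightarrow> 'b" assume "\<forall>l. l \<noteq> k \<longrightarrow> y l = y' l"
    then show "\<bar>f' y - f' y'\<bar> \<le> D k" unfolding f'_def by (intro Suc.prems(3)) auto
  next
    fix k assume "k \<in> \<Delta>'"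
    then show "influence_le A \<eta> \<eta>' {i \<in> \<Delta>'. w k \<le> w i} (\<phi> k)"
      using Suc.prems(4)[of k] by (auto elim!: influence_mono simp: \<Delta>'_def)
  qed
  have intf: "integrable \<nu> f" "integrable \<nu> f'"
    using depends_on_integrable Suc.prems(1,2) f\<Delta>'(1) d' by blast+
  have "(\<Sum>j\<in>\<Delta>. \<phi> j * (2 * D j)) = \<phi> j * (2 * D j) + (\<Sum>j\<in>\<Delta>'. \<phi> j * (2 * D j))"
    unfolding \<Delta>'_def by (rule sum.remove[OF Suc.prems(1) j(1)])
  then show ?case using 1 2 unfolding cexp_diff[OF A intf] by linarith
qed

lemma delta_bound: "bdd_above (oscillations f j) \<Longrightarrow> (\<forall>l. l \<noteq> j \<longrightarrow> y l = y' l) \<Longrightarrow> \<bar>f y - f y'\<bar> \<le> delta f j"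
  unfolding delta_def by (rule cSup_upper) (auto simp: oscillations_def)

lemma delta_nonneg: "bdd_above (oscillations f j) \<Longrightarrow> 0 \<le> delta f j"
  using delta_bound[of f j "\<lambda>_. undefined" "\<lambda>_. undefined"] by auto

lemma delta_norm_sq_eq:
  fixes f :: "(int ^ 'd \<Rightarrow> 'b) \<Rightarrow> real"
  assumes "finite \<Delta>" "depends_on f \<Delta>"
  shows "delta_norm_sq f = (\<Sum>j\<in>\<Delta>. (delta f j)\<^sup>2)"
proof -
  have 0: "delta f j = 0" if "j \<notin> \<Delta>" for j
  proof -
    have "f y = f y'" if "\<forall>l. l \<noteq> j \<longrightarrow> y l = y' l" for y y'
      by (rule depends_onD[OF assms(2)]) (use that \<open>j \<notin> \<Delta>\<close> in metis)
    then have e: "oscillations f j = {0}"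
      unfolding oscillations_def by (auto intro!: exI[of _ undefined])
    show ?thesis unfolding delta_def e by simp
  qed
  have "delta_norm_sq f = (\<Sum>\<^sub>\<infinity>j\<in>\<Delta>. (delta f j)\<^sup>2)"
    unfolding delta_norm_sq_def by (rule infsum_cong_neutral) (use 0 in auto)
  then show ?thesis using assms(1) by simp
qed

text \<open>The decaying part of the influence gives a kernel with bounded row and column sums. The
  part \<open>e\<close> may depend on \<open>\<Delta>\<close>, since
  \<open>e * card Q \<le> 1\<close> lets it add at most 1 to each of these sums; only
  \<open>C0\<close> has to be uniform. The set \<open>Q\<close> may be larger than
  \<open>\<Delta>\<close>, so that a geometrically convenient order is available.\<close>

theorem gaussian_concentration_of_influences:
  fixes C0 :: real
  assumes C0: "C0 \<ge> 0"
    and *: "\<And>\<Delta>. finite \<Delta> \<Longrightarrow> \<exists>Q (\<kappa> :: int ^ 'd \<Rightarrow> int) e. finite Q \<and> \<Delta> \<subseteq> Q \<and> inj_on \<kappa> Q \<and> e \<ge> 0 \<and>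
        e * real (card Q) \<le> 1 \<and>
      (\<forall>v\<in>Q. \<forall>r \<eta> \<eta>'. (\<forall>i\<in>{i\<in>Q. \<kappa> i < \<kappa> v}. \<eta> i = \<eta>' i) \<longrightarrow> pos {i\<in>Q. \<kappa> i \<le> \<kappa> v} \<eta> \<longrightarrow> pos {i\<in>Q. \<kappa> i \<le> \<kappa> v} \<eta>' \<longrightarrow>
         influence_le {i\<in>Q. \<kappa> i \<le> \<kappa> v} \<eta> \<eta>' {j\<in>\<Delta>. r \<le> l1_dist v j} (C0 / (1 + real r) ^ (CARD('d) + 2) +
             e))"
  shows "gaussian_concentration \<nu>"
proof -
  define S where "S = C0 * (2 ^ CARD('d) * 2) + 1"
  have S: "S > 0" using C0 by (simp add: S_def add_nonneg_pos)
  show ?thesis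
    unfolding gaussian_concentration_def
  \<comment> \<open>Schur's test bounds the sum of the squared oscillations by
    \<open>S\<^sup>2 * 4 * delta_norm_sq f\<close>, the 4 coming from \<open>2 * delta f j\<close>.
    Hoeffding's factor 1/8 turns this into \<open>S\<^sup>2 / 2\<close>.\<close>
  proof (intro exI[of _ "S\<^sup>2"] conjI allI impI, goal_cases)
    case 1
    then show ?case using S by simp
  next
    case (2 f t)
    then obtain \<Delta> where \<Delta>: "finite \<Delta>" "depends_on f \<Delta>" and bdd: "\<And>j. bdd_above (oscillations f j)"
        and t: "t > 0"
      unfolding local_function_def depends_on_def by blast
    obtain Q :: "(int ^ 'd) set" and \<kappa> :: "int ^ 'd \<Rightarrow> int" and e where
      H: "finite Q \<and> \<Delta> \<subseteq> Q \<and> inj_on \<kappa> Q \<and> e \<ge> 0 \<and> e * real (card Q) \<le> 1 \<and>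
      (\<forall>v\<in>Q. \<forall>r \<eta> \<eta>'. (\<forall>i\<in>{i\<in>Q. \<kappa> i < \<kappa> v}. \<eta> i = \<eta>' i) \<longrightarrow> pos {i\<in>Q. \<kappa> i \<le> \<kappa> v} \<eta> \<longrightarrow> pos {i\<in>Q. \<kappa> i \<le> \<kappa> v} \<eta>' \<longrightarrow>
         influence_le {i\<in>Q. \<kappa> i \<le> \<kappa> v} \<eta> \<eta>' {j\<in>\<Delta>. r \<le> l1_dist v j} (C0 / (1 + real r) ^ (CARD('d) + 2) +
             e))"
      using *[OF \<Delta>(1)] by (elim exE) (rule that)
    then have Q: "finite Q" "\<Delta> \<subseteq> Q" "inj_on \<kappa> Q" and e: "e \<ge> 0" "e * real (card Q) \<le> 1"
      by auto
    have influence_le: "influence_le {i\<in>Q. \<kappa> i \<le> \<kappa> v} \<eta> \<eta>' {j\<in>\<Delta>. r \<le> l1_dist v j} (C0 / (1 + real r) ^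
        (CARD('d) + 2) + e)"
      if "v \<in> Q" "\<forall>i\<in>{i\<in>Q. \<kappa> i < \<kappa> v}. \<eta> i = \<eta>' i" "pos {i\<in>Q. \<kappa> i \<le> \<kappa> v} \<eta>" "pos {i\<in>Q. \<kappa> i \<le> \<kappa> v} \<eta>'" for
          v r \<eta> \<eta>'
      using H that by blast
    define \<Phi> where "\<Phi> v j = C0 / (1 + real (l1_dist v j)) ^ (CARD('d) + 2) + e" for v j :: "int ^ 'd"
    define c where "c v = (\<Sum>j\<in>\<Delta>. \<Phi> v j * (2 * delta f j))" for v
    have \<Phi>0: "\<Phi> v j \<ge> 0" for v j unfolding \<Phi>_def using
        C0 e by (intro add_nonneg_nonneg divide_nonneg_nonneg) auto
    have c0: "c v \<ge> 0" for v unfolding c_def using \<Phi>0 delta_nonneg[OF bdd] by (intro sum_nonneg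
        mult_nonneg_nonneg) auto
    have row: "(\<Sum>j\<in>X. \<Phi> v j) \<le> S" if "X \<subseteq> Q" for v X
    proof -
      have fX: "finite X" using that Q(1) finite_subset by blast
      have "(\<Sum>j\<in>X. \<Phi> v j) = C0 * (\<Sum>j\<in>X. 1 / (1 + real (l1_dist v j)) ^ (CARD('d) + 2)) + real (card X) * e"
        by (simp add: \<Phi>_def sum.distrib sum_distrib_left)
      moreover have "real (card X) * e \<le> 1"
      proof -
        have "real (card X) * e \<le> real (card Q) * e"
          using e card_mono[OF Q(1) that] by (intro mult_right_mono) auto
        then show ?thesis using e by (simp add: mult.commute)
      qed
      moreover have "C0 * (\<Sum>j\<in>X. 1 / (1 + real (l1_dist v j)) ^ (CARD('d) + 2)) \<le> C0 * (2 ^ CARD('d) * 2)"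
        by (intro mult_left_mono sum_l1_dist_bound fX C0)
      ultimately show ?thesis by (simp add: S_def)
    qed
    have col: "(\<Sum>v\<in>Q. \<Phi> v j) \<le> S" for j
      using row[of Q j] by (simp add: \<Phi>_def l1_dist_commute[of _ j])
    have sum_c: "(\<Sum>v\<in>Q. (c v)\<^sup>2) \<le> S\<^sup>2 * (4 * delta_norm_sq f)"
    proof -
      have "(\<Sum>v\<in>Q. (c v)\<^sup>2) \<le> S\<^sup>2 * (\<Sum>j\<in>\<Delta>. (2 * delta f j)\<^sup>2)"
        unfolding c_def using \<Phi>0 row[OF Q(2)] col S by (intro schur_test) auto
      also have "(\<Sum>j\<in>\<Delta>. (2 * delta f j)\<^sup>2) = 4 * delta_norm_sq f"
        by (simp add: delta_norm_sq_eq[OF \<Delta>] power_mult_distrib sum_distrib_left)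
      finally show ?thesis .
    qed
    define m where "m = (\<integral>x. f x \<partial>\<nu>)"
    have "(\<integral>y. exp (t * cexp Q y f) \<partial>\<nu>) \<le> exp (t\<^sup>2 * (\<Sum>v\<in>Q. (c v)\<^sup>2) / 8) * exp (t * m)"
      unfolding m_def
    proof (rule martingale_bound[OF Q(1,3) \<Delta> t c0])
      fix v \<eta> \<eta>'
      assume a: "v \<in> Q" "\<forall>i\<in>{i\<in>Q. \<kappa> i < \<kappa> v}. \<eta> i = \<eta>' i" "pos {i\<in>Q. \<kappa> i \<le> \<kappa> v} \<eta>" "pos {i\<in>Q. \<kappa> i \<le> \<kappa> v} \<eta>'"
      show "\<bar>cexp {i\<in>Q. \<kappa> i \<le> \<kappa> v} \<eta> f - cexp {i\<in>Q. \<kappa> i \<le> \<kappa> v} \<eta>' f\<bar> \<le> c v"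
        unfolding c_def
      proof (rule cexp_diff_le_sum[where w = "l1_dist v", OF a(3,4) _ \<Delta>])
        fix j assume "j \<in> \<Delta>"
        show "influence_le {i\<in>Q. \<kappa> i \<le> \<kappa> v} \<eta> \<eta>' {i\<in>\<Delta>. l1_dist v j \<le> l1_dist v i} (\<Phi> v j)"
          unfolding \<Phi>_def by (rule influence_le[OF a])
      qed (use Q(1) delta_bound[OF bdd] in auto)
    qed
    \<comment> \<open>Once all of \<open>Q\<close> is revealed, \<open>f\<close> is known, because
      \<open>\<Delta> \<subseteq> Q\<close>.\<close>
    also have "(\<integral>y. exp (t * cexp Q y f) \<partial>\<nu>) = (\<integral>y. exp (t * f y) \<partial>\<nu>)"
    proof (rule integral_cong_AE)
      have cf: "cexp Q y f = f y" if "pos Q y" for y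
      proof -
        have "cexp Q y f = cexp Q y (\<lambda>_. f y)"
          using Q(2) by (intro cexp_cong depends_onD[OF \<Delta>(2)]) (auto simp: cyl_def)
        then show ?thesis using cexp_const[OF that Q(1)] by simp
      qed
      show "AE y in \<nu>. exp (t * cexp Q y f) = exp (t * f y)"
        using AE_pos[OF Q(1)]
      proof (rule AE_mp, intro AE_I2 impI)
        fix y assume "pos Q y"
        from cf[OF this] show "exp (t * cexp Q y f) = exp (t * f y)" by (rule arg_cong)
      qed
      show "(\<lambda>y. exp (t * cexp Q y f)) \<in> borel_measurable \<nu>"
        by (rule depends_on_measurable[OF Q(1) depends_on_comp[OF depends_on_cexp]])
      show "(\<lambda>y. exp (t * f y)) \<in> borel_measurable \<nu>"
        by (rule depends_on_measurable[OF \<Delta>(1) depends_on_comp[OF \<Delta>(2)]])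
    qed
    finally have 1: "(\<integral>y. exp (t * f y) \<partial>\<nu>) \<le> exp (t\<^sup>2 * (\<Sum>v\<in>Q. (c v)\<^sup>2) / 8) * exp (t * m)" .
    have "(\<integral>y. exp (t * (f y - m)) \<partial>\<nu>) = (\<integral>y. exp (t * f y) * exp (- t * m) \<partial>\<nu>)"
      by (simp add: mult_exp_exp algebra_simps)
    also have "\<dots> = (\<integral>y. exp (t * f y) \<partial>\<nu>) * exp (- t * m)" by simp
    also have "\<dots> \<le> exp (t\<^sup>2 * (\<Sum>v\<in>Q. (c v)\<^sup>2) / 8) * exp (t * m) * exp (- t * m)"
      by (intro mult_right_mono 1) auto
    also have "\<dots> = exp (t\<^sup>2 * (\<Sum>v\<in>Q. (c v)\<^sup>2) / 8)" by (simp add: mult.assoc mult_exp_exp)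
    also have "\<dots> \<le> exp (S\<^sup>2 / 2 * t\<^sup>2 * delta_norm_sq f)"
    proof -
      have "t\<^sup>2 * (\<Sum>v\<in>Q. (c v)\<^sup>2) \<le> t\<^sup>2 * (S\<^sup>2 * (4 * delta_norm_sq f))"
        by (intro mult_left_mono sum_c) auto
      then show ?thesis by (simp add: mult_ac)
    qed
    finally have up: "(\<integral>y. exp (t * (f y - m)) \<partial>\<nu>) \<le> exp (S\<^sup>2 / 2 * t\<^sup>2 * delta_norm_sq f)" .
    have "0 < (\<integral>y. exp (t * (f y - m)) \<partial>\<nu>)"
    proof -
      obtain B where B: "\<And>y. \<bar>f y\<bar> \<le> B" using depends_on_bounded[OF \<Delta>] by metis
      have "exp (t * (- B - m)) \<le> cexp {} undefined (\<lambda>y. exp (t * (f y - m)))"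
      proof (rule cexp_ge)
        show "integrable \<nu> (\<lambda>y. exp (t * (f y - m)))"
          by (rule depends_on_integrable[OF \<Delta>(1) depends_on_comp[OF \<Delta>(2)]])
        show "AE y in \<nu>. y \<in> cyl {} undefined \<longrightarrow> exp (t * (- B - m)) \<le> exp (t * (f y - m))"
          using B t by (auto simp: abs_le_iff minus_le_iff)
        show "pos {} undefined" using prob_space by (simp add: cyl_def)
      qed simp
      then show ?thesis by (simp add: less_le_trans[OF exp_gt_zero])
    qed
    then have "ln (\<integral>y. exp (t * (f y - m)) \<partial>\<nu>) \<le> ln (exp (S\<^sup>2 / 2 * t\<^sup>2 * delta_norm_sq f))"
      using up by (subst ln_le_cancel_iff) auto
    then show ?case by (simp add: m_def)
  qed
qed

end

section \<open>The Markov property\<close>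

text \<open>The infimum defining the distance is 1 and not infinite, so it is taken over a nonempty
  set; extended naturals are well ordered, hence it is attained.\<close>

lemma outer_boundaryD:
  assumes "i \<in> outer_boundary \<Lambda>"
  shows "i \<notin> \<Lambda>" "\<exists>j\<in>\<Lambda>. l1_dist i j = 1"
proof -
  let ?X = "{enat (l1_dist i' j) | i' j. i' \<in> {i} \<and> j \<in> \<Lambda>}"
  have i: "i \<notin> \<Lambda>" "Inf ?X = 1" using assms by (auto simp: outer_boundary_def l1_setdist_def)
  then have "?X \<noteq> {}" by (auto simp: Inf_enat_def)
  then obtain x where "x \<in> ?X" by blast
  then have "Inf ?X \<in> ?X" by (rule wellorder_InfI)
  then have "1 \<in> ?X" unfolding i(2) .
  then show "\<exists>j\<in>\<Lambda>. l1_dist i j = 1" by (auto simp: one_enat_def)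
qed (use assms in \<open>auto simp: outer_boundary_def\<close>)

lemma finite_outer_boundary [simp]: "finite \<Lambda> \<Longrightarrow> finite (outer_boundary \<Lambda>)"
proof (rule finite_subset)
  show "outer_boundary \<Lambda> \<subseteq> (\<Union>j\<in>\<Lambda>. {i. l1_dist j i \<le> 1})"
    by (auto dest!: outer_boundaryD(2) simp: l1_dist_commute intro!: bexI)
qed (simp add: l1_ball_bound(1))

lemma outer_boundary_singleton: "outer_boundary {i} = {j. l1_dist j i = 1}"
proof -
  have "l1_setdist {j} {i} = enat (l1_dist j i)" for j by (simp add: l1_setdist_def)
  then show ?thesis by (auto simp: outer_boundary_def one_enat_def l1_dist_def)
qed

lemma rate_at_le:
  assumes "mixing_rate \<rho>" "\<And>i j. i \<in> A \<Longrightarrow> j \<in> B \<Longrightarrow> k \<le> l1_dist i j"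
  shows "rate_at \<rho> (l1_setdist A B) \<le> \<rho> k"
proof -
  have "enat k \<le> l1_setdist A B"
    unfolding l1_setdist_def by (intro Inf_greatest) (use assms(2) in auto)
  then show ?thesis using assms(1)
    by (cases "l1_setdist A B") (auto simp: rate_at_def mixing_rate_def antimono_def)
qed

section \<open>Total variation distance of conditional laws\<close>

context random_field
begin

lemma cexp_sum:
  assumes "finite A" "\<And>s. s \<in> P \<Longrightarrow> integrable \<nu> (F s)"
  shows "cexp A \<eta> (\<lambda>y. \<Sum>s\<in>P. F s y) = (\<Sum>s\<in>P. cexp A \<eta> (F s))"
proof -
  have "(\<integral>y. indicator (cyl A \<eta>) y * (\<Sum>s\<in>P. F s y) \<partial>\<nu>) = (\<Sum>s\<in>P. \<integral>y. indicator (cyl A \<eta>) y * F s y \<partial>\<nu>)"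
    unfolding sum_distrib_left by (intro Bochner_Integration.integral_sum integrable_cyl_mult assms)
  then show ?thesis by (simp add: cexp_def sum_divide_distrib)
qed

lemma cexp_indicator:
  assumes "finite A" "E \<in> sets \<nu>"
  shows "cexp A \<eta> (indicator E) = measure \<nu> (cyl A \<eta> \<inter> E) / measure \<nu> (cyl A \<eta>)"
proof -
  have "(\<integral>y. indicator (cyl A \<eta>) y * (indicator E y :: real) \<partial>\<nu>) = (\<integral>y. indicator (cyl A \<eta> \<inter> E) y \<partial>\<nu>)"
    by (intro Bochner_Integration.integral_cong) (auto simp: indicator_def)
  then show ?thesis using assms by (simp add: cexp_def)
qed

lemma cexp_expand:
  assumes "finite A" "finite S" "depends_on g S"
  shows "cexp A \<eta> g = (\<Sum>s\<in>patterns S. g s * cexp A \<eta> (indicator (cyl S s)))"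
proof -
  have "g = (\<lambda>y. \<Sum>s\<in>patterns S. g s * indicator (cyl S s) y)"
    by (rule ext) (subst depends_on_expand[OF assms(2,3)], simp add: mult.commute)
  then have "cexp A \<eta> g = cexp A \<eta> (\<lambda>y. \<Sum>s\<in>patterns S. g s * indicator (cyl S s) y)"
    by (rule arg_cong)
  also have "\<dots> = (\<Sum>s\<in>patterns S. cexp A \<eta> (\<lambda>y. g s * indicator (cyl S s) y))"
    using assms depends_on_integrable[OF assms(2) depends_on_cyl]
    by (intro cexp_sum integrable_mult_right) auto
  also have "\<dots> = (\<Sum>s\<in>patterns S. g s * cexp A \<eta> (indicator (cyl S s)))"
    by (simp only: cexp_cmult)
  finally show ?thesis .
qed

text \<open>Conditioning is done in two stages, on \<open>W\<close> and then on \<open>X\<close>. If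
  the joint cylinder is null, both sides are 0.\<close>

lemma cexp_Un:
  assumes "finite W" "finite X"
  shows "cexp (W \<union> X) y g = cexp W y (\<lambda>z. indicator (cyl X y) z * g z) / cexp W y (indicator (cyl X y))"
proof -
  have "(\<integral>z. indicator (cyl W y) z * (indicator (cyl X y) z * g z) \<partial>\<nu>) = (\<integral>z. indicator (cyl (W \<union> X) y) z
      * g z \<partial>\<nu>)"
    by (intro Bochner_Integration.integral_cong) (auto simp: cyl_Un indicator_def)
  moreover have "cexp W y (indicator (cyl X y)) = measure \<nu> (cyl (W \<union> X) y) / measure \<nu> (cyl W y)"
    using assms by (subst cexp_indicator) (auto simp: cyl_Un)
  moreover have "measure \<nu> (cyl (W \<union> X) y) \<le> measure \<nu> (cyl W y)"
    using assms by (intro finite_measure_mono) (auto simp: cyl_Un)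
  then have "measure \<nu> (cyl W y) = 0 \<Longrightarrow> measure \<nu> (cyl (W \<union> X) y) = 0"
    using measure_nonneg[of \<nu> "cyl (W \<union> X) y"] by linarith
  ultimately show ?thesis by (auto simp: cexp_def)
qed

lemma sets_patterns: "finite S \<Longrightarrow> D \<subseteq> patterns S \<Longrightarrow> D \<in> sets (pattern_space S)"
proof -
  assume S: "finite S" and D: "D \<subseteq> patterns S"
  have "D = (\<Union>s\<in>D. PiE S (\<lambda>i. {s i}))"
  proof -
    have "PiE S (\<lambda>i. {s i}) = {s}" if "s \<in> D" for s
      using that D by (intro PiE_singleton) (auto simp: patterns_def PiE_def)
    then show ?thesis by auto
  qed
  moreover have "finite D" using D S finite_subset finite_patterns by blast
  moreover have "PiE S (\<lambda>i. {s i}) \<in> sets (pattern_space S)" for s :: "int ^ 'd \<Rightarrow> 'b"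
    using S by (intro sets_PiM_I_finite) auto
  ultimately show ?thesis by (metis (no_types, lifting) sets.finite_UN)
qed

text \<open>Among functions with values in \<open>[0, 1]\<close>, the difference of the two means is
  largest for the indicator of the patterns to which the first law gives at least as much mass as
  the second. This event \<open>D\<close> is one of those in the supremum defining
  \<open>tv_dist\<close>. The lemma is the bridge from the mixing hypotheses to
  \<open>influence_le\<close>.\<close>

lemma cexp_diff_le_tv:
  assumes \<Lambda>: "finite \<Lambda>" and S: "finite S" and p: "pos (outer_boundary \<Lambda>) z" "pos (outer_boundary \<Lambda>) z'"
    and g: "depends_on g S" "\<And>y. 0 \<le> g y \<and> g y \<le> 1"
  shows "cexp (outer_boundary \<Lambda>) z g - cexp (outer_boundary \<Lambda>) z' g
     \<le> tv_dist (conditional_law \<nu> \<Lambda> S z) (conditional_law \<nu> \<Lambda> S z')"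
proof -
  let ?B = "outer_boundary \<Lambda>"
  have fB: "finite ?B" using \<Lambda> by simp
  define p where "p s = cexp ?B z (indicator (cyl S s))" for s
  define p' where "p' s = cexp ?B z' (indicator (cyl S s))" for s
  define D where "D = {s\<in>patterns S. p s \<ge> p' s}"
  have D: "D \<in> sets (pattern_space S)" unfolding D_def by (intro sets_patterns S) auto
  have restr: "(\<lambda>y. restrict y S) \<in> measurable \<nu> (pattern_space S)"
    by (subst measurable_cong_sets[OF sets_field refl]) (rule measurable_restrict_subset, simp)
  have law: "measure (conditional_law \<nu> \<Lambda> S w) D = (\<Sum>s\<in>D. cexp ?B w (indicator (cyl S s)))"
    if w: "pos ?B w" for w
  proof -
    let ?E = "(\<lambda>y. restrict y S) -` D"
    have E: "?E \<in> sets \<nu>" using measurable_sets[OF restr D] by simp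
    have em: "emeasure \<nu> (cyl ?B w) \<noteq> 0" using w by (simp add: emeasure_eq_measure)
    have "measure (conditional_law \<nu> \<Lambda> S w) D = measure (uniform_measure \<nu> (cyl ?B w)) ?E"
      unfolding conditional_law_def cyl_def[symmetric]
      using restr D by (subst measure_distr) auto
    also have "\<dots> = measure \<nu> (cyl ?B w \<inter> ?E) / measure \<nu> (cyl ?B w)"
      using em E by (intro measure_uniform_measure) (auto simp: emeasure_eq_measure)
    also have "\<dots> = cexp ?B w (indicator ?E)" by (rule cexp_indicator[symmetric, OF fB E])
    also have "\<dots> = (\<Sum>s\<in>patterns S. indicator ?E s * cexp ?B w (indicator (cyl S s)))"
    proof (rule cexp_expand[OF fB S])
      have "restrict y S = restrict y' S" if "\<forall>i\<in>S. y i = y' i" for y y' :: "int ^ 'd \<Rightarrow> 'b"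
        using that by (intro restrict_ext) auto
      then show "depends_on (indicator ?E :: _ \<Rightarrow> real) S" unfolding depends_on_def indicator_def by force
    qed
    also have "\<dots> = (\<Sum>s\<in>D. cexp ?B w (indicator (cyl S s)))"
    proof (rule sum.mono_neutral_cong_right)
      have r: "restrict s S = s" if "s \<in> patterns S" for s
        using that by (auto simp: patterns_def PiE_def extensional_restrict)
      show "\<forall>s\<in>patterns S - D. indicator ?E s * cexp ?B w (indicator (cyl S s)) = 0"
        using r by auto
      show "indicator ?E s * cexp ?B w (indicator (cyl S s)) = cexp ?B w (indicator (cyl S s))" if "s \<in> D"
          for s
        using that r[of s] by (auto simp: D_def)
    qed (use S in \<open>auto simp: D_def\<close>)
    finally show ?thesis .
  qed
  have prob: "prob_space (conditional_law \<nu> \<Lambda> S w)" if w: "pos ?B w" for w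
  proof -
    have em: "emeasure \<nu> (cyl ?B w) \<noteq> 0" using w by (simp add: emeasure_eq_measure)
    interpret U: prob_space "uniform_measure \<nu> (cyl ?B w)"
      using em by (intro prob_space_uniform_measure) (auto simp: emeasure_eq_measure)
    show ?thesis unfolding conditional_law_def cyl_def[symmetric]
      using restr by (intro U.prob_space_distr) simp
  qed
  have "cexp ?B z g - cexp ?B z' g = (\<Sum>s\<in>patterns S. g s * (p s - p' s))"
    unfolding p_def p'_def by (subst (1 2) cexp_expand[OF fB S g(1)]) (simp add: sum_subtractf
        right_diff_distrib)
  also have "\<dots> \<le> (\<Sum>s\<in>patterns S. if s \<in> D then p s - p' s else 0)"
  proof (rule sum_mono)
    fix s assume "s \<in> patterns S"
    then show "g s * (p s - p' s) \<le> (if s \<in> D then p s - p' s else 0)"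
      using g(2)[of s] by (auto simp: D_def mult_le_0_iff intro: mult_left_le_one_le)
  qed
  also have "\<dots> = (\<Sum>s\<in>D. p s - p' s)"
    using S by (subst sum.inter_filter[symmetric]) (auto simp: D_def intro!: sum.cong)
  also have "\<dots> = measure (conditional_law \<nu> \<Lambda> S z) D - measure (conditional_law \<nu> \<Lambda> S z') D"
    using law[OF assms(3)] law[OF assms(4)] by (simp add: p_def p'_def sum_subtractf)
  also have "\<dots> \<le> \<bar>measure (conditional_law \<nu> \<Lambda> S z) D - measure (conditional_law \<nu> \<Lambda> S z') D\<bar>" by simp
  also have "\<dots> \<le> tv_dist (conditional_law \<nu> \<Lambda> S z) (conditional_law \<nu> \<Lambda> S z')"
    unfolding tv_dist_def
  proof (rule cSUP_upper)
    show "D \<in> sets (conditional_law \<nu> \<Lambda> S z)" using D by (simp add: conditional_law_def)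
    interpret P: prob_space "conditional_law \<nu> \<Lambda> S z" by (rule prob[OF assms(3)])
    interpret P': prob_space "conditional_law \<nu> \<Lambda> S z'" by (rule prob[OF assms(4)])
    show "bdd_above ((\<lambda>A. \<bar>P.prob A - P'.prob A\<bar>) ` sets (conditional_law \<nu> \<Lambda> S z))"
    proof (rule bdd_aboveI2)
      fix A show "\<bar>P.prob A - P'.prob A\<bar> \<le> 1"
        using P.prob_le_1[of A] P'.prob_le_1[of A] measure_nonneg[of "conditional_law \<nu> \<Lambda> S z" A]
          measure_nonneg[of "conditional_law \<nu> \<Lambda> S z'" A] by linarith
    qed
  qed
  finally show ?thesis .
qed

section \<open>Topological support and cylinders of positive probability\<close>

lemma openin_cyl: "finite A \<Longrightarrow> openin configuration_topology (cyl A \<eta>)"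
proof -
  assume A: "finite A"
  have "cyl A \<eta> = PiE UNIV (\<lambda>i. if i \<in> A then {\<eta> i} else UNIV)"
    by (auto simp: cyl_def PiE_def Pi_def split: if_splits)
  moreover have "openin configuration_topology (PiE UNIV (\<lambda>i. if i \<in> A then {\<eta> i} else UNIV))"
    unfolding configuration_topology_def using A
    by (intro product_topology_basis) (auto intro: finite_subset[of _ A])
  ultimately show ?thesis by simp
qed

lemma open_contains_cyl:
  assumes "openin configuration_topology U" "y \<in> U"
  obtains A where "finite A" "cyl A y \<subseteq> U"
proof -
  obtain X where X: "y \<in> PiE UNIV X" "finite {i. X i \<noteq> UNIV}" "PiE UNIV X \<subseteq> U"
    using product_topology_open_contains_basis[OF assms(1)[unfolded configuration_topology_def] assms(2)]
        by auto
  show ?thesis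
  proof (rule that[OF X(2)])
    have "z \<in> PiE UNIV X" if z: "z \<in> cyl {i. X i \<noteq> UNIV} y" for z
    proof -
      have "z i \<in> X i" for i
        using z X(1) by (cases "X i = UNIV") (auto simp: cyl_def PiE_def Pi_def)
      then show ?thesis by auto
    qed
    then show "cyl {i. X i \<noteq> UNIV} y \<subseteq> U" using X(3) by blast
  qed
qed

lemma countable_cyls: "countable {cyl A s | A s. finite A \<and> s \<in> patterns A}"
proof -
  have "{cyl A s | A s. finite A \<and> s \<in> patterns A} = (\<lambda>(A,
      s). cyl A s) ` (SIGMA A:Collect finite. patterns A)"
    by auto
  moreover have "countable (SIGMA A:Collect finite. patterns A)"
    by (intro countable_SIGMA countable_Collect_finite) (auto intro: countable_finite)
  ultimately show ?thesis by simp
qed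

lemma cyl_in_cyls: "finite A \<Longrightarrow> cyl A y \<in> {cyl A s | A s. finite A \<and> s \<in> patterns A}"
proof -
  assume "finite A"
  then have "cyl A (restrict y A) \<in> {cyl A s | A s. finite A \<and> s \<in> patterns A}"
    by (force simp: patterns_def simp del: cyl_restrict)
  then show ?thesis by simp
qed

lemma openin_sets: "openin configuration_topology U \<Longrightarrow> U \<in> sets \<nu>"
proof -
  assume U: "openin configuration_topology U"
  let ?C = "{C \<in> {cyl A s | A s. finite A \<and> s \<in> patterns A}. C \<subseteq> U}"
  have "U = \<Union>?C"
  proof
    show "U \<subseteq> \<Union>?C"
    proof
      fix y assume "y \<in> U"
      with U obtain A where "finite A" "cyl A y \<subseteq> U" using open_contains_cyl by blast
      then show "y \<in> \<Union>?C" using cyl_in_cyls[of A y] mem_cyl_self[of y A] by blast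
    qed
  qed auto
  moreover have "\<Union>?C \<in> sets \<nu>"
    by (intro sets.countable_Union countable_subset[OF _ countable_cyls]) auto
  ultimately show ?thesis by simp
qed

text \<open>A point outside the support has a null open neighbourhood, which contains a null
  cylinder around it; there are only countably many cylinders.\<close>

lemma AE_topological_support: "AE y in \<nu>. y \<in> topological_support \<nu>"
proof -
  let ?C = "{C \<in> {cyl A s | A s. finite A \<and> s \<in> patterns A}. measure \<nu> C = 0}"
  have "(\<Union>C\<in>?C. C) \<in> null_sets \<nu>"
  proof (rule null_sets_UN')
    show "countable ?C" by (rule countable_subset[OF _ countable_cyls]) auto
    show "C \<in> null_sets \<nu>" if "C \<in> ?C" for C
      using that by (auto simp: null_sets_def emeasure_eq_measure)
  qed
  moreover have "{y \<in> space \<nu>. y \<notin> topological_support \<nu>} \<subseteq> (\<Union>C\<in>?C. C)"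
  proof
    fix y assume "y \<in> {y \<in> space \<nu>. y \<notin> topological_support \<nu>}"
    then obtain U where U: "openin configuration_topology U" "y \<in> U" "\<not> measure \<nu> U > 0"
      by (auto simp: topological_support_def)
    then obtain A where A: "finite A" "cyl A y \<subseteq> U" using open_contains_cyl by blast
    have "measure \<nu> (cyl A y) \<le> measure \<nu> U" by (intro finite_measure_mono A(2) openin_sets U(1))
    then have "measure \<nu> (cyl A y) = 0" using U(3) measure_nonneg[of \<nu> "cyl A y"] by linarith
    then show "y \<in> (\<Union>C\<in>?C. C)" using cyl_in_cyls[OF A(1), of y] mem_cyl_self[of y A] by blast
  qed
  ultimately show ?thesis by (rule AE_I')
qed

text \<open>Since the support has full measure, a cylinder of positive probability meets it. Every
  pattern that occurs in a conditioning is thus an admissible boundary condition for the mixing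
  hypotheses.\<close>

lemma pos_feasible:
  assumes "finite A" "pos A y"
  shows "restrict y A \<in> feasible_on \<nu> A"
proof (rule ccontr)
  assume n: "restrict y A \<notin> feasible_on \<nu> A"
  have "z \<notin> topological_support \<nu>" if "z \<in> cyl A y" for z
  proof
    assume "z \<in> topological_support \<nu>"
    then have "restrict z A \<in> feasible_on \<nu> A" by (auto simp: feasible_on_def)
    moreover have "restrict z A = restrict y A" using that by (intro restrict_ext) (auto simp: cyl_def)
    ultimately show False using n by simp
  qed
  have "AE z in \<nu>. z \<notin> cyl A y"
    using AE_topological_support
  proof (rule AE_mp, intro AE_I2 impI)
    fix z assume "z \<in> topological_support \<nu>"
    then show "z \<notin> cyl A y" using \<open>\<And>z. z \<in> cyl A y \<Longrightarrow> z \<notin> topological_support \<nu>\<close> by blast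
  qed
  then have "measure \<nu> (cyl A y) = 0"
    using assms(1) by (subst (asm) AE_iff_null_sets[symmetric]) (auto simp: null_sets_def
        emeasure_eq_measure)
  then show False using assms(2) by simp
qed

lemma no_hard_constraints_pos:
  assumes "no_hard_constraints \<nu>" "finite A"
  shows "pos A y"
proof -
  have "y \<in> topological_support \<nu>" using assms(1) by (simp add: no_hard_constraints_def)
  then show ?thesis using openin_cyl[OF assms(2), of y] mem_cyl_self unfolding topological_support_def by
      blast
qed

end

section \<open>Screening by a revealed boundary\<close>

locale markov_field = random_field \<nu> for \<nu> :: "(int ^ 'd \<Rightarrow> 'b :: finite) measure" +
  assumes mrf: "markov_random_field \<nu>"
begin

text \<open>The almost sure identity in the definition is integrated over \<open>cyl C b\<close>, an
  event of the outside sigma-algebra. What matters is that \<open>G\<close> does not depend on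
  \<open>C\<close>: comparing \<open>C\<close> with the boundary itself then removes all sites of
  \<open>C\<close> beyond the boundary.\<close>

lemma markov_cyl:
  assumes "finite \<Lambda>"
  obtains G where "\<And>C b. finite C \<Longrightarrow> outer_boundary \<Lambda> \<subseteq> C \<Longrightarrow> C \<inter> \<Lambda> = {} \<Longrightarrow>
     measure \<nu> (cyl C b \<inter> cyl \<Lambda> a) = G (restrict b (outer_boundary \<Lambda>)) * measure \<nu> (cyl C b)"
proof -
  let ?F = "coordinate_algebra (- \<Lambda>) :: (int ^ 'd \<Rightarrow> 'b) measure" and ?f = "indicator (cyl \<Lambda> a) :: _ \<Rightarrow> real"
  obtain G where G: "AE y in \<nu>. real_cond_exp \<nu> ?F ?f y = G (restrict y (outer_boundary \<Lambda>))"
    using mrf assms unfolding markov_random_field_def cyl_def by blast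
  have restr: "(\<lambda>y. restrict y (- \<Lambda>)) \<in> measurable \<nu> (pattern_space (- \<Lambda>))"
    by (subst measurable_cong_sets[OF sets_field refl]) (rule measurable_restrict_subset, simp)
  interpret F: finite_measure_subalgebra \<nu> ?F
  proof
    show "subalgebra \<nu> ?F"
      unfolding subalgebra_def coordinate_algebra_def using restr
      by (auto intro!: sets_image_in_sets simp del: sets_vimage_algebra dest!: subsetD[OF
          sets_image_in_sets, rotated 2])
  qed
  show ?thesis
  proof (rule that)
    fix C and b :: "int ^ 'd \<Rightarrow> 'b" assume C: "finite C" "outer_boundary \<Lambda> \<subseteq> C" "C \<inter> \<Lambda> = {}"
    have "cyl C b = (\<lambda>y. restrict y (- \<Lambda>)) -` {z \<in> space (pattern_space (- \<Lambda>)). \<forall>i\<in>C. z i = b i} \<inter> UNIV"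
      using C(3) by (auto simp: cyl_def space_PiM)
    also have "\<dots> \<in> sets ?F"
      unfolding coordinate_algebra_def
    proof (rule in_vimage_algebra)
      show "{z \<in> space (pattern_space (- \<Lambda>)). \<forall>i\<in>C. z i = b i} \<in> sets (pattern_space (- \<Lambda>))"
      proof (rule sets.sets_Collect_finite_All[OF _ C(1)])
        fix i assume "i \<in> C"
        then have "(\<lambda>z. z i) \<in> measurable (pattern_space (- \<Lambda>)) (count_space (UNIV :: 'b set))"
          using C(3) by (intro measurable_component_singleton) auto
        from measurable_sets[OF this, of "{b i}"]
        show "{z \<in> space (pattern_space (- \<Lambda>)). z i = b i} \<in> sets (pattern_space (- \<Lambda>))"
          by (simp add: vimage_def Int_def conj_commute)
      qed
    qed
    finally have cF: "cyl C b \<in> sets ?F" .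
    have int: "integrable \<nu> ?f" using assms by (simp add: emeasure_eq_measure)
    have "measure \<nu> (cyl C b \<inter> cyl \<Lambda> a) = (\<integral>y\<in>cyl C b. ?f y \<partial>\<nu>)"
    proof -
      have "(\<integral>y\<in>cyl C b. ?f y \<partial>\<nu>) = (\<integral>y. indicator (cyl C b \<inter> cyl \<Lambda> a) y \<partial>\<nu>)"
        unfolding set_lebesgue_integral_def
        by (intro Bochner_Integration.integral_cong) (auto simp: indicator_def)
      then show ?thesis using assms C(1) by simp
    qed
    also have "\<dots> = (\<integral>y\<in>cyl C b. real_cond_exp \<nu> ?F ?f y \<partial>\<nu>)"
      by (rule F.real_cond_exp_intA[OF int cF])
    also have "\<dots> = (\<integral>y. G (restrict b (outer_boundary \<Lambda>)) * indicator (cyl C b) y \<partial>\<nu>)"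
      unfolding set_lebesgue_integral_def
    proof (rule integral_cong_AE)
      show "AE y in \<nu>. indicator (cyl C b) y *\<^sub>R real_cond_exp \<nu> ?F ?f y = G (restrict b (outer_boundary
          \<Lambda>)) * indicator (cyl C b) y"
        using G
      proof (rule AE_mp, intro AE_I2 impI)
        fix y assume e: "real_cond_exp \<nu> ?F ?f y = G (restrict y (outer_boundary \<Lambda>))"
        have "restrict y (outer_boundary \<Lambda>) = restrict b (outer_boundary \<Lambda>)" if "y \<in> cyl C b"
          using that C(2) by (intro restrict_ext) (auto simp: cyl_def)
        then show "indicator (cyl C b) y *\<^sub>R real_cond_exp \<nu> ?F ?f y = G (restrict b (outer_boundary \<Lambda>)) *
            indicator (cyl C b) y"
          using e by (auto simp: indicator_def)
      qed
    qed (use C(1) in measurable)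
    also have "\<dots> = G (restrict b (outer_boundary \<Lambda>)) * measure \<nu> (cyl C b)"
      using C(1) by simp
    finally show "measure \<nu> (cyl C b \<inter> cyl \<Lambda> a) = G (restrict b (outer_boundary \<Lambda>)) * measure \<nu> (cyl C b)" .
  qed
qed

lemma cexp_markov:
  assumes \<Lambda>: "finite \<Lambda>" and C: "finite C" "outer_boundary \<Lambda> \<subseteq> C" "C \<inter> \<Lambda> = {}"
    and h: "depends_on h \<Lambda>" and p: "pos C a"
  shows "cexp C a h = cexp (outer_boundary \<Lambda>) a h"
proof -
  let ?B = "outer_boundary \<Lambda>"
  have pB: "pos ?B a" by (rule pos_mono[OF p C(2,1)])
  have fB: "finite ?B" using \<Lambda> by simp
  have "cexp C a (indicator (cyl \<Lambda> s)) = cexp ?B a (indicator (cyl \<Lambda> s))" for s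
  proof -
    obtain G where G: "\<And>C b. finite C \<Longrightarrow> outer_boundary \<Lambda> \<subseteq> C \<Longrightarrow> C \<inter> \<Lambda> = {} \<Longrightarrow>
     measure \<nu> (cyl C b \<inter> cyl \<Lambda> s) = G (restrict b (outer_boundary \<Lambda>)) * measure \<nu> (cyl C b)"
      using markov_cyl[OF \<Lambda>, of s] by blast
    have "?B \<inter> \<Lambda> = {}" using outer_boundaryD(1) by blast
    then show ?thesis
      using G[OF C, of a] G[OF fB subset_refl, of a] p pB \<Lambda> C(1) fB by (simp add: cexp_indicator)
  qed
  then show ?thesis by (simp add: cexp_expand[OF C(1) \<Lambda> h] cexp_expand[OF fB \<Lambda> h])
qed

text \<open>This is Bayes' rule: given \<open>W\<close> and \<open>T\<close>, the likelihood of the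
  pattern on \<open>X = C \<inter> \<Lambda>\<close> is a number \<open>q\<close> determined by the
  boundary values alone, so it cancels in the quotient of \<open>cexp_Un\<close>. Values revealed
  behind a revealed boundary are forgotten, in particular a disagreement there.\<close>

lemma cexp_markov_outside:
  assumes \<Lambda>: "finite \<Lambda>" and C: "finite C" "outer_boundary \<Lambda> \<subseteq> C" and T: "finite T" "T \<inter> \<Lambda> = {}"
    and g: "depends_on g T" and p: "pos C y"
  shows "cexp C y g = cexp (C - \<Lambda>) y g"
proof -
  define W where "W = C - \<Lambda>"
  define X where "X = C \<inter> \<Lambda>"
  have CWX: "C = W \<union> X" "finite W" "finite X" using C(1) by (auto simp: W_def X_def)
  have dB: "outer_boundary \<Lambda> \<subseteq> W" using C(2) outer_boundaryD(1)[of _ \<Lambda>] by (auto simp: W_def)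
  have pW: "pos W y" using pos_mono[OF p _ C(1)] by (auto simp: W_def)
  have fWT: "finite (W \<union> T)" using CWX T by simp
  define q where "q = cexp (outer_boundary \<Lambda>) y (indicator (cyl X y))"
  have dX: "depends_on (indicator (cyl X y) :: _ \<Rightarrow> real) \<Lambda>"
    using depends_on_mono[OF depends_on_cyl, of X \<Lambda> y] by (simp add: X_def)
  have key: "cexp W y (\<lambda>z. indicator (cyl X y) z * k z) = q * cexp W y k" if k: "depends_on k T" for k
  proof -
    have dXk: "depends_on (\<lambda>z. indicator (cyl X y) z * k z) (X \<union> T)"
      by (intro depends_on_comp2[where h = "(*)"] depends_on_mono[OF depends_on_cyl] depends_on_mono[OF
          k]) auto
    have "cexp W y (\<lambda>z. indicator (cyl X y) z * k z) = cexp W y (\<lambda>z. cexp (W \<union> T) z (\<lambda>z. indicator (cyl X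
        y) z * k z))"
      using fWT depends_on_integrable[OF _ dXk] CWX T by (intro cexp_tower[symmetric]) auto
    also have "\<dots> = cexp W y (\<lambda>z. q * k z)"
    proof (rule cexp_cong_AE)
      show "integrable \<nu> (\<lambda>z. cexp (W \<union> T) z (\<lambda>z. indicator (cyl X y) z * k z))"
        by (rule depends_on_integrable[OF fWT depends_on_cexp])
      show "integrable \<nu> (\<lambda>z. q * k z)"
        by (rule depends_on_integrable[OF T(1) depends_on_comp[OF k]])
      show "AE z in \<nu>. z \<in> cyl W y \<longrightarrow> cexp (W \<union> T) z (\<lambda>z. indicator (cyl X y) z * k z) = q * k z"
        using AE_pos[OF fWT]
      proof (rule AE_mp, intro AE_I2 impI)
        fix z assume z: "pos (W \<union> T) z" "z \<in> cyl W y"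
        have "cexp (W \<union> T) z (\<lambda>z. indicator (cyl X y) z * k z) = cexp (W \<union> T) z (\<lambda>x. k z * indicator (cyl
            X y) x)"
        proof (rule cexp_cong)
          fix x assume "x \<in> cyl (W \<union> T) z"
          then have "k x = k z" by (intro depends_onD[OF k]) (auto simp: cyl_def)
          then show "indicator (cyl X y) x * k x = k z * indicator (cyl X y) x" by simp
        qed
        also have "\<dots> = k z * cexp (W \<union> T) z (indicator (cyl X y))" by (rule cexp_cmult)
        also have "cexp (W \<union> T) z (indicator (cyl X y)) = cexp (outer_boundary \<Lambda>) z (indicator (cyl X y))"
          using dB T by (intro cexp_markov[OF \<Lambda> fWT _ _ dX z(1)]) (auto simp: W_def)
        also have "\<dots> = q" unfolding q_def using z(2) dB by (intro cexp_eqI) (auto simp: cyl_def)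
        finally show "cexp (W \<union> T) z (\<lambda>z. indicator (cyl X y) z * k z) = q * k z" by simp
      qed
    qed (use CWX in auto)
    also have "\<dots> = q * cexp W y k" by (rule cexp_cmult)
    finally show ?thesis .
  qed
  have q1: "cexp W y (indicator (cyl X y)) = q"
    using key[of "\<lambda>_. 1"] pW CWX by (simp add: cexp_const)
  have "q \<noteq> 0"
  proof
    assume "q = 0"
    then have "measure \<nu> (cyl W y \<inter> cyl X y) = 0" using q1 pW CWX by (simp add: cexp_indicator)
    then show False using p by (simp add: CWX(1) cyl_Un)
  qed
  then have e: "cexp (W \<union> X) y g = cexp W y g"
    unfolding cexp_Un[OF CWX(2,3)] key[OF g] q1 by simp
  show ?thesis by (subst CWX(1)) (simp only: e W_def[symmetric])
qed

text \<open>The counterpart for functions of the inside: values beyond the boundary are forgotten,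
  while sites already revealed inside stay in the conditioning. Both terms of the quotient in
  \<open>cexp_Un\<close> are functions of the inside, so \<open>cexp_markov\<close> applies to
  each.\<close>

lemma cexp_markov_inside:
  assumes \<Lambda>: "finite \<Lambda>" and C: "finite C" "outer_boundary \<Lambda> \<subseteq> C"
    and g: "depends_on g \<Lambda>" and p: "pos C y"
  shows "cexp C y g = cexp (C \<inter> (\<Lambda> \<union> outer_boundary \<Lambda>)) y g"
proof -
  define X where "X = C \<inter> \<Lambda>"
  have fX: "finite X" using C by (simp add: X_def)
  have dX: "depends_on (indicator (cyl X y) :: _ \<Rightarrow> real) \<Lambda>"
    using depends_on_mono[OF depends_on_cyl, of X \<Lambda> y] by (simp add: X_def)
  have dXg: "depends_on (\<lambda>z. indicator (cyl X y) z * g z) \<Lambda>"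
    by (rule depends_on_comp2[OF dX g])
  have fB: "finite (outer_boundary \<Lambda>)" using \<Lambda> by simp
  have eq: "cexp (W \<union> X) y g = cexp (outer_boundary \<Lambda> \<union> X) y g"
    if "finite W" "outer_boundary \<Lambda> \<subseteq> W" "W \<inter> \<Lambda> = {}" "pos W y" for W
    unfolding cexp_Un[OF that(1) fX] cexp_Un[OF fB fX]
    using cexp_markov[OF \<Lambda> that(1-3) dX that(4)] cexp_markov[OF \<Lambda> that(1-3) dXg that(4)] by simp
  have "C - \<Lambda> \<union> X = C" by (auto simp: X_def)
  moreover have "outer_boundary \<Lambda> \<union> X = C \<inter> (\<Lambda> \<union> outer_boundary \<Lambda>)" using C(2) by (auto simp: X_def)
  moreover have "outer_boundary \<Lambda> \<subseteq> C - \<Lambda>" using C(2) outer_boundaryD(1)[of _ \<Lambda>] by auto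
  ultimately show ?thesis using eq[of "C - \<Lambda>"] C(1) pos_mono[OF p, of "C - \<Lambda>"] by auto
qed

end

section \<open>Strong spatial mixing\<close>

lemma l1_dist_triangle: "l1_dist i k \<le> l1_dist i j + l1_dist j k"
proof -
  have "l1_dist i k \<le> (\<Sum>l\<in>UNIV. nat \<bar>i $ l - j $ l\<bar> + nat \<bar>j $ l - k $ l\<bar>)"
    unfolding l1_dist_def by (intro sum_mono) linarith
  then show ?thesis by (simp add: l1_dist_def sum.distrib)
qed

lemma poly_exp_bounded:
  assumes "c > 0"
  shows "\<exists>K\<ge>0. \<forall>r::nat. (1 + real r) ^ n * exp (- c * real r) \<le> K"
proof -
  have "(\<lambda>r::nat. (1 + real r) ^ n * exp (- c * real r)) \<longlonglongrightarrow> 0"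
    using assms by real_asymp
  then have "Bseq (\<lambda>r::nat. (1 + real r) ^ n * exp (- c * real r))"
    by (intro convergent_imp_Bseq) (auto simp: convergent_def)
  then obtain K where "K > 0" "\<And>r::nat. norm ((1 + real r) ^ n * exp (- c * real r)) \<le> K"
    by (auto elim: BseqE)
  then show ?thesis by (intro exI[of _ K]) auto
qed

context random_field
begin

text \<open>If \<open>S\<close> screens \<open>T\<close> off from the disagreement, then the influence on \<open>T\<close> is that on \<open>S\<close>,
  contracted by the worst influence of \<open>S\<close> on \<open>T\<close> (Dobrushin's contraction).\<close>

lemma influence_screen:
  assumes fin: "finite A" "finite S" "finite T" "B \<subseteq> A \<union> S" and p: "pos A \<eta>" "pos A \<eta>'"
    and screen: "\<And>y g. depends_on g T \<Longrightarrow> pos (A \<union> S) y \<Longrightarrow> cexp (A \<union> S) y g = cexp B y g"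
    and agree: "\<And>i. i \<in> B - S \<Longrightarrow> \<eta> i = \<eta>' i"
    and S: "influence_le A \<eta> \<eta>' S \<tau>"
    and w: "\<And>y y'. (\<And>i. i \<in> B - S \<Longrightarrow> y i = y' i) \<Longrightarrow> influence_le B y y' T w"
  shows "influence_le A \<eta> \<eta>' T (\<tau> * w)"
  unfolding influence_le_def
proof (intro allI impI)
  fix g :: "(int ^ 'd \<Rightarrow> 'b) \<Rightarrow> real" assume g: "depends_on g T \<and> (\<forall>y. 0 \<le> g y \<and> g y \<le> 1)"
  have intg: "integrable \<nu> g" using g depends_on_integrable[OF fin(3)] by blast
  have fB: "finite B" using fin finite_subset by blast
  define h where "h y = cexp B (\<lambda>i. if i \<in> B - S then \<eta> i else y i) g" for y
  have dh: "depends_on h S"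
    unfolding depends_on_def h_def by (intro allI impI cexp_eqI) auto
  have eq: "cexp A z g = cexp A z h" if pz: "pos A z" and az: "\<And>i. i \<in> B - S \<Longrightarrow> z i = \<eta> i" for z
  proof -
    have "cexp A z g = cexp A z (\<lambda>y. cexp (A \<union> S) y g)"
      using fin intg by (intro cexp_tower[symmetric]) auto
    also have "\<dots> = cexp A z (\<lambda>y. cexp B y g)"
    proof (rule cexp_cong_AE)
      show "integrable \<nu> (\<lambda>y. cexp (A \<union> S) y g)" "integrable \<nu> (\<lambda>y. cexp B y g)"
        using depends_on_integrable[OF _ depends_on_cexp] fin fB by blast+
      have "AE y in \<nu>. pos (A \<union> S) y" using fin by (intro AE_pos) simp
      then show "AE y in \<nu>. y \<in> cyl A z \<longrightarrow> cexp (A \<union> S) y g = cexp B y g"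
        by (rule AE_mp) (use screen g in \<open>auto intro!: AE_I2\<close>)
    qed (use fin in simp)
    also have "\<dots> = cexp A z h"
    proof (rule cexp_cong)
      fix y assume "y \<in> cyl A z"
      then show "cexp B y g = h y" unfolding h_def
        using az fin(4) by (intro cexp_eqI) (auto simp: cyl_def)
    qed
    finally show ?thesis .
  qed
  have "\<bar>cexp A \<eta> h - cexp A \<eta>' h\<bar> \<le> \<tau> * w"
  proof (rule influence_scale[OF S p fin(1,2) dh])
    fix y y' show "\<bar>h y - h y'\<bar> \<le> w" unfolding h_def using g by (intro influence_leD[OF w]) auto
  qed
  then show "\<bar>cexp A \<eta> g - cexp A \<eta>' g\<bar> \<le> \<tau> * w"
    using eq[OF p(1)] eq[OF p(2)] agree by simp
qed

end

context markov_field
begin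

lemma ssm_cexp:
  assumes ssm: "strong_spatial_mixing \<nu> \<rho>" and \<Lambda>: "finite \<Lambda>" "S \<subseteq> \<Lambda>"
    and p: "pos (outer_boundary \<Lambda>) z" "pos (outer_boundary \<Lambda>) z'"
    and g: "depends_on g S" "\<And>y. 0 \<le> g y \<and> g y \<le> 1"
    and k: "\<And>i j. i \<in> S \<Longrightarrow> j \<in> outer_boundary \<Lambda> \<Longrightarrow> z j \<noteq> z' j \<Longrightarrow> k \<le> l1_dist i j"
  shows "\<bar>cexp (outer_boundary \<Lambda>) z g - cexp (outer_boundary \<Lambda>) z' g\<bar> \<le> real (card S) * \<rho> k"
proof -
  let ?B = "outer_boundary \<Lambda>"
  have fS: "finite S" using \<Lambda> finite_subset by blast
  have rate: "mixing_rate \<rho>" using ssm by (simp add: strong_spatial_mixing_def)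
  have one: "cexp ?B z g - cexp ?B z' g \<le> real (card S) * \<rho> k"
    if p: "pos ?B z" "pos ?B z'" and k: "\<And>i j. i \<in> S \<Longrightarrow> j \<in> ?B \<Longrightarrow> z j \<noteq> z' j \<Longrightarrow> k \<le> l1_dist i j" for z z'
  proof -
    let ?z = "restrict z ?B" and ?z' = "restrict z' ?B"
    have "cexp ?B ?z g - cexp ?B ?z' g \<le> tv_dist (conditional_law \<nu> \<Lambda> S ?z) (conditional_law \<nu> \<Lambda> S ?z')"
      using p by (intro cexp_diff_le_tv \<Lambda> fS g) auto
    also have "\<dots> \<le> real (card S) * rate_at \<rho> (l1_setdist S {i \<in> ?B. ?z i \<noteq> ?z' i})"
    proof -
      have "?z \<in> feasible_on \<nu> ?B" "?z' \<in> feasible_on \<nu> ?B" using \<Lambda> p by (auto intro!: pos_feasible)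
      then show ?thesis using ssm \<Lambda> unfolding strong_spatial_mixing_def by blast
    qed
    also have "\<dots> \<le> real (card S) * \<rho> k"
      using k by (intro mult_left_mono rate_at_le[OF rate]) auto
    finally show ?thesis by (simp add: cexp_def)
  qed
  show ?thesis using one[OF p k] one[OF p(2,1), of] k by (simp add: abs_le_iff)
qed

text \<open>All disagreement is kept at distance at least \<open>r\<close> from the sphere: that at
  \<open>v\<close> is at distance exactly \<open>r\<close>, and the rest is pushed beyond radius
  \<open>2 * r\<close>. Sites of the sphere that are already revealed agree, so they are adjoined at
  no cost.\<close>

lemma ssm_sphere:
  assumes ssm: "strong_spatial_mixing \<nu> \<rho>" and A: "finite A" and p: "pos A \<eta>" "pos A \<eta>'"
    and agree: "\<And>i. i \<in> A \<Longrightarrow> i \<noteq> v \<Longrightarrow> \<eta> i = \<eta>' i" and r: "r \<ge> 1"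
  shows "influence_le A \<eta> \<eta>' {i. l1_dist v i = r} (real ((2 * r + 1) ^ CARD('d)) * \<rho> r)"
proof -
  define S where "S = {i. l1_dist v i = r}"
  have fS: "finite S" unfolding S_def using l1_ball_bound(1)[of v r] by (rule finite_subset[rotated]) auto
  have cS: "card S \<le> (2 * r + 1) ^ CARD('d)"
    by (rule order_trans[OF card_mono[OF l1_ball_bound(1)] l1_ball_bound(2)]) (auto simp: S_def)
  \<comment> \<open>The unrevealed part of a ball of twice the radius. A boundary site either is
    revealed, and then agrees unless it is \<open>v\<close>, or lies outside the ball.\<close>
  define \<Lambda> where "\<Lambda> = {i. l1_dist v i \<le> 2 * r} - A"
  have \<Lambda>: "finite \<Lambda>" unfolding \<Lambda>_def using l1_ball_bound(1) by auto
  have S\<Lambda>: "S - A \<subseteq> \<Lambda>" by (auto simp: S_def \<Lambda>_def)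
  have \<rho>0: "\<rho> r \<ge> 0" using ssm by (auto simp: strong_spatial_mixing_def mixing_rate_def)
  let ?B = "outer_boundary \<Lambda>"
  have fAB: "finite (A \<union> ?B)" using A \<Lambda> by simp
  have "influence_le A \<eta> \<eta>' (S - A) (real (card (S - A)) * \<rho> r)"
    unfolding influence_le_def
  proof (intro allI impI)
    fix g :: "(int ^ 'd \<Rightarrow> 'b) \<Rightarrow> real" assume g: "depends_on g (S - A) \<and> (\<forall>y. 0 \<le> g y \<and> g y \<le> 1)"
    have intg: "integrable \<nu> g" using g fS by (intro depends_on_integrable[of "S - A"]) auto
    have "\<bar>cexp A \<eta> (\<lambda>y. cexp (A \<union> ?B) y g) - cexp A \<eta>' (\<lambda>y. cexp (A \<union> ?B) y g)\<bar> \<le> real (card (S - A)) * \<rho>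
        r"
    \<comment> \<open>Unrevealed boundary sites are averaged over under each law separately, so they
      may carry different values; they are far enough away for that.\<close>
    proof (rule cexp_close[OF A A p fAB fAB depends_on_cexp depends_on_cexp fAB fAB])
      fix y y' assume y: "y \<in> cyl A \<eta>" "y' \<in> cyl A \<eta>'" "pos (A \<union> ?B) y" "pos (A \<union> ?B) y'"
      have disj: "(A \<union> ?B) \<inter> \<Lambda> = {}" using outer_boundaryD(1)[of _ \<Lambda>] by (auto simp: \<Lambda>_def)
      have m: "cexp (A \<union> ?B) y g = cexp ?B y g" if "pos (A \<union> ?B) y" for y
        using g depends_on_mono[OF _ S\<Lambda>, of g] by (intro cexp_markov[OF \<Lambda> fAB _ disj _ that]) auto
      have "\<bar>cexp ?B y g - cexp ?B y' g\<bar> \<le> real (card (S - A)) * \<rho> r"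
      proof (rule ssm_cexp[OF ssm \<Lambda> S\<Lambda>])
        fix i j assume i: "i \<in> S - A" and j: "j \<in> ?B" "y j \<noteq> y' j"
        show "r \<le> l1_dist i j"
        proof (cases "j \<in> A")
          case True
          then have "j = v" using agree[of j] y(1,2) j(2) by (auto simp: cyl_def)
          then show ?thesis using i by (simp add: S_def l1_dist_commute)
        next
          case False
          then have "2 * r < l1_dist v j" using outer_boundaryD(1)[OF j(1)] by (auto simp: \<Lambda>_def)
          then show ?thesis using l1_dist_triangle[of v j i] i by (simp add: S_def)
        qed
      next
        show "pos ?B y" "pos ?B y'" using pos_mono[OF y(3) _ fAB, of ?B] pos_mono[OF y(4) _ fAB, of ?B] by
            auto
      qed (use g in auto)
      then show "\<bar>cexp (A \<union> ?B) y g - cexp (A \<union> ?B) y' g\<bar> \<le> real (card (S - A)) * \<rho> r"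
        using m y by simp
    qed
    then show "\<bar>cexp A \<eta> g - cexp A \<eta>' g\<bar> \<le> real (card (S - A)) * \<rho> r"
      using fAB intg by (simp add: cexp_tower)
  qed
  then have "influence_le A \<eta> \<eta>' (S - A) (real ((2 * r + 1) ^ CARD('d)) * \<rho> r)"
  proof (rule influence_mono[OF _ subset_refl])
    have "card (S - A) \<le> (2 * r + 1) ^ CARD('d)" using card_mono[OF fS, of "S - A"] cS by auto
    then show "real (card (S - A)) * \<rho> r \<le> real ((2 * r + 1) ^ CARD('d)) * \<rho> r"
      by (intro mult_right_mono \<rho>0) (rule of_nat_mono)
  qed
  then have "influence_le A \<eta> \<eta>' ((S - A) \<union> (S \<inter> A)) (real ((2 * r + 1) ^ CARD('d)) * \<rho> r)"
    by (rule influence_add_agree) (use r in \<open>auto intro!: agree simp: S_def l1_dist_def\<close>)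
  moreover have "(S - A) \<union> (S \<inter> A) = S" by auto
  ultimately show ?thesis by (simp add: S_def)
qed

text \<open>The open ball around \<open>v\<close> is forgotten once the sphere is known. As
  \<open>r \<ge> 1\<close>, the site \<open>v\<close> lies in this ball, so no disagreement is left
  off the sphere. The contraction factor is the trivial 1, since the bound on the sphere already
  decays.\<close>

lemma ssm_outside:
  assumes ssm: "strong_spatial_mixing \<nu> \<rho>" and A: "finite A" and p: "pos A \<eta>" "pos A \<eta>'"
    and agree: "\<And>i. i \<in> A \<Longrightarrow> i \<noteq> v \<Longrightarrow> \<eta> i = \<eta>' i" and r: "r \<ge> 1"
    and T: "finite T" "\<And>j. j \<in> T \<Longrightarrow> r \<le> l1_dist v j"
  shows "influence_le A \<eta> \<eta>' T (real ((2 * r + 1) ^ CARD('d)) * \<rho> r)"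
proof -
  define S where "S = {i. l1_dist v i = r}"
  have fS: "finite S" unfolding S_def using l1_ball_bound(1)[of v r] by (rule finite_subset[rotated]) auto
  define \<Lambda> where "\<Lambda> = {i. l1_dist v i < r}"
  have \<Lambda>: "finite \<Lambda>" unfolding \<Lambda>_def using l1_ball_bound(1)[of v r] by (rule finite_subset[rotated]) auto
  have bd: "outer_boundary \<Lambda> \<subseteq> S"
  proof
    fix j assume j: "j \<in> outer_boundary \<Lambda>"
    obtain i where i: "i \<in> \<Lambda>" "l1_dist j i = 1" using outer_boundaryD(2)[OF j] by blast
    have "l1_dist v j \<le> l1_dist v i + 1"
      using l1_dist_triangle[of v j i] i(2) by (simp add: l1_dist_commute)
    then show "j \<in> S" using i(1) outer_boundaryD(1)[OF j] by (auto simp: \<Lambda>_def S_def)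
  qed
  let ?\<tau> = "real ((2 * r + 1) ^ CARD('d)) * \<rho> r"
  have "influence_le A \<eta> \<eta>' T (?\<tau> * 1)"
  proof (rule influence_screen[where S = S and B = "(A \<union> S) - \<Lambda>"])
    show "influence_le A \<eta> \<eta>' S ?\<tau>" unfolding S_def by (rule ssm_sphere[OF ssm A p agree r])
    show "cexp (A \<union> S) y g = cexp (A \<union> S - \<Lambda>) y g" if "depends_on g T" "pos (A \<union> S) y" for y g
      using A fS bd T that by (intro cexp_markov_outside[OF \<Lambda>, of _ T]) (fastforce simp: \<Lambda>_def)+
    show "\<eta> i = \<eta>' i" if "i \<in> A \<union> S - \<Lambda> - S" for i
      using that r by (intro agree) (auto simp: \<Lambda>_def l1_dist_def)
    show "influence_le (A \<union> S - \<Lambda>) y y' T 1" for y y' using A fS T(1) by (intro influence_one) auto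
  qed (use A fS T p in auto)
  then show ?thesis by simp
qed

theorem gaussian_concentration_of_ssm:
  assumes "exponential_strong_spatial_mixing \<nu>"
  shows "gaussian_concentration \<nu>"
proof -
  obtain \<rho> c C where ssm: "strong_spatial_mixing \<nu> \<rho>" and c: "c > 0" and C: "C > 0"
    and \<rho>: "\<And>n. n \<ge> 1 \<Longrightarrow> \<rho> n \<le> C * exp (- c * real n)"
    using assms unfolding exponential_strong_spatial_mixing_def exponential_rate_def by blast
  let ?d = "CARD('d)"
  obtain K where K: "K \<ge> 0" "\<And>r::nat. (1 + real r) ^ (?d + (?d + 2)) * exp (- c * real r) \<le> K"
    using poly_exp_bounded[OF c] by blast
  \<comment> \<open>The entry 1 is for \<open>r = 0\<close>, where only the trivial bound is
    available.\<close>
  define C0 where "C0 = max 1 (2 ^ ?d * C * K)"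
  have bound: "real ((2 * r + 1) ^ ?d) * \<rho> r \<le> C0 / (1 + real r) ^ (?d + 2)" if "r \<ge> 1" for r
  proof -
    have "real ((2 * r + 1) ^ ?d) \<le> (2 * (1 + real r)) ^ ?d"
      unfolding of_nat_power by (intro power_mono) auto
    then have 1: "real ((2 * r + 1) ^ ?d) \<le> 2 ^ ?d * (1 + real r) ^ ?d"
      by (simp only: power_mult_distrib)
    have "real ((2 * r + 1) ^ ?d) * \<rho> r \<le> (2 ^ ?d * (1 + real r) ^ ?d) * (C * exp (- c * real r))"
      using ssm by (intro mult_mono 1 \<rho> that) (auto simp: strong_spatial_mixing_def mixing_rate_def)
    then have "real ((2 * r + 1) ^ ?d) * \<rho> r * (1 + real r) ^ (?d + 2)
        \<le> (2 ^ ?d * (1 + real r) ^ ?d) * (C * exp (- c * real r)) * (1 + real r) ^ (?d + 2)"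
      by (intro mult_right_mono) auto
    also have "\<dots> = 2 ^ ?d * C * ((1 + real r) ^ (?d + (?d + 2)) * exp (- c * real r))"
      by (simp add: power_add mult_ac)
    also have "\<dots> \<le> 2 ^ ?d * C * K" using C by (intro mult_left_mono K) auto
    also have "\<dots> \<le> C0" by (simp add: C0_def)
    finally show ?thesis by (simp add: pos_le_divide_eq)
  qed
  show ?thesis
  proof (rule gaussian_concentration_of_influences[of C0])
    show "C0 \<ge> 0" by (simp add: C0_def)
    fix \<Delta> :: "(int ^ 'd) set" assume \<Delta>: "finite \<Delta>"
    \<comment> \<open>Any order will do, and \<open>Q = \<Delta>\<close>: strong mixing holds in
      volumes of every shape.\<close>
    obtain k :: "int ^ 'd \<Rightarrow> nat" where k: "inj_on k \<Delta>" using finite_imp_inj_to_nat_seg[OF \<Delta>] by blast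
    define \<kappa> where "\<kappa> i = int (k i)" for i
    have inj: "inj_on \<kappa> \<Delta>" using k by (auto simp: \<kappa>_def inj_on_def)
    show "\<exists>Q (\<kappa> :: int ^ 'd \<Rightarrow> int) e. finite Q \<and> \<Delta> \<subseteq> Q \<and> inj_on \<kappa> Q \<and> e \<ge> 0 \<and> e * real (card Q) \<le> 1 \<and>
      (\<forall>v\<in>Q. \<forall>r \<eta> \<eta>'. (\<forall>i\<in>{i\<in>Q. \<kappa> i < \<kappa> v}. \<eta> i = \<eta>' i) \<longrightarrow> pos {i\<in>Q. \<kappa> i \<le> \<kappa> v} \<eta> \<longrightarrow> pos {i\<in>Q. \<kappa> i \<le> \<kappa> v} \<eta>' \<longrightarrow>
         influence_le {i\<in>Q. \<kappa> i \<le> \<kappa> v} \<eta> \<eta>' {j\<in>\<Delta>. r \<le> l1_dist v j} (C0 / (1 + real r) ^ (CARD('d) + 2) +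
             e))"
    proof (rule exI[of _ \<Delta>], rule exI[of _ \<kappa>], rule exI[of _ 0], intro conjI ballI allI impI)
      fix v r and \<eta> \<eta>' :: "int ^ 'd \<Rightarrow> 'b"
      let ?A = "{i\<in>\<Delta>. \<kappa> i \<le> \<kappa> v}" and ?T = "{j\<in>\<Delta>. r \<le> l1_dist v j}"
      assume a: "v \<in> \<Delta>" "\<forall>i\<in>{i\<in>\<Delta>. \<kappa> i < \<kappa> v}. \<eta> i = \<eta>' i" "pos ?A \<eta>" "pos ?A \<eta>'"
      have agree: "\<eta> i = \<eta>' i" if "i \<in> ?A" "i \<noteq> v" for i
        using that a(1,2) inj by (auto simp: inj_on_def order_le_less)
      show "influence_le ?A \<eta> \<eta>' ?T (C0 / (1 + real r) ^ (CARD('d) + 2) + 0)"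
      proof (cases "r \<ge> 1")
        case True
        have "influence_le ?A \<eta> \<eta>' ?T (real ((2 * r + 1) ^ CARD('d)) * \<rho> r)"
          using \<Delta> True by (intro ssm_outside[OF ssm _ a(3,4) agree]) auto
        then show ?thesis by (rule influence_mono) (use bound[OF True] in auto)
      next
        case False
        then have "r = 0" by simp
        have "influence_le ?A \<eta> \<eta>' ?T 1" using \<Delta> by (intro influence_one) auto
        then show ?thesis by (rule influence_mono) (auto simp: \<open>r = 0\<close> C0_def)
      qed
    qed (use \<Delta> inj in auto)
  qed
qed

end

section \<open>Composing influences\<close>

context random_field
begin

lemma influence_sym: "influence_le A \<eta> \<eta>' S \<tau> \<longleftrightarrow> influence_le A \<eta>' \<eta> S \<tau>"
  by (simp add: influence_le_def abs_minus_commute)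

text \<open>In terms of the overlap \<open>1 - \<tau>\<close> of two laws: the overlap on \<open>S \<union> S'\<close> is at least the
  overlap on \<open>S\<close> times the conditional overlap on \<open>S'\<close> once the patterns on \<open>S\<close> agree.\<close>

lemma influence_Un:
  assumes fin: "finite A" "finite S" "finite S'" and p: "pos A \<eta>" "pos A \<eta>'"
    and S: "influence_le A \<eta> \<eta>' S \<tau>" and \<tau>: "\<tau>' \<le> 1"
    and S': "\<And>y y'. (\<And>i. i \<in> A - S \<Longrightarrow> y i = \<eta> i) \<Longrightarrow> (\<And>i. i \<in> A - S \<Longrightarrow> y' i = \<eta>' i) \<Longrightarrow> (\<And>i. i \<in> S \<Longrightarrow> y i = y' i)
        \<Longrightarrow> influence_le (A \<union> S) y y' S' \<tau>'"
  shows "influence_le A \<eta> \<eta>' (S \<union> S') (1 - (1 - \<tau>) * (1 - \<tau>'))"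
proof -
  have \<tau>'0: "0 \<le> \<tau>'"
    using S'[of "\<lambda>i. if i \<in> A - S then \<eta> i else undefined" "\<lambda>i. if i \<in> A - S then \<eta>' i else undefined"]
    by (auto dest: influence_nonneg)
  have one: "cexp A \<xi> g - cexp A \<xi>' g \<le> 1 - (1 - \<tau>) * (1 - \<tau>')"
    if g: "depends_on g (S \<union> S')" "\<And>y. 0 \<le> g y \<and> g y \<le> 1" and p: "pos A \<xi>" "pos A \<xi>'"
        and S: "influence_le A \<xi> \<xi>' S \<tau>"
    and S': "\<And>y y'. (\<And>i. i \<in> A - S \<Longrightarrow> y i = \<xi> i) \<Longrightarrow> (\<And>i. i \<in> A - S \<Longrightarrow> y' i = \<xi>' i) \<Longrightarrow> (\<And>i. i \<in> S \<Longrightarrow> y i = y' i)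
        \<Longrightarrow> influence_le (A \<union> S) y y' S' \<tau>'"
    for g and \<xi> \<xi>' :: "int ^ 'd \<Rightarrow> 'b"
  proof -
    define G where "G \<zeta> y = cexp (A \<union> S) (\<lambda>i. if i \<in> A - S then \<zeta> i else y i) g" for \<zeta> y
    have dG: "depends_on (G \<zeta>) S" for \<zeta>
      unfolding depends_on_def G_def by (intro allI impI cexp_eqI) auto
    have intG: "integrable \<nu> (G \<zeta>)" for \<zeta> by (rule depends_on_integrable[OF fin(2) dG])
    have intg: "integrable \<nu> g" by (rule depends_on_integrable[OF _ g(1)]) (use fin in simp)
    have eq: "cexp A \<zeta> g = cexp A \<zeta> (G \<zeta>)" for \<zeta>
    proof -
      have "cexp A \<zeta> g = cexp A \<zeta> (\<lambda>y. cexp (A \<union> S) y g)"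
        using fin intg by (intro cexp_tower[symmetric]) auto
      also have "\<dots> = cexp A \<zeta> (G \<zeta>)"
        unfolding G_def by (intro cexp_cong cexp_eqI) (auto simp: cyl_def)
      finally show ?thesis .
    qed
    have rng: "0 \<le> G \<zeta> y \<and> G \<zeta> y \<le> 1" for \<zeta> y
      unfolding G_def using fin g by (intro cexp_unit_range[of _ "S \<union> S'"]) auto
    have close: "\<bar>G \<xi> y - G \<xi>' y\<bar> \<le> \<tau>'" for y
    proof -
      let ?m = "\<lambda>\<zeta> i. if i \<in> A - S then \<zeta> i else y i"
      have "influence_le (A \<union> S) (?m \<xi>) (?m \<xi>') (S' \<union> S) \<tau>'"
        by (intro influence_add_agree S') auto
      then show ?thesis unfolding G_def using g by (intro influence_leD) (auto simp: Un_commute)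
    qed
    \<comment> \<open>\<open>H\<close> dominates \<open>G \<xi>\<close> but is a single function
      that can be compared under both laws. Truncation at 1 confines it to an interval of length
      \<open>1 - \<tau>'\<close>, which produces the product of the overlaps instead of a mere sum
      of errors.\<close>
    define H where "H y = min (G \<xi>' y + \<tau>') 1" for y
    have dH: "depends_on H S" unfolding H_def by (rule depends_on_comp[OF dG])
    have intH: "integrable \<nu> H" by (rule depends_on_integrable[OF fin(2) dH])
    have "cexp A \<xi> g \<le> cexp A \<xi> H"
      unfolding eq[of \<xi>] using close rng
      by (intro cexp_mono_AE p fin intG intH AE_I2 impI) (auto simp: H_def abs_le_iff algebra_simps)
    moreover have "\<bar>cexp A \<xi> H - cexp A \<xi>' H\<bar> \<le> \<tau> * (1 - \<tau>')"
    proof (rule influence_scale[OF S p fin(1,2) dH])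
      fix y y'
      have "\<tau>' \<le> H y" "H y \<le> 1" for y using rng[of \<xi>' y] \<tau> by (auto simp: H_def)
      from this[of y] this[of y'] show "\<bar>H y - H y'\<bar> \<le> 1 - \<tau>'" by linarith
    qed
    moreover have "cexp A \<xi>' H \<le> cexp A \<xi>' g + \<tau>'"
    proof -
      have "cexp A \<xi>' H \<le> cexp A \<xi>' (\<lambda>y. G \<xi>' y + \<tau>')"
        using intG intH by (intro cexp_mono_AE p fin AE_I2 impI) (auto simp: H_def)
      also have "\<dots> = cexp A \<xi>' (G \<xi>') + cexp A \<xi>' (\<lambda>_. \<tau>')"
        using intG fin by (intro cexp_add) auto
      finally show ?thesis using eq[of \<xi>'] cexp_const[OF p(2) fin(1), of \<tau>'] by simp
    qed
    ultimately show ?thesis by (simp add: algebra_simps abs_le_iff)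
  qed
  show ?thesis
    unfolding influence_le_def
  proof (intro allI impI)
    fix g :: "(int ^ 'd \<Rightarrow> 'b) \<Rightarrow> real" assume g: "depends_on g (S \<union> S') \<and> (\<forall>y. 0 \<le> g y \<and> g y \<le> 1)"
    have "cexp A \<eta> g - cexp A \<eta>' g \<le> 1 - (1 - \<tau>) * (1 - \<tau>')"
      using g by (intro one p S S') auto
    moreover have "cexp A \<eta>' g - cexp A \<eta> g \<le> 1 - (1 - \<tau>) * (1 - \<tau>')"
    proof (rule one)
      show "influence_le A \<eta>' \<eta> S \<tau>" using S influence_sym by blast
      fix y y' assume "\<And>i. i \<in> A - S \<Longrightarrow> y i = \<eta>' i" "\<And>i. i \<in> A - S \<Longrightarrow> y' i = \<eta> i" "\<And>i. i \<in> S \<Longrightarrow> y i = y' i"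
      then have "influence_le (A \<union> S) y' y S' \<tau>'" by (intro S') auto
      then show "influence_le (A \<union> S) y y' S' \<tau>'" using influence_sym by blast
    qed (use g p in auto)
    ultimately show "\<bar>cexp A \<eta> g - cexp A \<eta>' g\<bar> \<le> 1 - (1 - \<tau>) * (1 - \<tau>')" by linarith
  qed
qed

text \<open>Screening is iterated. After the reduction from \<open>A \<union> D i\<close> to
  \<open>B i\<close>, the two conditionings can differ only on the layer \<open>D i\<close>, so each
  passage to the next layer costs one factor \<open>w\<close>.\<close>

lemma influence_chain:
  assumes fin: "finite A" "\<And>n. finite (D n)" and p: "pos A \<eta>" "pos A \<eta>'"
    and B: "\<And>i. i < n \<Longrightarrow> B i \<subseteq> A \<union> D i"
    and screen: "\<And>i y g. i < n \<Longrightarrow> depends_on g (D (Suc i)) \<Longrightarrow> pos (A \<union> D i) y \<Longrightarrow>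
        cexp (A \<union> D i) y g = cexp (B i) y g"
    and agree: "\<And>i j. i < n \<Longrightarrow> j \<in> B i - D i \<Longrightarrow> \<eta> j = \<eta>' j"
    and w: "\<And>i y y'. i < n \<Longrightarrow> (\<And>j. j \<in> B i - D i \<Longrightarrow> y j = y' j) \<Longrightarrow> influence_le (B i) y y' (D (Suc i)) w"
  shows "influence_le A \<eta> \<eta>' (D n) (w ^ n)"
  using B screen agree w
proof (induction n)
  case 0
  show ?case using influence_one[OF fin(1) fin(2)] by simp
next
  case (Suc n)
  have "influence_le A \<eta> \<eta>' (D (Suc n)) (w ^ n * w)"
  proof (rule influence_screen[where S = "D n" and B = "B n"])
    show "influence_le A \<eta> \<eta>' (D n) (w ^ n)"
    proof (rule Suc.IH)
      fix i assume "i < n"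
      then have i: "i < Suc n" by simp
      show "B i \<subseteq> A \<union> D i" by (rule Suc.prems(1)[OF i])
      show "cexp (A \<union> D i) y g = cexp (B i) y g" if "depends_on g (D (Suc i))" "pos (A \<union> D i) y" for y g
        by (rule Suc.prems(2)[OF i that])
      show "\<eta> j = \<eta>' j" if "j \<in> B i - D i" for j by (rule Suc.prems(3)[OF i that])
      show "influence_le (B i) y y' (D (Suc i)) w" if "\<And>j. j \<in> B i - D i \<Longrightarrow> y j = y' j" for y y'
        by (rule Suc.prems(4)[OF i that])
    qed
    show "cexp (A \<union> D n) y g = cexp (B n) y g" if "depends_on g (D (Suc n))" "pos (A \<union> D n) y" for y g
      by (rule Suc.prems(2)[OF lessI that])
    show "\<eta> j = \<eta>' j" if "j \<in> B n - D n" for j by (rule Suc.prems(3)[OF lessI that])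
    show "influence_le (B n) y y' (D (Suc n)) w" if "\<And>j. j \<in> B n - D n \<Longrightarrow> y j = y' j" for y y'
      by (rule Suc.prems(4)[OF lessI that])
  qed (use fin p Suc.prems(1)[OF lessI] in auto)
  then show ?case by (simp add: mult.commute)
qed

end

section \<open>Uniform positivity and weak mixing under partial conditioning\<close>

locale full_markov_field = markov_field \<nu> for \<nu> :: "(int ^ 'd \<Rightarrow> 'b :: finite) measure" +
  assumes shift: "shift_invariant \<nu>" and nhc: "no_hard_constraints \<nu>"
begin

lemma pos_cyl [simp]: "finite A \<Longrightarrow> pos A \<eta>"
  using no_hard_constraints_pos[OF nhc] .

lemma measure_cyl_shift:
  assumes "finite A"
  shows "measure \<nu> (cyl ((\<lambda>i. i + k) ` A) \<eta>) = measure \<nu> (cyl A (\<lambda>i. \<eta> (i + k)))"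
proof -
  let ?s = "\<lambda>y :: int ^ 'd \<Rightarrow> 'b. \<lambda>i. y (i + k)"
  have m: "?s \<in> measurable \<nu> (pattern_space UNIV)"
    by (rule measurable_PiM_single') (auto simp: space_PiM)
  have d: "distr \<nu> (pattern_space UNIV) ?s = \<nu>" using shift by (simp add: shift_invariant_def)
  have c: "cyl A (\<lambda>i. \<eta> (i + k)) \<in> sets (pattern_space UNIV)" using cyl_sets[OF assms] sets_field by blast
  have "measure (distr \<nu> (pattern_space UNIV) ?s) (cyl A (\<lambda>i. \<eta> (i + k))) = measure \<nu> (?s -` cyl A (\<lambda>i. \<eta>
      (i + k)) \<inter> space \<nu>)"
    by (rule measure_distr[OF m c])
  also have "?s -` cyl A (\<lambda>i. \<eta> (i + k)) \<inter> space \<nu> = cyl ((\<lambda>i. i + k) ` A) \<eta>"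
    by (auto simp: cyl_def)
  finally show ?thesis by (simp add: d)
qed

text \<open>Given its neighbours, a site has one of finitely many conditional laws, all with
  positive weights as there are no hard constraints, and shift invariance makes the bound the same
  at every site. For an arbitrary conditioning set the neighbours are averaged over by the tower
  property.\<close>

lemma single_site_bound:
  obtains \<epsilon> where "0 < \<epsilon>" "\<epsilon> \<le> 1" "\<And>i A \<eta> a. finite A \<Longrightarrow> i \<notin> A \<Longrightarrow> \<epsilon> \<le> cexp A \<eta> (indicator (cyl {i} a))"
proof -
  define N where "N i = outer_boundary {i}" for i :: "int ^ 'd"
  have fN: "finite (N i)" for i by (simp add: N_def)
  define F where "F i s = measure \<nu> (cyl (insert i (N i)) s) / measure \<nu> (cyl (N i) s)" for i s
  define P where "P = patterns (insert 0 (N 0))"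
  have "finite P" unfolding P_def using fN by (intro finite_patterns) simp
  moreover have "P \<noteq> {}" by (simp add: P_def patterns_def PiE_eq_empty_iff)
  ultimately have P: "finite P" "P \<noteq> {}" by auto
  define \<epsilon> where "\<epsilon> = Min (F 0 ` P)"
  have \<epsilon>F: "\<epsilon> \<le> F 0 s" for s
  proof -
    have "F 0 s = F 0 (restrict s (insert 0 (N 0)))"
      unfolding F_def by (intro arg_cong2[where f = "(/)"] arg_cong[where f = "measure \<nu>"] cyl_eqI) auto
    moreover have "restrict s (insert 0 (N 0)) \<in> P" by (auto simp: P_def patterns_def)
    ultimately show ?thesis unfolding \<epsilon>_def using P by (auto intro!: Min_le)
  qed
  have Fpos: "0 < F 0 s" for s using fN by (simp add: F_def)
  have \<epsilon>0: "0 < \<epsilon>" unfolding \<epsilon>_def using P Fpos by (subst Min_gr_iff) auto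
  have F1: "F 0 s \<le> 1" for s
    unfolding F_def using fN by (auto simp: divide_le_eq_1 intro!: finite_measure_mono) (auto simp: cyl_def)
  have \<epsilon>1: "\<epsilon> \<le> 1" using \<epsilon>F[of undefined] F1[of undefined] by linarith
  have shiftF: "F i s = F 0 (\<lambda>j. s (j + i))" for i s
  proof -
    have "N i = (\<lambda>j. j + i) ` N 0"
    proof -
      have "l1_dist j i = l1_dist (j - i) 0" for j by (simp add: l1_dist_def)
      then show ?thesis
        unfolding N_def outer_boundary_singleton by (auto intro!: image_eqI[of _ _ "_ - i"])
    qed
    moreover from this have "insert i (N i) = (\<lambda>j. j + i) ` insert 0 (N 0)" by simp
    ultimately show ?thesis unfolding F_def using fN[of 0] by (simp only: measure_cyl_shift finite_insert)
  qed
  show ?thesis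
  proof (rule that[OF \<epsilon>0 \<epsilon>1])
    fix i A \<eta> a assume A: "finite A" "i \<notin> (A :: (int ^ 'd) set)"
    let ?g = "indicator (cyl {i} a) :: (int ^ 'd \<Rightarrow> 'b) \<Rightarrow> real"
    have iN: "i \<notin> N i" unfolding N_def using outer_boundaryD(1) by blast
    have fAN: "finite (A \<union> N i)" using A fN by simp
    have intg: "integrable \<nu> ?g" by (rule depends_on_integrable[OF _ depends_on_cyl]) simp
    have site: "\<epsilon> \<le> cexp (A \<union> N i) y ?g" for y
    proof -
      have "cexp (A \<union> N i) y ?g = cexp (N i) y ?g"
        using A iN fAN depends_on_cyl[of "{i}" a] unfolding N_def by (intro cexp_markov) auto
      also have "\<dots> = measure \<nu> (cyl (N i) y \<inter> cyl {i} a) / measure \<nu> (cyl (N i) y)"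
        using fN by (intro cexp_indicator) auto
      also have "\<dots> = F i (y(i := a i))"
        unfolding F_def using iN
        by (intro arg_cong2[where f = "(/)"] arg_cong[where f = "measure \<nu>"]) (auto simp: cyl_def)
      finally show ?thesis using \<epsilon>F[of "\<lambda>j. (y(i := a i)) (j + i)"] by (simp only: shiftF[of i])
    qed
    have "\<epsilon> \<le> cexp A \<eta> (\<lambda>y. cexp (A \<union> N i) y ?g)"
      using A site depends_on_integrable[OF fAN depends_on_cexp] by (intro cexp_ge) auto
    then show "\<epsilon> \<le> cexp A \<eta> ?g" using fAN intg by (simp add: cexp_tower)
  qed
qed

lemma influence_agree:
  assumes "finite A" "X \<subseteq> A" "\<And>i. i \<in> X \<Longrightarrow> \<eta> i = \<eta>' i"
  shows "influence_le A \<eta> \<eta>' X 0"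
proof -
  have "influence_le A \<eta> \<eta>' {} 0"
    unfolding influence_le_def
  proof (intro allI impI)
    fix g :: "(int ^ 'd \<Rightarrow> 'b) \<Rightarrow> real" assume "depends_on g {} \<and> (\<forall>y. 0 \<le> g y \<and> g y \<le> 1)"
    then have "g = (\<lambda>_. g undefined)" by (auto simp: depends_on_def)
    then have "cexp A z g = g undefined" for z using cexp_const[OF pos_cyl[OF assms(1)] assms(1),
        of z "g undefined"] by simp
    then show "\<bar>cexp A \<eta> g - cexp A \<eta>' g\<bar> \<le> 0" by simp
  qed
  from influence_add_agree[OF this assms(2,3)] show ?thesis by simp
qed

text \<open>Both laws give mass at least \<open>\<epsilon>\<close> to one and the same letter, here
  \<open>undefined\<close>, so they overlap by at least \<open>\<epsilon>\<close>. A site already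
  revealed has to agree.\<close>

lemma influence_site:
  assumes \<epsilon>: "\<epsilon> \<le> 1" "\<And>i A \<eta> a. finite A \<Longrightarrow> i \<notin> A \<Longrightarrow> \<epsilon> \<le> cexp A \<eta> (indicator (cyl {i} a))"
    and A: "finite A" and i: "i \<in> A \<Longrightarrow> \<eta> i = \<eta>' i"
  shows "influence_le A \<eta> \<eta>' {i} (1 - \<epsilon>)"
proof (cases "i \<in> A")
  case True
  have "influence_le A \<eta> \<eta>' {i} 0" by (rule influence_agree) (use True i A in auto)
  then show ?thesis by (rule influence_mono) (use \<epsilon> in auto)
next
  case False
  have one: "cexp A \<xi> g - cexp A \<xi>' g \<le> 1 - \<epsilon>" if g: "depends_on g {i}" "\<And>y. 0 \<le> g y \<and> g y \<le> 1" for g \<xi> \<xi>'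
  proof -
    let ?I = "indicator (cyl {i} undefined) :: (int ^ 'd \<Rightarrow> 'b) \<Rightarrow> real"
    let ?a = "g undefined"
    have I: "\<epsilon> \<le> cexp A \<zeta> ?I" for \<zeta> by (rule \<epsilon>(2)[OF A False])
    have intI: "integrable \<nu> ?I" by (rule depends_on_integrable[OF _ depends_on_cyl]) simp
    have intg: "integrable \<nu> g" by (rule depends_on_integrable[OF _ g(1)]) simp
    have ga: "g y = ?a" if "y \<in> cyl {i} undefined" for y
      using that by (intro depends_onD[OF g(1)]) (auto simp: cyl_def)
    have "cexp A \<xi> g \<le> cexp A \<xi> (\<lambda>y. 1 - (1 - ?a) * ?I y)"
    proof (intro cexp_mono_AE AE_I2 impI)
      show "g y \<le> 1 - (1 - ?a) * ?I y" for y
        using g(2)[of y] ga[of y] by (cases "y \<in> cyl {i} undefined") simp_all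
    qed (use A intg intI in auto)
    also have "\<dots> = 1 - (1 - ?a) * cexp A \<xi> ?I"
      using A intI by (subst cexp_diff) (auto simp: cexp_cmult cexp_const)
    also have "\<dots> \<le> 1 - (1 - ?a) * \<epsilon>"
      using I[of \<xi>] g(2)[of undefined] by (intro diff_left_mono mult_left_mono) auto
    finally have 1: "cexp A \<xi> g \<le> 1 - (1 - ?a) * \<epsilon>" .
    have "?a * \<epsilon> \<le> ?a * cexp A \<xi>' ?I" using I[of \<xi>'] g(2)[of undefined] by (intro mult_left_mono) auto
    also have "\<dots> = cexp A \<xi>' (\<lambda>y. ?a * ?I y)" by (rule cexp_cmult[symmetric])
    also have "\<dots> \<le> cexp A \<xi>' g"
    proof (intro cexp_mono_AE AE_I2 impI)
      show "?a * ?I y \<le> g y" for y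
        using g(2)[of y] ga[of y] by (cases "y \<in> cyl {i} undefined") simp_all
    qed (use A intg intI in auto)
    finally show ?thesis using 1 by (simp add: algebra_simps)
  qed
  show ?thesis
    unfolding influence_le_def by (intro allI impI) (use one in \<open>simp add: abs_le_iff\<close>)
qed

text \<open>Sites are adjoined one at a time by \<open>influence_Un\<close>, and the overlaps
  multiply.\<close>

lemma influence_sites:
  assumes \<epsilon>: "0 < \<epsilon>" "\<epsilon> \<le> 1" "\<And>i A \<eta> a. finite A \<Longrightarrow> i \<notin> A \<Longrightarrow> \<epsilon> \<le> cexp A \<eta> (indicator (cyl {i} a))"
    and A: "finite A" and F: "finite F" and agree: "\<And>i. i \<in> F \<inter> A \<Longrightarrow> \<eta> i = \<eta>' i"
  shows "influence_le A \<eta> \<eta>' F (1 - \<epsilon> ^ card F)"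
  using F agree
proof (induction F)
  case empty
  then show ?case using influence_agree[OF A, of "{}"] by simp
next
  case (insert x F)
  have "influence_le A \<eta> \<eta>' (F \<union> {x}) (1 - (1 - (1 - \<epsilon> ^ card F)) * (1 - (1 - \<epsilon>)))"
  proof (rule influence_Un)
    show "influence_le A \<eta> \<eta>' F (1 - \<epsilon> ^ card F)" using insert by auto
    fix y y' assume y: "\<And>i. i \<in> A - F \<Longrightarrow> y i = \<eta> i" "\<And>i. i \<in> A - F \<Longrightarrow> y' i = \<eta>' i"
    show "influence_le (A \<union> F) y y' {x} (1 - \<epsilon>)"
      using insert y A by (intro influence_site \<epsilon>) auto
  qed (use insert A \<epsilon> in auto)
  then show ?case using insert by (simp add: mult.commute)
qed

text \<open>Weak mixing compares arbitrary boundary conditions, and without hard constraints all of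
  them are feasible. So \<open>\<eta>\<close> and \<open>\<eta>'\<close> may disagree everywhere
  outside the square, and its unrevealed boundary sites are averaged over.\<close>

lemma wsm_influence:
  assumes wsm: "weak_spatial_mixing squares \<nu> \<rho>" and \<Lambda>: "\<Lambda> \<in> squares" "finite \<Lambda>" and S: "S \<subseteq> \<Lambda>"
    and A: "finite A" "A \<inter> \<Lambda> = {}"
    and k: "\<And>i j. i \<in> S \<Longrightarrow> j \<notin> \<Lambda> \<Longrightarrow> k \<le> l1_dist i j"
  shows "influence_le A \<eta> \<eta>' S (real (card S) * \<rho> k)"
proof -
  let ?B = "outer_boundary \<Lambda>"
  have rate: "mixing_rate \<rho>" using wsm by (simp add: weak_spatial_mixing_def)
  have fS: "finite S" using \<Lambda> S finite_subset by blast
  have fAB: "finite (A \<union> ?B)" using A \<Lambda> by simp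
  have disj: "(A \<union> ?B) \<inter> \<Lambda> = {}" using outer_boundaryD(1)[of _ \<Lambda>] A by auto
  show ?thesis
    unfolding influence_le_def
  proof (intro allI impI)
    fix g :: "(int ^ 'd \<Rightarrow> 'b) \<Rightarrow> real" assume g: "depends_on g S \<and> (\<forall>y. 0 \<le> g y \<and> g y \<le> 1)"
    have intg: "integrable \<nu> g" using g fS by (intro depends_on_integrable[of S]) auto
    have le: "cexp ?B z g - cexp ?B z' g \<le> real (card S) * \<rho> k" for z z'
    proof -
      let ?z = "restrict z ?B" and ?z' = "restrict z' ?B"
      have f: "restrict w ?B \<in> feasible_on \<nu> ?B" for w
        using \<Lambda> by (intro pos_feasible pos_cyl) auto
      have "cexp ?B ?z g - cexp ?B ?z' g \<le> tv_dist (conditional_law \<nu> \<Lambda> S ?z) (conditional_law \<nu> \<Lambda> S ?z')"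
        using g \<Lambda> fS by (intro cexp_diff_le_tv) auto
      also have "\<dots> \<le> real (card S) * rate_at \<rho> (l1_setdist S ?B)"
        using wsm \<Lambda>(1) S f[of z] f[of z'] unfolding weak_spatial_mixing_def by blast
      also have "\<dots> \<le> real (card S) * \<rho> k"
        using k outer_boundaryD(1)[of _ \<Lambda>] by (intro mult_left_mono rate_at_le[OF rate]) auto
      finally show ?thesis by (simp add: cexp_def)
    qed
    have "\<bar>cexp A \<eta> (\<lambda>y. cexp (A \<union> ?B) y g) - cexp A \<eta>' (\<lambda>y. cexp (A \<union> ?B) y g)\<bar> \<le> real (card S) * \<rho> k"
    proof (rule cexp_close[OF A(1) A(1) pos_cyl[OF A(1)] pos_cyl[OF A(1)] fAB fAB depends_on_cexp
        depends_on_cexp fAB fAB])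
      fix y y'
      have m: "cexp (A \<union> ?B) y g = cexp ?B y g" for y
        using g depends_on_mono[OF _ S, of g] by (intro cexp_markov[OF \<Lambda>(2) fAB _ disj _ pos_cyl[OF fAB]])
            auto
      show "\<bar>cexp (A \<union> ?B) y g - cexp (A \<union> ?B) y' g\<bar> \<le> real (card S) * \<rho> k"
        using le[of y y'] le[of y' y] by (simp add: m abs_le_iff)
    qed
    then show "\<bar>cexp A \<eta> g - cexp A \<eta>' g\<bar> \<le> real (card S) * \<rho> k"
      using fAB intg by (simp add: cexp_tower)
  qed
qed

end

section \<open>Weak spatial mixing for squares in the plane\<close>

text \<open>The index type is only known to have two elements, which receive names here: columns are
  indexed by the coordinate \<open>p\<close> and revealed in its increasing order, while
  \<open>q\<close> runs along the line that bounds the unrevealed region.\<close>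

locale plane_field = full_markov_field \<nu> for \<nu> :: "(int ^ 'd \<Rightarrow> 'b :: finite) measure" +
  fixes p q :: 'd and \<rho> :: "nat \<Rightarrow> real" and \<epsilon> :: real
  assumes pq: "p \<noteq> q" "(UNIV :: 'd set) = {p, q}"
    and wsm: "weak_spatial_mixing squares \<nu> \<rho>"
    and \<epsilon>: "0 < \<epsilon>" "\<epsilon> \<le> 1" "\<And>i A \<eta> a. finite A \<Longrightarrow> i \<notin> A \<Longrightarrow> \<epsilon> \<le> cexp A \<eta> (indicator (cyl {i} a))"
begin

lemma rho_nonneg: "0 \<le> \<rho> n"
  using wsm by (simp add: weak_spatial_mixing_def mixing_rate_def)

definition site :: "int \<Rightarrow> int \<Rightarrow> int ^ 'd" where
  "site x y = (\<chi> k. if k = p then x else y)"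

lemma site_eta: "site (i $ p) (i $ q) = i"
  using pq by (auto simp: site_def vec_eq_iff)

lemma l1_dist_plane: "l1_dist i j = nat \<bar>i $ p - j $ p\<bar> + nat \<bar>i $ q - j $ q\<bar>"
  using pq(1) by (simp add: l1_dist_def pq(2))

lemma rect_bound:
  assumes "X \<subseteq> {i. x1 \<le> i $ p \<and> i $ p \<le> x2 \<and> y1 \<le> i $ q \<and> i $ q \<le> y2}"
  shows "finite X" "card X \<le> nat (x2 - x1 + 1) * nat (y2 - y1 + 1)"
proof -
  have s: "X \<subseteq> (\<lambda>(x, y). site x y) ` ({x1..x2} \<times> {y1..y2})"
  proof
    fix i assume "i \<in> X"
    then have "(i $ p, i $ q) \<in> {x1..x2} \<times> {y1..y2}" using assms by auto
    then show "i \<in> (\<lambda>(x, y). site x y) ` ({x1..x2} \<times> {y1..y2})"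
      using site_eta[of i] by (intro image_eqI[of _ _ "(i $ p, i $ q)"]) auto
  qed
  then show "finite X" by (rule finite_subset) auto
  have "card X \<le> card ((\<lambda>(x, y). site x y) ` ({x1..x2} \<times> {y1..y2}))" by (rule card_mono[OF _ s]) auto
  also have "\<dots> \<le> card ({x1..x2} \<times> {y1..y2})" by (rule card_image_le) auto
  also have "\<dots> = nat (x2 - x1 + 1) * nat (y2 - y1 + 1)" by (simp add: card_cartesian_product)
  finally show "card X \<le> nat (x2 - x1 + 1) * nat (y2 - y1 + 1)" .
qed

definition box :: "int \<Rightarrow> int \<Rightarrow> nat \<Rightarrow> (int ^ 'd) set" where
  "box a b n = {i. a \<le> i $ p \<and> i $ p < a + int n \<and> b \<le> i $ q \<and> i $ q < b + int n}"

lemma box_square: "n \<ge> 1 \<Longrightarrow> box a b n \<in> squares"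
proof -
  assume n: "n \<ge> 1"
  have "box a b n = {i. \<forall>k. site a b $ k \<le> i $ k \<and> i $ k < site a b $ k + int n}"
  proof -
    have "(\<forall>k. P k) \<longleftrightarrow> P p \<and> P q" for P :: "'d \<Rightarrow> bool"
      using pq(2) by (metis UNIV_I insertE singletonD)
    then show ?thesis using pq(1) by (auto simp: box_def site_def)
  qed
  then show ?thesis unfolding squares_def using n by blast
qed

text \<open>Outside sites nearest to the square have a coordinate just before its first or just
  after its last one. Removing \<open>k - 1\<close> layers on each side therefore already leaves
  distance \<open>k\<close>.\<close>

lemma wsm_box:
  assumes A: "finite A" "A \<inter> box a b n = {}" and k: "k \<ge> 1"
    and S: "S \<subseteq> {i. a + int k - 1 \<le> i $ p \<and> i $ p \<le> a + int n - int k \<and> b + int k - 1 \<le> i $ q \<and>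
        i $ q \<le> b + int n - int k}"
  shows "influence_le A \<eta> \<eta>' S (real (card S) * \<rho> k)"
proof (cases "S = {}")
  case True
  then show ?thesis using influence_agree[OF A(1), of "{}"] by simp
next
  case False
  then obtain i where "i \<in> S" by blast
  then have n: "n \<ge> 1" using S k by auto
  show ?thesis
  proof (rule wsm_influence[OF wsm box_square[OF n] _ _ A])
    show "finite (box a b n)" by (rule rect_bound(1)[of _ a "a + int n" b "b + int n"]) (auto simp: box_def)
    show "S \<subseteq> box a b n" using S k by (auto simp: box_def)
    fix i j assume "i \<in> S" "j \<notin> box a b n"
    then have "int k \<le> \<bar>i $ p - j $ p\<bar> \<or> int k \<le> \<bar>i $ q - j $ q\<bar>" using S by (auto simp: box_def)
    then show "k \<le> l1_dist i j" by (auto simp: l1_dist_plane)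
  qed
qed

text \<open>Inside an unrevealed half plane the square may be as large as desired. It starts right
  at the line and extends past \<open>S\<close> by at least \<open>K\<close> on the other three
  sides, so only the distance to the line matters.\<close>

lemma halfplane_influence:
  assumes A: "finite A" "\<And>i. i \<in> A \<Longrightarrow> i $ p \<le> x0" and K: "K \<ge> 1"
    and S: "finite S" "\<And>i. i \<in> S \<Longrightarrow> x0 + int K \<le> i $ p"
  shows "influence_le A \<eta> \<eta>' S (real (card S) * \<rho> K)"
proof -
  define R where "R = Max (insert 0 ((\<lambda>i. max \<bar>i $ p\<bar> \<bar>i $ q\<bar>) ` S))"
  have R: "\<bar>i $ p\<bar> \<le> R" "\<bar>i $ q\<bar> \<le> R" if "i \<in> S" for i
  proof -
    have "max \<bar>i $ p\<bar> \<bar>i $ q\<bar> \<le> R" unfolding R_def using that S(1) by (intro Max_ge) auto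
    then show "\<bar>i $ p\<bar> \<le> R" "\<bar>i $ q\<bar> \<le> R" by auto
  qed
  have R0: "R \<ge> 0" unfolding R_def using S(1) by (intro Max_ge) auto
  define n where "n = nat (2 * R + 2 * int K + \<bar>x0\<bar>)"
  have n: "int n = 2 * R + 2 * int K + \<bar>x0\<bar>" using R0 by (simp add: n_def)
  show ?thesis
  proof (rule wsm_box[OF A(1) _ K])
    show "A \<inter> box (x0 + 1) (- R - int K) n = {}" using A(2) by (fastforce simp: box_def)
    show "S \<subseteq> {i. x0 + 1 + int K - 1 \<le> i $ p \<and> i $ p \<le> x0 + 1 + int n - int K \<and>
        - R - int K + int K - 1 \<le> i $ q \<and> i $ q \<le> - R - int K + int n - int K}"
      using R S(2) R0 K by (fastforce simp: n)
  qed
qed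

section \<open>Chains of cross sections in a strip\<close>

definition strip :: "int \<Rightarrow> nat \<Rightarrow> int \<Rightarrow> int \<Rightarrow> (int ^ 'd) set" where
  "strip x0 K c a = {i. x0 \<le> i $ p \<and> i $ p < x0 + int K \<and> \<bar>i $ q - c\<bar> < a}"

text \<open>Both cross sections at height \<open>a\<close> form one layer, because a disagreement
  travels in both directions. The column \<open>x0\<close> is included because it may be only partly
  revealed; the walls are the columns \<open>x0 - 1\<close> and \<open>x0 + int K\<close>.\<close>

definition rows :: "int \<Rightarrow> nat \<Rightarrow> int \<Rightarrow> int \<Rightarrow> (int ^ 'd) set" where
  "rows x0 K c a = {i. x0 \<le> i $ p \<and> i $ p < x0 + int K \<and> \<bar>i $ q - c\<bar> = a}"

lemma finite_strip [simp]: "finite (strip x0 K c a)"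
  by (rule rect_bound(1)[of _ x0 "x0 + int K" "c - a" "c + a"]) (auto simp: strip_def)

lemma finite_rows [simp]: "finite (rows x0 K c a)"
  by (rule rect_bound(1)[of _ x0 "x0 + int K" "c - a" "c + a"]) (auto simp: rows_def)

lemma strip_boundary:
  assumes "j \<in> outer_boundary (strip x0 K c a)"
  shows "j \<in> rows x0 K c a \<or> ((j $ p = x0 - 1 \<or> j $ p = x0 + int K) \<and> \<bar>j $ q - c\<bar> < a)"
proof -
  obtain i where i: "i \<in> strip x0 K c a" "l1_dist j i = 1" using outer_boundaryD(2)[OF assms] by blast
  have n: "j \<notin> strip x0 K c a" by (rule outer_boundaryD(1)[OF assms])
  have "\<bar>j $ p - i $ p\<bar> + \<bar>j $ q - i $ q\<bar> = 1" using i(2) by (simp add: l1_dist_plane)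
  then consider "j $ p = i $ p" "\<bar>j $ q - i $ q\<bar> = 1" | "\<bar>j $ p - i $ p\<bar> = 1" "j $ q = i $ q" by linarith
  then show ?thesis
  proof cases
    case 1
    then show ?thesis using i(1) n by (auto simp: strip_def rows_def)
  next
    case 2
    then show ?thesis using i(1) n by (auto simp: strip_def rows_def)
  qed
qed

text \<open>Each of the two rows is crossed by a segment of bounded mixing error that stays at distance \<open>k\<close>
  from both walls; only the \<open>O(k)\<close> remaining sites are left to the positivity of the specification.\<close>

lemma cross_step:
  assumes B: "finite B" "\<And>i. i \<in> B \<Longrightarrow> x0 < i $ p \<Longrightarrow> i $ p < x0 + int K \<Longrightarrow> int h < \<bar>\<bar>i $ q - c\<bar> - a\<bar>"
    and K: "K = 2 * h + 2" and k: "1 \<le> k" "k \<le> h" "real K * \<rho> k \<le> 1 / 2" and a: "a \<ge> int K"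
    and agree: "\<And>i. i \<in> B \<inter> rows x0 K c a \<Longrightarrow> \<eta> i = \<eta>' i"
  shows "influence_le B \<eta> \<eta>' (rows x0 K c a) (1 - \<epsilon> ^ (4 * k + 2) / 4)"
proof -
  \<comment> \<open>The square \<open>bx y\<close> is centred on the row \<open>y\<close> and fills
    the \<open>K - 1 = 2 * h + 1\<close> columns strictly between \<open>x0\<close> and
    \<open>x0 + int K\<close>; centring is why \<open>K\<close> is even. \<open>mid y\<close> has at
    most \<open>K\<close> sites, all deep enough for the mixing error to be at most 1/2.\<close>
  define mid where "mid y = {i :: int ^ 'd. x0 + 1 + int k \<le> i $ p \<and> i $ p \<le> x0 + int K - 1 - int k \<and>
      i $ q = y}" for y
  define bx where "bx y = box (x0 + 1) (y - int h) (2 * h + 1)" for y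
  have fmid: "finite (mid y)" and cmid: "card (mid y) \<le> K" for y
  proof -
    have s: "mid y \<subseteq> {i. x0 + 1 + int k \<le> i $ p \<and> i $ p \<le> x0 + int K - 1 - int k \<and> y \<le> i $ q \<and> i $ q \<le> y}"
      by (auto simp: mid_def)
    show "finite (mid y)" by (rule rect_bound(1)[OF s])
    show "card (mid y) \<le> K" using rect_bound(2)[OF s] by simp
  qed
  have influence_mid: "influence_le B' y y' (mid z) (1 / 2)" if "finite B'" "B' \<inter> bx z = {}" for B' y y' z
  proof -
    have "influence_le B' y y' (mid z) (real (card (mid z)) * \<rho> k)"
      using that k unfolding bx_def by (intro wsm_box[where a = "x0 + 1" and b = "z - int h"
          and n = "2 * h + 1"]) (auto simp: mid_def K)
    moreover have "real (card (mid z)) * \<rho> k \<le> 1 / 2"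
      using mult_right_mono[of "real (card (mid z))" "real K"
          "\<rho> k"] cmid[of z] rho_nonneg[of k] k(3) by simp
    ultimately show ?thesis by (rule influence_mono[OF _ subset_refl])
  qed
  have Bbx: "B \<inter> bx (c + a) = {}" "B \<inter> bx (c - a) = {}"
  proof -
    have "i \<notin> bx (c + a) \<and> i \<notin> bx (c - a)" if "i \<in> B" for i
    proof (cases "x0 < i $ p \<and> i $ p < x0 + int K")
      case True
      then have "int h < \<bar>\<bar>i $ q - c\<bar> - a\<bar>" using B(2)[OF that] by blast
      then show ?thesis using a K by (auto simp: bx_def box_def)
    next
      case False
      then show ?thesis using K by (auto simp: bx_def box_def)
    qed
    then show "B \<inter> bx (c + a) = {}" "B \<inter> bx (c - a) = {}" by auto
  qed
  define M where "M = mid (c + a) \<union> mid (c - a)"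
  have fM: "finite M" by (simp add: M_def fmid)
  have M: "influence_le B \<eta> \<eta>' M (1 - (1 - 1 / 2) * (1 - 1 / 2))"
    unfolding M_def
  proof (rule influence_Un)
    show "influence_le B \<eta> \<eta>' (mid (c + a)) (1 / 2)" by (intro influence_mid B Bbx)
    have "mid (c + a) \<inter> bx (c - a) = {}" using a K by (auto simp: mid_def bx_def box_def)
    then show "influence_le (B \<union> mid (c + a)) y y' (mid (c - a)) (1 / 2)" for y y'
      using B(1) fmid Bbx by (intro influence_mid) auto
  qed (use B(1) fmid in auto)
  define F where "F = rows x0 K c a - M"
  have fF: "finite F" by (simp add: F_def)
  \<comment> \<open>In each of the two rows \<open>k + 1\<close> sites are left over at the lower
    end, the column \<open>x0\<close> among them, and \<open>k\<close> at the upper end.\<close>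
  have cF: "card F \<le> 4 * k + 2"
  proof -
    define E where "E x1 x2 y = {i :: int ^ 'd. x1 \<le> i $ p \<and> i $ p \<le> x2 \<and> y \<le> i $ q \<and> i $ q \<le> y}" for
        x1 x2 y
    have E: "finite (E x1 x2 y)" "card (E x1 x2 y) \<le> nat (x2 - x1 + 1)" for x1 x2 y
      using rect_bound[of "E x1 x2 y" x1 x2 y y] by (auto simp: E_def)
    have "F \<subseteq> (E x0 (x0 + int k) (c + a) \<union> E (x0 + int K - int k) (x0 + int K - 1) (c + a)) \<union>
        (E x0 (x0 + int k) (c - a) \<union> E (x0 + int K - int k) (x0 + int K - 1) (c - a))" (is "_ \<subseteq> ?X1 \<union> ?X2")
    proof
      fix i assume i: "i \<in> F"
      then have r: "x0 \<le> i $ p" "i $ p < x0 + int K" and abs: "\<bar>i $ q - c\<bar> = a" and nM: "i \<notin> M"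
        by (simp_all add: F_def rows_def)
      from abs have q: "i $ q = c + a \<or> i $ q = c - a" by linarith
      have "i $ p \<le> x0 + int k \<or> x0 + int K - int k \<le> i $ p"
      proof (rule ccontr)
        assume "\<not> ?thesis"
        then have "i \<in> mid (i $ q)" by (simp add: mid_def)
        then show False using q nM by (auto simp: M_def)
      qed
      then have "i \<in> E x0 (x0 + int k) (i $ q) \<union> E (x0 + int K - int k) (x0 + int K - 1) (i $ q)"
        using r by (auto simp: E_def)
      then show "i \<in> ?X1 \<union> ?X2" using q by auto
    qed
    then have "card F \<le> card (?X1 \<union> ?X2)" using E by (intro card_mono) auto
    also have "\<dots> \<le> card ?X1 + card ?X2" by (rule card_Un_le)
    also have "card ?X1 \<le> (k + 1) + k"
      using E(2)[of x0 "x0 + int k" "c + a"] E(2)[of "x0 + int K - int k" "x0 + int K - 1" "c + a"]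
      by (intro order_trans[OF card_Un_le] add_mono) auto
    also have "card ?X2 \<le> (k + 1) + k"
      using E(2)[of x0 "x0 + int k" "c - a"] E(2)[of "x0 + int K - int k" "x0 + int K - 1" "c - a"]
      by (intro order_trans[OF card_Un_le] add_mono) auto
    finally show ?thesis by simp
  qed
  have e1: "\<epsilon> ^ (4 * k + 2) \<le> \<epsilon> ^ card F" using \<epsilon> cF by (intro power_decreasing) auto
  \<comment> \<open>The overlap is at least 1/2 for each of the two middle segments and at least
    \<open>\<epsilon>\<close> for each remaining site.\<close>
  have "influence_le B \<eta> \<eta>' (M \<union> F) (1 - (1 - (1 - (1 - 1 / 2) * (1 - 1 / 2))) * (1 - (1 - \<epsilon> ^ card F)))"
  proof (rule influence_Un[OF B(1) fM fF _ _ M])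
    fix y y' assume y: "\<And>i. i \<in> B - M \<Longrightarrow> y i = \<eta> i" "\<And>i. i \<in> B - M \<Longrightarrow> y' i = \<eta>' i"
    show "influence_le (B \<union> M) y y' F (1 - \<epsilon> ^ card F)"
    proof (rule influence_sites[OF \<epsilon> _ fF])
      fix i assume "i \<in> F \<inter> (B \<union> M)"
      then have "i \<in> B - M" "i \<in> B \<inter> rows x0 K c a" by (auto simp: F_def)
      then show "y i = y' i" using y agree by simp
    qed (use B(1) fM in auto)
  qed (use B(1) \<epsilon>(1) in simp_all)
  then show ?thesis by (rule influence_mono) (use e1 in \<open>auto simp: F_def\<close>)
qed

text \<open>A gap of \<open>K > h\<close> between consecutive layers keeps the layer just revealed
  out of the squares around the next one. With the gap in absolute value, the layers may move
  outward or inward.\<close>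

lemma strip_chain:
  assumes A: "finite A" "\<And>i. i \<in> A \<Longrightarrow> i $ p \<le> x0 \<or> x0 + int K \<le> i $ p"
    and K: "K = 2 * h + 2" and k: "1 \<le> k" "k \<le> h" "real K * \<rho> k \<le> 1 / 2"
    and a: "\<And>i. i \<le> n \<Longrightarrow> int K \<le> a i" "\<And>i. i < n \<Longrightarrow> int K \<le> \<bar>a (Suc i) - a i\<bar>"
    and B: "\<And>i. i < n \<Longrightarrow> B i \<subseteq> A \<union> rows x0 K c (a i)" "\<And>i. i < n \<Longrightarrow> v \<notin> B i"
    and agree: "\<And>i. i \<in> A \<Longrightarrow> i \<noteq> v \<Longrightarrow> \<eta> i = \<eta>' i"
    and screen: "\<And>i y g. i < n \<Longrightarrow> depends_on g (rows x0 K c (a (Suc i))) \<Longrightarrow>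
       cexp (A \<union> rows x0 K c (a i)) y g = cexp (B i) y g"
  shows "influence_le A \<eta> \<eta>' (rows x0 K c (a n)) ((1 - \<epsilon> ^ (4 * k + 2) / 4) ^ n)"
proof (rule influence_chain[where D = "\<lambda>i. rows x0 K c (a i)" and B = B])
  fix i and y y' :: "int ^ 'd \<Rightarrow> 'b" assume i: "i < n" and y: "\<And>j. j \<in> B i - rows x0 K c (a i) \<Longrightarrow> y j = y' j"
  show "influence_le (B i) y y' (rows x0 K c (a (Suc i))) (1 - \<epsilon> ^ (4 * k + 2) / 4)"
  proof (rule cross_step[OF _ _ K k])
    show "finite (B i)" by (rule finite_subset[OF B(1)[OF i]]) (simp add: A(1))
    show "int K \<le> a (Suc i)" using i by (intro a(1)) simp
    fix j assume j: "j \<in> B i" "x0 < j $ p" "j $ p < x0 + int K"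
    then have "j \<in> rows x0 K c (a i)" using B(1)[OF i] A(2)[of j] by auto
    then have e: "\<bar>j $ q - c\<bar> = a i" by (simp add: rows_def)
    show "int h < \<bar>\<bar>j $ q - c\<bar> - a (Suc i)\<bar>" using a(2)[OF i] unfolding e K by linarith
  next
    fix j assume j: "j \<in> B i \<inter> rows x0 K c (a (Suc i))"
    then have e: "\<bar>j $ q - c\<bar> = a (Suc i)" by (simp add: rows_def)
    have "a (Suc i) \<noteq> a i" using a(2)[OF i] unfolding K by linarith
    then have "j \<notin> rows x0 K c (a i)" using e by (simp add: rows_def)
    then show "y j = y' j" using j by (intro y) blast
  qed
next
  fix i j assume i: "i < n" "j \<in> B i - rows x0 K c (a i)"
  then have "j \<in> A" "j \<noteq> v" using B(1)[OF i(1)] B(2)[OF i(1)] by auto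
  then show "\<eta> j = \<eta>' j" by (rule agree)
qed (use A B screen in auto)

text \<open>The disagreement is at \<open>v\<close>, in the middle row. Walls and the current layer
  enclose the shorter strip around \<open>v\<close>, which is forgotten at every step. Layers start
  at height \<open>K\<close>, so \<open>n\<close> contractions end at
  \<open>(n + 1) * K\<close>.\<close>

lemma outward_chain:
  assumes A: "finite A" "\<And>i. i \<in> A \<Longrightarrow> i $ p \<le> x0 \<or> x0 + int K \<le> i $ p"
    and wall: "\<And>i. (i $ p = x0 - 1 \<or> i $ p = x0 + int K) \<Longrightarrow> \<bar>i $ q - c\<bar> \<le> int ((n + 1) * K) \<Longrightarrow> i \<in> A"
    and K: "K = 2 * h + 2" and k: "1 \<le> k" "k \<le> h" "real K * \<rho> k \<le> 1 / 2"
    and v: "v $ p = x0" "v $ q = c"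
    and agree: "\<And>i. i \<in> A \<Longrightarrow> i \<noteq> v \<Longrightarrow> \<eta> i = \<eta>' i"
    and T: "finite T" "T \<inter> strip x0 K c (int ((n + 1) * K)) = {}"
  shows "influence_le A \<eta> \<eta>' T ((1 - \<epsilon> ^ (4 * k + 2) / 4) ^ n)"
proof -
  define a where "a i = int ((i + 1) * K)" for i
  have aS: "a (Suc i) = a i + int K" for i by (simp add: a_def)
  have aK: "int K \<le> a i" for i by (simp add: a_def)
  have an: "a i \<le> a n" if "i \<le> n" for i
    unfolding a_def of_nat_le_iff using that by (intro mult_le_mono1) simp
  let ?D = "\<lambda>i. rows x0 K c (a i)" and ?\<Lambda> = "\<lambda>i. strip x0 K c (a i)"
  define B where "B i = (A \<union> ?D i) - ?\<Lambda> i" for i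
  have vB: "v \<notin> B i" for i using v aK[of i] K by (auto simp: B_def strip_def)
  have screen: "cexp (A \<union> ?D i) y g = cexp (B i) y g"
    if "i \<le> n" "finite T'" "T' \<inter> ?\<Lambda> i = {}" "depends_on g T'" for i y g T'
    unfolding B_def
  proof (rule cexp_markov_outside[OF finite_strip])
    show "outer_boundary (?\<Lambda> i) \<subseteq> A \<union> ?D i"
    proof
      fix j assume "j \<in> outer_boundary (?\<Lambda> i)"
      from strip_boundary[OF this] show "j \<in> A \<union> ?D i"
        using wall[of j] an[OF that(1)] by (auto simp: a_def)
    qed
  qed (use that A in auto)
  have n: "influence_le A \<eta> \<eta>' (?D n) ((1 - \<epsilon> ^ (4 * k + 2) / 4) ^ n)"
  proof (rule strip_chain[OF A K k, where B = B and v = v])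
    show "cexp (A \<union> ?D i) y g = cexp (B i) y g" if "i < n" "depends_on g (?D (Suc i))" for i y g
    proof (rule screen[of _ "?D (Suc i)"])
      show "?D (Suc i) \<inter> ?\<Lambda> i = {}" by (auto simp: strip_def rows_def aS)
    qed (use that in simp_all)
  qed (use aS aK vB agree in \<open>auto simp: B_def\<close>)
  have "influence_le A \<eta> \<eta>' T ((1 - \<epsilon> ^ (4 * k + 2) / 4) ^ n * 1)"
  proof (rule influence_screen[where S = "?D n" and B = "B n", OF _ _ _ _ _ _ _ _ n])
    show "cexp (A \<union> ?D n) y g = cexp (B n) y g" if "depends_on g T" for y g
      using that T by (intro screen[of _ T]) (auto simp: a_def)
    show "\<eta> i = \<eta>' i" if "i \<in> B n - ?D n" for i using that vB[of n] by (intro agree) (auto simp: B_def)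
    show "influence_le (B n) y y' T 1" for y y' using A T by (intro influence_one) (auto simp: B_def)
  qed (use A T in \<open>auto simp: B_def\<close>)
  then show ?thesis by simp
qed

text \<open>Here the disagreement lies beyond the ends of the strip, and it is the outside that is
  forgotten. The layers descend from height \<open>2 * n * K\<close> to \<open>n * K\<close>;
  \<open>n \<ge> 1\<close> keeps the last one at height at least \<open>K\<close>, where its two
  squares are disjoint.\<close>

lemma inward_chain:
  assumes A: "finite A" "\<And>i. i \<in> A \<Longrightarrow> i $ p \<le> x0 \<or> x0 + int K \<le> i $ p"
    and wall: "\<And>i. (i $ p = x0 - 1 \<or> i $ p = x0 + int K) \<Longrightarrow> \<bar>i $ q - c\<bar> \<le> int (2 * n * K) \<Longrightarrow> i \<in> A"
    and K: "K = 2 * h + 2" and k: "1 \<le> k" "k \<le> h" "real K * \<rho> k \<le> 1 / 2" and n: "n \<ge> 1"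
    and v: "int (2 * n * K) < \<bar>v $ q - c\<bar>"
    and agree: "\<And>i. i \<in> A \<Longrightarrow> i \<noteq> v \<Longrightarrow> \<eta> i = \<eta>' i"
    and T: "T \<subseteq> strip x0 K c (int (n * K))"
  shows "influence_le A \<eta> \<eta>' T ((1 - \<epsilon> ^ (4 * k + 2) / 4) ^ n)"
proof -
  define a where "a i = int ((2 * n - i) * K)" for i
  have aS: "a i = a (Suc i) + int K" if "i < n" for i
  proof -
    have "2 * n - i = Suc (2 * n - Suc i)" using that by simp
    then show ?thesis by (simp add: a_def)
  qed
  have aK: "int K \<le> a i" if "i \<le> n" for i
  proof -
    have "1 * K \<le> (2 * n - i) * K" using that n by (intro mult_le_mono1) simp
    then show ?thesis unfolding a_def of_nat_le_iff by (simp only: mult_1)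
  qed
  have a0: "a i \<le> int (2 * n * K)" for i unfolding a_def by (intro of_nat_mono mult_le_mono1) simp
  have fT: "finite T" using T finite_subset by (metis finite_strip)
  let ?D = "\<lambda>i. rows x0 K c (a i)" and ?\<Lambda> = "\<lambda>i. strip x0 K c (a i)"
  define B where "B i = (A \<union> ?D i) \<inter> (?\<Lambda> i \<union> outer_boundary (?\<Lambda> i))" for i
  have vB: "v \<notin> B i" for i
  proof
    assume "v \<in> B i"
    then have "v \<in> ?\<Lambda> i \<or> v \<in> outer_boundary (?\<Lambda> i)" by (auto simp: B_def)
    then have "\<bar>v $ q - c\<bar> \<le> a i" using strip_boundary[of v x0 K c "a i"] by (auto simp: strip_def rows_def)
    then show False using v a0[of i] by simp
  qed
  have screen: "cexp (A \<union> ?D i) y g = cexp (B i) y g"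
    if "depends_on g T'" "T' \<subseteq> ?\<Lambda> i" for i y g T'
    unfolding B_def
  proof (rule cexp_markov_inside[OF finite_strip])
    show "outer_boundary (?\<Lambda> i) \<subseteq> A \<union> ?D i"
    proof
      fix j assume "j \<in> outer_boundary (?\<Lambda> i)"
      from strip_boundary[OF this] show "j \<in> A \<union> ?D i"
        using wall[of j] a0[of i] by auto
    qed
    show "depends_on g (?\<Lambda> i)" by (rule depends_on_mono[OF that])
  qed (use A in auto)
  have n': "influence_le A \<eta> \<eta>' (?D n) ((1 - \<epsilon> ^ (4 * k + 2) / 4) ^ n)"
  proof (rule strip_chain[OF A K k, where B = B and v = v])
    show "cexp (A \<union> ?D i) y g = cexp (B i) y g" if "i < n" "depends_on g (?D (Suc i))" for i y g
      using that aS[of i] K by (intro screen[of _ "?D (Suc i)"]) (auto simp: strip_def rows_def)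
    show "int K \<le> \<bar>a (Suc i) - a i\<bar>" if "i < n" for i using aS[OF that] by simp
  qed (use aK vB agree in \<open>auto simp: B_def\<close>)
  have "influence_le A \<eta> \<eta>' T ((1 - \<epsilon> ^ (4 * k + 2) / 4) ^ n * 1)"
  proof (rule influence_screen[where S = "?D n" and B = "B n", OF _ _ _ _ _ _ _ _ n'])
    show "cexp (A \<union> ?D n) y g = cexp (B n) y g" if "depends_on g T" for y g
      using that T by (intro screen[of _ T]) (auto simp: a_def mult_2)
    show "\<eta> i = \<eta>' i" if "i \<in> B n - ?D n" for i using that vB[of n] by (intro agree) (auto simp: B_def)
    show "influence_le (B n) y y' T 1" for y y' using A fT by (intro influence_one) (auto simp: B_def)
  qed (use A fT in \<open>auto simp: B_def\<close>)
  then show ?thesis by simp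
qed

text \<open>The additive weakening of the product of overlaps, for use when both errors are
  small.\<close>

lemma influence_Un_le:
  assumes fin: "finite A" "finite S" "finite T"
    and S: "influence_le A \<eta> \<eta>' S \<tau>" and \<tau>: "\<tau>' \<le> 1"
    and T: "\<And>y y'. (\<And>i. i \<in> A - S \<Longrightarrow> y i = \<eta> i) \<Longrightarrow> (\<And>i. i \<in> A - S \<Longrightarrow> y' i = \<eta>' i) \<Longrightarrow> (\<And>i. i \<in> S \<Longrightarrow> y i = y' i)
        \<Longrightarrow> influence_le (A \<union> S) y y' T \<tau>'"
  shows "influence_le A \<eta> \<eta>' (S \<union> T) (\<tau> + \<tau>')"
proof -
  have "0 \<le> \<tau>" using influence_nonneg[OF S] .
  moreover have "0 \<le> \<tau>'"
    using influence_nonneg[OF T[of "\<lambda>i. if i \<in> A - S then \<eta> i else undefined"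
        "\<lambda>i. if i \<in> A - S then \<eta>' i else undefined"]] by simp
  ultimately have "1 - (1 - \<tau>) * (1 - \<tau>') \<le> \<tau> + \<tau>'" by (simp add: algebra_simps)
  then show ?thesis using influence_Un[OF fin pos_cyl[OF fin(1)] pos_cyl[OF fin(1)] S \<tau> T]
      influence_mono[OF _ subset_refl] by blast
qed

lemma contraction_le_one: "(1 - \<epsilon> ^ m / 4) ^ n \<le> 1"
proof -
  have "\<epsilon> ^ m \<le> 1" "0 < \<epsilon> ^ m" using \<epsilon> by (auto intro: power_le_one)
  then show ?thesis by (intro power_le_one) auto
qed

section \<open>Influence of central and of remote sites\<close>

lemma near_influence:
  assumes A: "finite A" "\<And>i. i \<in> A \<Longrightarrow> i $ p \<le> v $ p"
    and wall: "\<And>i. i $ p = v $ p - 1 \<Longrightarrow> \<bar>i $ q - v $ q\<bar> \<le> int ((n + 1) * K) \<Longrightarrow> i \<in> A"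
    and K: "K = 2 * h + 2" and k: "1 \<le> k" "k \<le> h" "real K * \<rho> k \<le> 1 / 2"
    and agree: "\<And>i. i \<in> A \<Longrightarrow> i \<noteq> v \<Longrightarrow> \<eta> i = \<eta>' i"
    and T: "finite T" "\<And>j. j \<in> T \<Longrightarrow> (n + 2) * K \<le> l1_dist v j"
  shows "influence_le A \<eta> \<eta>' T (real (2 * ((n + 1) * K) + 1) * \<rho> K + (1 - \<epsilon> ^ (4 * k + 2) / 4) ^ n)"
proof -
  define x0 c M where "x0 = v $ p" and "c = v $ q" and "M = (n + 1) * K"
  \<comment> \<open>\<open>J\<close> becomes the missing wall: half-plane mixing makes it agree up
    to an error proportional to its length, and then the strip is closed on both sides. Sites at
    distance at least \<open>(n + 2) * K\<close> from \<open>v\<close> lie outside this strip, by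
    adding its width and its half length.\<close>
  define J where "J = {i :: int ^ 'd. i $ p = x0 + int K \<and> \<bar>i $ q - c\<bar> \<le> int M}"
  have Js: "J \<subseteq> {i. x0 + int K \<le> i $ p \<and> i $ p \<le> x0 + int K \<and> c - int M \<le> i $ q \<and> i $ q \<le> c + int M}"
    by (auto simp: J_def)
  have fJ: "finite J" by (rule rect_bound(1)[OF Js])
  have cJ: "card J \<le> 2 * M + 1" using rect_bound(2)[OF Js] by simp
  have J: "influence_le A \<eta> \<eta>' J (real (2 * M + 1) * \<rho> K)"
  proof (rule influence_mono[OF _ subset_refl])
    show "influence_le A \<eta> \<eta>' J (real (card J) * \<rho> K)"
      using A fJ K by (intro halfplane_influence[of _ x0]) (auto simp: J_def x0_def)
    show "real (card J) * \<rho> K \<le> real (2 * M + 1) * \<rho> K"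
      using cJ rho_nonneg by (intro mult_right_mono) auto
  qed
  have "influence_le A \<eta> \<eta>' (J \<union> T) (real (2 * M + 1) * \<rho> K + (1 - \<epsilon> ^ (4 * k + 2) / 4) ^ n)"
  proof (rule influence_Un_le[OF A(1) fJ T(1) J contraction_le_one])
    fix y y' assume y: "\<And>i. i \<in> A - J \<Longrightarrow> y i = \<eta> i" "\<And>i. i \<in> A - J \<Longrightarrow> y' i = \<eta>' i" "\<And>i. i \<in> J \<Longrightarrow> y i = y' i"
    show "influence_le (A \<union> J) y y' T ((1 - \<epsilon> ^ (4 * k + 2) / 4) ^ n)"
    proof (rule outward_chain[of _ x0 K c n h k v])
      show "finite (A \<union> J)" using A fJ by simp
      show "i $ p \<le> x0 \<or> x0 + int K \<le> i $ p" if "i \<in> A \<union> J" for i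
        using that A(2) by (auto simp: J_def x0_def)
      show "i \<in> A \<union> J" if "i $ p = x0 - 1 \<or> i $ p = x0 + int K" "\<bar>i $ q - c\<bar> \<le> int ((n + 1) * K)" for i
        using that wall[of i] unfolding J_def x0_def c_def M_def by blast
      show "y i = y' i" if "i \<in> A \<union> J" "i \<noteq> v" for i
        using that y agree by (cases "i \<in> J") auto
      show "T \<inter> strip x0 K c (int ((n + 1) * K)) = {}"
      proof (rule ccontr)
        assume "T \<inter> strip x0 K c (int ((n + 1) * K)) \<noteq> {}"
        then obtain j where j: "j \<in> T" "j \<in> strip x0 K c (int ((n + 1) * K))" by blast
        have "int (l1_dist v j) < int K + int ((n + 1) * K)"
          using j(2) unfolding l1_dist_plane strip_def x0_def c_def by auto
        also have "\<dots> = int ((n + 2) * K)" by (simp add: algebra_simps)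
        finally have "l1_dist v j < (n + 2) * K" by (simp only: of_nat_less_iff)
        then show False using T(2)[OF j(1)] by linarith
      qed
    qed (use K k T in \<open>auto simp: x0_def c_def\<close>)
  qed
  then show ?thesis unfolding M_def by (rule influence_mono) auto
qed

text \<open>The target is cut by columns. Sites before the column of \<open>v\<close> are already
  revealed and agree; those at least \<open>K\<close> columns further are reached by half-plane
  mixing together with the wall \<open>J\<close>; those between lie in the strip, which the
  disagreement can only enter through its distant ends.\<close>

lemma far_influence:
  assumes A: "finite A" "\<And>i. i \<in> A \<Longrightarrow> i $ p \<le> v $ p"
    and wall: "\<And>i. i $ p = v $ p - 1 \<Longrightarrow> \<bar>i $ q\<bar> \<le> int (2 * n * K) \<Longrightarrow> i \<in> A"
    and K: "K = 2 * h + 2" and k: "1 \<le> k" "k \<le> h" "real K * \<rho> k \<le> 1 / 2" and n: "n \<ge> 1"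
    and v: "int (2 * n * K) < \<bar>v $ q\<bar>"
    and agree: "\<And>i. i \<in> A \<Longrightarrow> i \<noteq> v \<Longrightarrow> \<eta> i = \<eta>' i"
    and T: "finite T" "\<And>j. j \<in> T \<Longrightarrow> j \<noteq> v" "\<And>j. j \<in> T \<Longrightarrow> j $ p < v $ p \<Longrightarrow> j \<in> A" "\<And>j. j \<in> T \<Longrightarrow>
        \<bar>j $ q\<bar> < int (n * K)"
  shows "influence_le A \<eta> \<eta>' T (real (2 * (2 * n * K) + 1 + card T) * \<rho> K + (1 - \<epsilon> ^ (4 * k + 2) / 4) ^ n)"
proof -
  define x0 M where "x0 = v $ p" and "M = 2 * n * K"
  define J where "J = {i :: int ^ 'd. i $ p = x0 + int K \<and> \<bar>i $ q\<bar> \<le> int M}"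
  define S where "S = J \<union> {j\<in>T. x0 + int K \<le> j $ p}"
  define T' where "T' = {j\<in>T. x0 \<le> j $ p \<and> j $ p < x0 + int K}"
  have Js: "J \<subseteq> {i. x0 + int K \<le> i $ p \<and> i $ p \<le> x0 + int K \<and> - int M \<le> i $ q \<and> i $ q \<le> int M}"
    by (auto simp: J_def)
  have fJ: "finite J" by (rule rect_bound(1)[OF Js])
  have cJ: "card J \<le> 2 * M + 1" using rect_bound(2)[OF Js] by simp
  have fS: "finite S" using fJ T(1) by (simp add: S_def)
  have "card {j\<in>T. x0 + int K \<le> j $ p} \<le> card T" by (rule card_mono[OF T(1)]) auto
  then have cS: "card S \<le> 2 * M + 1 + card T"
    unfolding S_def using card_Un_le[of J "{j\<in>T. x0 + int K \<le> j $ p}"] cJ by linarith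
  have S: "influence_le A \<eta> \<eta>' S (real (2 * M + 1 + card T) * \<rho> K)"
  proof (rule influence_mono[OF _ subset_refl])
    show "influence_le A \<eta> \<eta>' S (real (card S) * \<rho> K)"
      using A fS K by (intro halfplane_influence[of _ x0]) (auto simp: S_def J_def x0_def)
    show "real (card S) * \<rho> K \<le> real (2 * M + 1 + card T) * \<rho> K"
      using cS rho_nonneg by (intro mult_right_mono) auto
  qed
  have "influence_le A \<eta> \<eta>' (S \<union> T') (real (2 * M + 1 + card T) * \<rho> K + (1 - \<epsilon> ^ (4 * k + 2) / 4) ^ n)"
  proof (rule influence_Un_le[OF A(1) fS _ S contraction_le_one])
    show "finite T'" using T(1) by (simp add: T'_def)
    fix y y' assume y: "\<And>i. i \<in> A - S \<Longrightarrow> y i = \<eta> i" "\<And>i. i \<in> A - S \<Longrightarrow> y' i = \<eta>' i" "\<And>i. i \<in> S \<Longrightarrow> y i = y' i"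
    show "influence_le (A \<union> S) y y' T' ((1 - \<epsilon> ^ (4 * k + 2) / 4) ^ n)"
    proof (rule inward_chain[of _ x0 K 0 n h k v])
      show "finite (A \<union> S)" using A fS by simp
      show "i $ p \<le> x0 \<or> x0 + int K \<le> i $ p" if "i \<in> A \<union> S" for i
        using that A(2) by (auto simp: S_def J_def x0_def)
      show "i \<in> A \<union> S" if "i $ p = x0 - 1 \<or> i $ p = x0 + int K" "\<bar>i $ q - 0\<bar> \<le> int (2 * n * K)" for i
        using that wall[of i] unfolding S_def J_def x0_def M_def by auto
      show "y i = y' i" if "i \<in> A \<union> S" "i \<noteq> v" for i
        using that y agree by (cases "i \<in> S") auto
      show "T' \<subseteq> strip x0 K 0 (int (n * K))" using T(4) by (auto simp: T'_def strip_def)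
    qed (use K k n v in auto)
  qed
  then have "influence_le A \<eta> \<eta>' ((S \<union> T') \<union> {j\<in>T. j $ p < x0}) (real (2 * M + 1 + card T) * \<rho> K + (1 - \<epsilon>
      ^ (4 * k + 2) / 4) ^ n)"
    by (rule influence_add_agree) (use T agree in \<open>auto simp: x0_def\<close>)
  then show ?thesis unfolding M_def by (rule influence_mono) (auto simp: S_def T'_def)
qed

end

text \<open>With strip width of order \<open>(ln r)\<^sup>2\<close> and wall distance \<open>k\<close> of order \<open>sqrt (ln r)\<close>, the contraction
  per step is \<open>1 - r powr (-o(1))\<close>, while about \<open>r / (ln r) ^ 3\<close> steps fit into distance \<open>r\<close>.\<close>

lemma scale_parameters:
  fixes \<rho> :: "nat \<Rightarrow> real"
  assumes c: "c > 0" and C: "C > 0" and \<rho>: "\<And>n. n \<ge> 1 \<Longrightarrow> \<rho> n \<le> C * exp (- c * real n)" and \<epsilon>: "0 < \<epsilon>" "\<epsilon> \<le> 1"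
  shows "\<forall>\<^sub>F r in sequentially. \<exists>h k n. 1 \<le> k \<and> k \<le> h \<and> real (2 * h + 2) * \<rho> k \<le> 1 / 2 \<and>
      \<rho> (2 * h + 2) \<le> 1 / real r ^ 6 \<and>
     (1 - \<epsilon> ^ (4 * k + 2) / 4) ^ n \<le> 1 / real r ^ 6 \<and> 3 * ((n + 2) * (2 * h + 2)) \<le> r \<and> 1 \<le> n \<and> r \<le> n * n"
proof -
  \<comment> \<open>Then \<open>exp (- b) \<le> \<epsilon>\<close>, and the 1 keeps \<open>b\<close>
    positive even when \<open>\<epsilon> = 1\<close>.\<close>
  define b where "b = 1 - ln \<epsilon>"
  have b: "b > 0" using ln_le_zero_iff[OF \<epsilon>(1)] \<epsilon>(2) by (simp add: b_def)
  \<comment> \<open>The requirements at real scales, where each \<open>- 1\<close> pays for an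
    integer part taken below. The square of the logarithm in the width makes
    \<open>\<rho> (2 * h + 2)\<close> smaller than every power of \<open>1 / r\<close>.\<close>
  have "\<forall>\<^sub>F x :: real in at_top. x \<ge> 3" "\<forall>\<^sub>F x :: real in at_top. 1 \<le> sqrt (ln x)"
    "\<forall>\<^sub>F x :: real in at_top. sqrt (ln x) \<le> (ln x)\<^sup>2"
    "\<forall>\<^sub>F x :: real in at_top. (2 * (ln x)\<^sup>2 + 2) * (C * exp (- c * (sqrt (ln x) - 1))) \<le> 1 / 2"
    "\<forall>\<^sub>F x :: real in at_top. C * exp (- c * (2 * (ln x)\<^sup>2)) \<le> 1 / x ^ 6"
    "\<forall>\<^sub>F x :: real in at_top. exp (- (exp (- b * (4 * sqrt (ln x) + 2)) / 4 * (x / (ln x) ^ 3 - 1))) \<le> 1 /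
        x ^ 6"
    "\<forall>\<^sub>F x :: real in at_top. 3 * ((x / (ln x) ^ 3 + 2) * (2 * (ln x)\<^sup>2 + 2)) \<le> x"
    "\<forall>\<^sub>F x :: real in at_top. 1 \<le> x / (ln x) ^ 3 - 1"
    "\<forall>\<^sub>F x :: real in at_top. x \<le> (x / (ln x) ^ 3 - 1)\<^sup>2"
    using c C b by real_asymp+
  then have "\<forall>\<^sub>F x :: real in at_top. x \<ge> 3 \<and> 1 \<le> sqrt (ln x) \<and> sqrt (ln x) \<le> (ln x)\<^sup>2 \<and>
    (2 * (ln x)\<^sup>2 + 2) * (C * exp (- c * (sqrt (ln x) - 1))) \<le> 1 / 2 \<and>
    C * exp (- c * (2 * (ln x)\<^sup>2)) \<le> 1 / x ^ 6 \<and>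
    exp (- (exp (- b * (4 * sqrt (ln x) + 2)) / 4 * (x / (ln x) ^ 3 - 1))) \<le> 1 / x ^ 6 \<and>
    3 * ((x / (ln x) ^ 3 + 2) * (2 * (ln x)\<^sup>2 + 2)) \<le> x \<and> 1 \<le> x / (ln x) ^ 3 - 1 \<and>
        x \<le> (x / (ln x) ^ 3 - 1)\<^sup>2"
    by (simp only: eventually_conj_iff conj_assoc)
  then have "\<forall>\<^sub>F r in sequentially. real r \<ge> 3 \<and> 1 \<le> sqrt (ln (real r)) \<and>
      sqrt (ln (real r)) \<le> (ln (real r))\<^sup>2 \<and>
    (2 * (ln (real r))\<^sup>2 + 2) * (C * exp (- c * (sqrt (ln (real r)) - 1))) \<le> 1 / 2 \<and>
    C * exp (- c * (2 * (ln (real r))\<^sup>2)) \<le> 1 / (real r) ^ 6 \<and>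
    exp (- (exp (- b * (4 * sqrt (ln (real r)) + 2)) / 4 * (real r / (ln (real r)) ^ 3 - 1))) \<le> 1 / real r
        ^ 6 \<and>
    3 * ((real r / (ln (real r)) ^ 3 + 2) * (2 * (ln (real r))\<^sup>2 + 2)) \<le> real r \<and>
        1 \<le> real r / (ln (real r)) ^ 3 - 1 \<and>
    real r \<le> (real r / (ln (real r)) ^ 3 - 1)\<^sup>2"
    by (rule eventually_compose_filterlim[OF _ filterlim_real_sequentially])
  then show ?thesis
  proof eventually_elim
    case (elim r)
    define x where "x = real r"
    have e: "x \<ge> 3" "1 \<le> sqrt (ln x)" "sqrt (ln x) \<le> (ln x)\<^sup>2"
      "(2 * (ln x)\<^sup>2 + 2) * (C * exp (- c * (sqrt (ln x) - 1))) \<le> 1 / 2"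
      "C * exp (- c * (2 * (ln x)\<^sup>2)) \<le> 1 / x ^ 6"
      "exp (- (exp (- b * (4 * sqrt (ln x) + 2)) / 4 * (x / (ln x) ^ 3 - 1))) \<le> 1 / x ^ 6"
      "3 * ((x / (ln x) ^ 3 + 2) * (2 * (ln x)\<^sup>2 + 2)) \<le> x" "1 \<le> x / (ln x) ^ 3 - 1"
      "x \<le> (x / (ln x) ^ 3 - 1)\<^sup>2"
      using elim unfolding x_def by blast+
    define h k n where "h = nat \<lfloor>(ln x)\<^sup>2\<rfloor>" and "k = nat \<lfloor>sqrt (ln x)\<rfloor>" and "n = nat \<lfloor>x / (ln x) ^ 3\<rfloor>"
    have h: "real h \<le> (ln x)\<^sup>2" "(ln x)\<^sup>2 - 1 \<le> real h" unfolding h_def by (simp add: of_nat_nat, linarith)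
    have kk: "real k \<le> sqrt (ln x)" "sqrt (ln x) - 1 \<le> real k" unfolding k_def using e(2) by linarith+
    have n: "real n \<le> x / (ln x) ^ 3" "x / (ln x) ^ 3 - 1 \<le> real n" unfolding n_def using e(8) by linarith+
    have k1: "1 \<le> k" unfolding k_def using e(2) by (simp add: le_nat_iff le_floor_iff)
    have kh: "k \<le> h" unfolding k_def h_def using e(3) by (intro nat_mono floor_mono)
    have "real (2 * h + 2) * \<rho> k \<le> (2 * (ln x)\<^sup>2 + 2) * (C * exp (- c * (sqrt (ln x) - 1)))"
    proof -
      have "\<rho> k \<le> C * exp (- c * real k)" by (rule \<rho>[OF k1])
      also have "\<dots> \<le> C * exp (- c * (sqrt (ln x) - 1))" using kk(2) c C by simp
      finally have "real (2 * h + 2) * \<rho> k \<le> real (2 * h + 2) * (C * exp (- c * (sqrt (ln x) - 1)))"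
        by (intro mult_left_mono) auto
      also have "\<dots> \<le> (2 * (ln x)\<^sup>2 + 2) * (C * exp (- c * (sqrt (ln x) - 1)))"
        using h(1) C by (intro mult_right_mono) auto
      finally show ?thesis .
    qed
    then have 1: "real (2 * h + 2) * \<rho> k \<le> 1 / 2" using e(4) by linarith
    have "\<rho> (2 * h + 2) \<le> C * exp (- c * real (2 * h + 2))" by (rule \<rho>) simp
    also have "\<dots> \<le> C * exp (- c * (2 * (ln x)\<^sup>2))" using h(2) c C by simp
    finally have 2: "\<rho> (2 * h + 2) \<le> 1 / x ^ 6" using e(5) by linarith
    define \<delta> where "\<delta> = \<epsilon> ^ (4 * k + 2) / 4"
    have \<delta>: "\<delta> \<ge> exp (- b * (4 * sqrt (ln x) + 2)) / 4"
    proof -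
      have "- b * (4 * sqrt (ln x) + 2) \<le> - b * real (4 * k + 2)"
        using b kk(1) by simp
      also have "\<dots> \<le> ln \<epsilon> * real (4 * k + 2)"
        unfolding b_def by (intro mult_right_mono) auto
      finally have "exp (- b * (4 * sqrt (ln x) + 2)) \<le> exp (real (4 * k + 2) * ln \<epsilon>)"
          by (simp add: mult.commute)
      also have "\<dots> = \<epsilon> ^ (4 * k + 2)" unfolding exp_of_nat_mult using \<epsilon>(1) by simp
      finally show ?thesis by (simp add: \<delta>_def)
    qed
    have \<delta>1: "\<delta> \<le> 1" unfolding \<delta>_def using power_le_one[of \<epsilon> "4 * k + 2"] \<epsilon> by simp
    have "(1 - \<delta>) ^ n \<le> exp (- \<delta>) ^ n"
      using \<delta>1 exp_ge_add_one_self[of "- \<delta>"] by (intro power_mono) auto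
    also have "\<dots> = exp (- (\<delta> * real n))" by (simp add: exp_of_nat_mult[symmetric] mult.commute)
    also have "\<dots> \<le> exp (- (exp (- b * (4 * sqrt (ln x) + 2)) / 4 * (x / (ln x) ^ 3 - 1)))"
    proof -
      have "exp (- b * (4 * sqrt (ln x) + 2)) / 4 * (x / (ln x) ^ 3 - 1) \<le> \<delta> * real n"
        using \<delta> n(2) e(8) by (intro mult_mono) (auto intro: order_trans[OF _ \<delta>])
      then show ?thesis by simp
    qed
    finally have 3: "(1 - \<delta>) ^ n \<le> 1 / x ^ 6" using e(6) by linarith
    have "real (3 * ((n + 2) * (2 * h + 2))) = 3 * ((real n + 2) * (2 * real h + 2))"
      by (simp add: algebra_simps)
    also have "\<dots> \<le> 3 * ((x / (ln x) ^ 3 + 2) * (2 * (ln x)\<^sup>2 + 2))"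
      using n(1) h(1) e(8) by (intro mult_left_mono mult_mono) auto
    also have "\<dots> \<le> real r" using e(7) by (simp add: x_def)
    finally have 4: "3 * ((n + 2) * (2 * h + 2)) \<le> r" by (simp only: of_nat_le_iff)
    have 5: "1 \<le> n" using n(2) e(8) by linarith
    have "real r \<le> (x / (ln x) ^ 3 - 1)\<^sup>2" using e(9) by (simp add: x_def)
    also have "\<dots> \<le> (real n)\<^sup>2" using n(2) e(8) by (intro power_mono) auto
    also have "\<dots> = real (n * n)" by (simp add: power2_eq_square)
    finally have 6: "r \<le> n * n" by (simp only: of_nat_le_iff)
    show ?case
      using k1 kh 1 2 3 4 5 6 unfolding x_def \<delta>_def by blast
  qed
qed

section \<open>Assembly of the planar case\<close>

context plane_field
begin

theorem gaussian_concentration_of_plane_wsm: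
  assumes "exponential_rate \<rho>"
  shows "gaussian_concentration \<nu>"
proof -
  obtain c C where c: "c > 0" "C > 0" "\<And>n. n \<ge> 1 \<Longrightarrow> \<rho> n \<le> C * exp (- c * real n)"
    using assms unfolding exponential_rate_def by blast
  obtain r0' where r0': "\<And>r. r \<ge> r0' \<Longrightarrow> \<exists>h k n. 1 \<le> k \<and> k \<le> h \<and> real (2 * h + 2) * \<rho> k \<le> 1 / 2 \<and>
      \<rho> (2 * h + 2) \<le> 1 / real r ^ 6 \<and>
     (1 - \<epsilon> ^ (4 * k + 2) / 4) ^ n \<le> 1 / real r ^ 6 \<and> 3 * ((n + 2) * (2 * h + 2)) \<le> r \<and> 1 \<le> n \<and> r \<le> n * n"
    using scale_parameters[OF c \<epsilon>(1,2)] unfolding eventually_sequentially by blast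
  define r0 where "r0 = max 1 r0'"
  obtain h k n where par: "\<And>r. r \<ge> r0 \<Longrightarrow> 1 \<le> k r \<and> k r \<le> h r \<and> real (2 * h r + 2) * \<rho> (k r) \<le> 1 / 2 \<and>
      \<rho> (2 * h r + 2) \<le> 1 / real r ^ 6 \<and>
     (1 - \<epsilon> ^ (4 * k r + 2) / 4) ^ n r \<le> 1 / real r ^ 6 \<and> 3 * ((n r + 2) * (2 * h r + 2)) \<le> r \<and> 1 \<le> n r \<and>
         r \<le> n r * n r"
    using r0' unfolding r0_def by (metis max.boundedE)
  \<comment> \<open>The entry \<open>64 = 4 * 2 ^ 4\<close> turns \<open>4 / s ^ 5\<close> into
    decay in \<open>1 + s\<close>; the other one covers radii below \<open>r0\<close>, where the
    influence is bounded by 1.\<close>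
  define C0 where "C0 = max 64 ((1 + real r0) ^ 4)"
  have card2: "CARD('d) + 2 = 4" by (subst pq(2)) (simp add: pq(1))
  show ?thesis
  proof (rule gaussian_concentration_of_influences[of C0])
    show "C0 \<ge> 0" by (simp add: C0_def)
    fix \<Delta> :: "(int ^ 'd) set" assume \<Delta>: "finite \<Delta>"
    define R where "R = Max (insert 0 ((\<lambda>i. max \<bar>i $ p\<bar> \<bar>i $ q\<bar>) ` \<Delta>))"
    have R: "\<bar>i $ p\<bar> \<le> R" "\<bar>i $ q\<bar> \<le> R" if "i \<in> \<Delta>" for i
    proof -
      have "max \<bar>i $ p\<bar> \<bar>i $ q\<bar> \<le> R" unfolding R_def using that \<Delta> by (intro Max_ge) auto
      then show "\<bar>i $ p\<bar> \<le> R" "\<bar>i $ q\<bar> \<le> R" by auto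
    qed
    have R0: "R \<ge> 0" unfolding R_def using \<Delta> by (intro Max_ge) auto
    \<comment> \<open>For remote sites, half-plane mixing acts on at most
      \<open>(card \<Delta> + 3) * r\<close> sites, and the chain adds one more unit. The value is
      also at least 4, as the estimate for central sites at the truncated scale requires.\<close>
    define E where "E = card \<Delta> + 4"
    \<comment> \<open>The summand \<open>81 * E\<close> ensures \<open>e * card Q \<le> 1\<close>,
      as \<open>Q\<close> has at most \<open>(9 * r)\<^sup>2\<close> sites. The summand
      \<open>R * R\<close> confines \<open>\<Delta>\<close> to the innermost part of the
      strips.\<close>
    define r where "r = r0 + 81 * E + nat (R * R) + nat R + 1"
    have r: "r0 \<le> r" "81 * E \<le> r" "R * R < int r" "R < int r" "1 \<le> r"
      using R0 zero_le_square[of R] by (auto simp: r_def add_pos_nonneg)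
    \<comment> \<open>Sites within \<open>2 * r\<close> of the origin need straight walls of length
      up to \<open>r\<close> on either side; the factor 4 leaves room for them.\<close>
    define N where "N = 4 * int r"
    define e where "e = real E / real r ^ 5"
    define Q where "Q = {i :: int ^ 'd. \<bar>i $ p\<bar> \<le> N \<and> \<bar>i $ q\<bar> \<le> N}"
    have Qs: "Q \<subseteq> {i. - N \<le> i $ p \<and> i $ p \<le> N \<and> - N \<le> i $ q \<and> i $ q \<le> N}" by (auto simp: Q_def)
    have fQ: "finite Q" by (rule rect_bound(1)[OF Qs])
    have cQ: "card Q \<le> (8 * r + 1) * (8 * r + 1)" using
        rect_bound(2)[OF Qs] by (simp add: N_def nat_add_distrib nat_mult_distrib)
    have \<Delta>Q: "\<Delta> \<subseteq> Q" using R r by (fastforce simp: Q_def N_def)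
    \<comment> \<open>Lexicographic order, columns first. A column of \<open>Q\<close> has
      \<open>2 * N + 1\<close> sites, so the second coordinate never overturns the order of
      columns.\<close>
    define \<kappa> where "\<kappa> i = i $ p * (2 * N + 1) + i $ q" for i :: "int ^ 'd"
    have \<kappa>: "\<kappa> i < \<kappa> j" if "i \<in> Q" "j \<in> Q" "i $ p < j $ p" for i j
    proof -
      have "(i $ p + 1) * (2 * N + 1) \<le> j $ p * (2 * N + 1)"
        using that(3) by (intro mult_right_mono) (auto simp: N_def)
      then have "i $ p * (2 * N + 1) + (2 * N + 1) \<le> j $ p * (2 * N + 1)" by (simp add: algebra_simps)
      then show ?thesis using that(1,2) unfolding \<kappa>_def Q_def by auto
    qed
    have inj: "inj_on \<kappa> Q"
    proof
      fix i j assume ij: "i \<in> Q" "j \<in> Q" "\<kappa> i = \<kappa> j"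
      then have "i $ p = j $ p" using \<kappa>[of i j] \<kappa>[of j i] by linarith
      moreover from this have "i $ q = j $ q" using ij(3) by (simp add: \<kappa>_def)
      ultimately have "site (i $ p) (i $ q) = site (j $ p) (j $ q)" by (rule arg_cong2)
      then show "i = j" by (simp only: site_eta)
    qed
    have e0: "e \<ge> 0" by (simp add: e_def)
    have eQ: "e * real (card Q) \<le> 1"
    proof -
      have "real (card Q) \<le> (8 * real r + 1) * (8 * real r + 1)"
        using of_nat_mono[OF cQ, where 'a = real] by (simp add: algebra_simps)
      also have "\<dots> \<le> (9 * real r) * (9 * real r)" using r(5) by (intro mult_mono) auto
      finally have "e * real (card Q) \<le> e * (81 * real r ^ 2)"
        using e0 by (intro mult_left_mono) (simp_all add: power2_eq_square)
      also have "\<dots> = 81 * real E / real r ^ 3"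
        using r(5) by (simp add: e_def frac_eq_eq mult.assoc flip: power_add)
      also have "\<dots> \<le> 81 * real E / real r"
        using r(5) by (intro divide_left_mono) (auto simp: self_le_power)
      also have "\<dots> \<le> 1" using r(2,5) of_nat_mono[OF r(2), where 'a = real] by (simp add: divide_le_eq_1)
      finally show ?thesis .
    qed
    show "\<exists>Q (\<kappa> :: int ^ 'd \<Rightarrow> int) e. finite Q \<and> \<Delta> \<subseteq> Q \<and> inj_on \<kappa> Q \<and> e \<ge> 0 \<and> e * real (card Q) \<le> 1 \<and>
      (\<forall>v\<in>Q. \<forall>r \<eta> \<eta>'. (\<forall>i\<in>{i\<in>Q. \<kappa> i < \<kappa> v}. \<eta> i = \<eta>' i) \<longrightarrow> pos {i\<in>Q. \<kappa> i \<le> \<kappa> v} \<eta> \<longrightarrow> pos {i\<in>Q. \<kappa> i \<le> \<kappa> v} \<eta>' \<longrightarrow>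
         influence_le {i\<in>Q. \<kappa> i \<le> \<kappa> v} \<eta> \<eta>' {j\<in>\<Delta>. r \<le> l1_dist v j} (C0 / (1 + real r) ^ (CARD('d) + 2) +
             e))"
    proof (rule exI[of _ Q], rule exI[of _ \<kappa>], rule exI[of _ e],
        intro conjI ballI allI impI fQ \<Delta>Q inj e0 eQ)
      fix v r1 and \<eta> \<eta>' :: "int ^ 'd \<Rightarrow> 'b"
      let ?A = "{i\<in>Q. \<kappa> i \<le> \<kappa> v}" and ?T = "{j\<in>\<Delta>. r1 \<le> l1_dist v j}"
      assume a: "v \<in> Q" "\<forall>i\<in>{i\<in>Q. \<kappa> i < \<kappa> v}. \<eta> i = \<eta>' i"
      have fA: "finite ?A" and fT: "finite ?T" using fQ \<Delta> by auto
      have agree: "\<eta> i = \<eta>' i" if "i \<in> ?A" "i \<noteq> v" for i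
        using that a inj by (auto simp: inj_on_def order_le_less)
      have Ap: "i $ p \<le> v $ p" if "i \<in> ?A" for i
        using \<kappa>[of v i] that a(1) by force
      have inA: "i \<in> ?A" if "i \<in> Q" "i $ p < v $ p" for i
        using \<kappa>[OF that(1) a(1) that(2)] that(1) by simp
      have c0: "0 \<le> C0 / (1 + real r1) ^ 4" by (simp add: C0_def)
      have "influence_le ?A \<eta> \<eta>' ?T (C0 / (1 + real r1) ^ 4 + e)"
      \<comment> \<open>Central sites get the decay in \<open>r1\<close>; for all others
        \<open>e\<close> alone suffices, since they are far from \<open>\<Delta>\<close>.\<close>
      proof (cases "\<bar>v $ p\<bar> \<le> 2 * int r \<and> \<bar>v $ q\<bar> \<le> 2 * int r")
        case near: True
        show ?thesis
        proof (cases "r1 < r0")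
          case True
          have "(1 + real r1) ^ 4 \<le> (1 + real r0) ^ 4" using True by (intro power_mono) auto
          also have "\<dots> \<le> C0" unfolding C0_def by (rule max.cobounded2)
          finally have "(1 + real r1) ^ 4 \<le> C0" .
          then have "1 \<le> C0 / (1 + real r1) ^ 4" by (simp add: le_divide_eq)
          then have "1 \<le> C0 / (1 + real r1) ^ 4 + e" using e0 by linarith
          then show ?thesis by (rule influence_mono[OF influence_one[OF fA fT] subset_refl])
        next
          case False
          \<comment> \<open>Strips at a scale above \<open>r\<close> could leave \<open>Q\<close>.
            The scale is therefore truncated at \<open>r\<close>, and for larger \<open>r1\<close>
            the error goes into \<open>e\<close>.\<close>
          define s where "s = min r1 r"
          have s: "r0 \<le> s" "s \<le> r1" "s \<le> r" "1 \<le> s" using False r by (auto simp: s_def r0_def)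
          let ?K = "2 * h s + 2"
          have P: "1 \<le> k s" "k s \<le> h s" "real ?K * \<rho> (k s) \<le> 1 / 2" "\<rho> ?K \<le> 1 / real s ^ 6"
            "(1 - \<epsilon> ^ (4 * k s + 2) / 4) ^ n s \<le> 1 / real s ^ 6" "3 * ((n s + 2) * ?K) \<le> s"
            using par[OF s(1)] by blast+
          have M: "(n s + 1) * ?K \<le> s" using P(6) by simp
          have "influence_le ?A \<eta> \<eta>' ?T (real (2 * ((n s + 1) * ?K) + 1) * \<rho> ?K + (1 - \<epsilon> ^ (4 * k s + 2) /
              4) ^ n s)"
          proof (rule near_influence[OF fA Ap _ refl P(1-3) agree fT])
            show "i \<in> ?A" if "i $ p = v $ p - 1" "\<bar>i $ q - v $ q\<bar> \<le> int ((n s + 1) * ?K)" for i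
            proof (rule inA)
              have "\<bar>i $ q - v $ q\<bar> \<le> int s" using that(2) of_nat_mono[OF M, where 'a = int] by linarith
              then show "i \<in> Q" using near that(1) s(3) r(5) by (auto simp: Q_def N_def)
            qed (use that in simp)
            show "(n s + 2) * ?K \<le> l1_dist v j" if "j \<in> ?T" for j
              using P(6) s(2) that by simp
          qed
          moreover have "real (2 * ((n s + 1) * ?K) + 1) * \<rho> ?K + (1 - \<epsilon> ^ (4 * k s + 2) / 4) ^ n s \<le> 4 /
              real s ^ 5"
          proof -
            have "real (2 * ((n s + 1) * ?K) + 1) * \<rho> ?K \<le> real (3 * s) * (1 / real s ^ 6)"
              using M s(4) by (intro mult_mono P(4) rho_nonneg of_nat_mono) auto
            moreover have "1 / real s ^ 6 \<le> 1 / real s ^ 5"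
              using s(4) by (intro divide_left_mono power_increasing) auto
            moreover have "real (3 * s) * (1 / real s ^ 6) = 3 / real s ^ 5"
              using s(4) power_Suc[of "real s" 5] by simp
            ultimately show ?thesis using P(5) by (simp add: add_divide_distrib[symmetric])
          qed
          moreover have "4 / real s ^ 5 \<le> C0 / (1 + real r1) ^ 4 + e"
          proof (cases "r1 \<le> r")
            case True
            then have sr: "s = r1" by (simp add: s_def)
            have "4 * (1 + real s) ^ 4 \<le> 4 * (2 * real s) ^ 4"
              using s(4) by (intro mult_left_mono power_mono) auto
            also have "\<dots> = 64 * real s ^ 4" by (simp add: power_mult_distrib)
            also have "\<dots> \<le> C0 * real s ^ 5"
              using s(4) by (intro mult_mono power_increasing) (auto simp: C0_def)
            finally have "4 / real s ^ 5 \<le> C0 / (1 + real s) ^ 4"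
              using s(4) by (simp add: divide_le_eq le_divide_eq mult_ac)
            then show ?thesis using e0 sr by simp
          next
            case False
            then have "s = r" by (simp add: s_def)
            then have "4 / real s ^ 5 \<le> e" unfolding e_def by (simp add: E_def divide_right_mono)
            then show ?thesis using c0 by simp
          qed
          ultimately show ?thesis by (meson influence_mono order_trans subset_refl)
        qed
      next
        case far: False
        let ?K = "2 * h r + 2"
        have P: "1 \<le> k r" "k r \<le> h r" "real ?K * \<rho> (k r) \<le> 1 / 2" "\<rho> ?K \<le> 1 / real r ^ 6"
          "(1 - \<epsilon> ^ (4 * k r + 2) / 4) ^ n r \<le> 1 / real r ^ 6" "3 * ((n r + 2) * ?K) \<le> r" "1 \<le> n r"
              "r \<le> n r * n r"
          using par[OF r(1)] by blast+
        have K0: "0 \<le> (1 - \<epsilon> ^ (4 * k r + 2) / 4) ^ n r"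
          using power_le_one[of \<epsilon> "4 * k r + 2"] \<epsilon> by (intro zero_le_power) auto
        have K3: "3 * ?K \<le> r"
        proof -
          have "1 * ?K \<le> (n r + 2) * ?K" by (intro mult_le_mono1) simp
          then show ?thesis using P(6) by linarith
        qed
        have M: "2 * n r * ?K \<le> r"
        proof -
          have "3 * (n r * ?K) \<le> 3 * ((n r + 2) * ?K)" by (intro mult_le_mono) auto
          then show ?thesis using P(6) by linarith
        qed
        \<comment> \<open>From \<open>R * R < r\<close> and \<open>r \<le> n * n\<close> one gets
          \<open>R < n\<close>, so \<open>\<Delta>\<close> lies within the last layers of the inward
          chain.\<close>
        have RnK: "R < int (n r * ?K)"
        proof -
          have "R * R < int (n r * n r)" using r(3) of_nat_mono[OF P(8), where 'a = int] by linarith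
          then have "R < int (n r)" using R0 by (simp add: power2_eq_square[symmetric]
              power_less_imp_less_base)
          also have "\<dots> \<le> int (n r * ?K)" by (subst of_nat_le_iff) simp
          finally show ?thesis .
        qed
        have main: "influence_le ?A \<eta> \<eta>' ?T (real (2 * (2 * n r * ?K) + 1 + card ?T) * \<rho> ?K + (1 - \<epsilon> ^ (4
            * k r + 2) / 4) ^ n r)" (is "influence_le _ _ _ _ ?\<tau>")
        proof -
          \<comment> \<open>Either \<open>\<Delta>\<close> is wholly revealed, or it lies wholly at
            distance \<open>K\<close> beyond the line, or \<open>v\<close> is in a column near those
            of \<open>\<Delta>\<close>; in the last case \<open>v\<close>, not being central, is
            remote along its column.\<close>
          consider "R < v $ p" | "v $ p + int ?K \<le> - R" | "- R - int ?K < v $ p" "v $ p \<le> R" by linarith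
          then show ?thesis
          proof cases
            case 1
            have "?T \<subseteq> ?A" "\<And>j. j \<in> ?T \<Longrightarrow> j \<noteq> v"
              using inA R 1 \<Delta>Q by (fastforce, fastforce)
            then have "influence_le ?A \<eta> \<eta>' ?T 0" using agree by (intro influence_agree fA) auto
            then show ?thesis using K0 rho_nonneg by (elim influence_mono) (auto intro!: add_nonneg_nonneg
                mult_nonneg_nonneg)
          next
            case 2
            have "influence_le ?A \<eta> \<eta>' ?T (real (card ?T) * \<rho> ?K)"
            proof (rule halfplane_influence[OF fA Ap _ fT])
              show "v $ p + int ?K \<le> j $ p" if "j \<in> ?T" for j using R(1)[of j] that 2 by auto
            qed simp_all
            moreover have "real (card ?T) * \<rho> ?K \<le> ?\<tau>"
            proof -
              have "real (card ?T) * \<rho> ?K \<le> real (2 * (2 * n r * ?K) + 1 + card ?T) * \<rho> ?K"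
                by (intro mult_right_mono rho_nonneg of_nat_mono) simp
              then show ?thesis using K0 by linarith
            qed
            ultimately show ?thesis by (rule influence_mono[OF _ subset_refl])
          next
            case 3
            have vp: "\<bar>v $ p\<bar> \<le> R + int ?K" using 3 R0 by simp
            have K3': "3 * int ?K \<le> int r" using of_nat_mono[OF K3, where 'a = int] by simp
            have "x + y \<le> 2 * z" if "3 * y \<le> z" "x < z" "0 \<le> z" for x y z :: int using that by linarith
            from this[OF K3' r(4)] have "R + int ?K \<le> 2 * int r" by simp
            then have vp2: "\<bar>v $ p\<bar> \<le> 2 * int r" using vp by (rule order_trans[rotated])
            then have vq: "2 * int r < \<bar>v $ q\<bar>" using far by linarith
            have M': "int (2 * n r * ?K) \<le> int r" using M by (rule of_nat_mono)
            show ?thesis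
            proof (rule far_influence[OF fA Ap _ refl P(1-3,7) _ agree fT])
              show "i \<in> ?A" if "i $ p = v $ p - 1" "\<bar>i $ q\<bar> \<le> int (2 * n r * ?K)" for i
              proof (rule inA)
                show "i \<in> Q" using vp2 M' that r(5) by (auto simp: Q_def N_def)
              qed (use that in simp)
              show "int (2 * n r * ?K) < \<bar>v $ q\<bar>" using M' vq by linarith
              show "j \<noteq> v" if "j \<in> ?T" for j using R(2)[of j] that vq r(4) by auto
              show "j \<in> ?A" if "j \<in> ?T" "j $ p < v $ p" for j using that \<Delta>Q by (intro inA) auto
              show "\<bar>j $ q\<bar> < int (n r * ?K)" if "j \<in> ?T" for j
                using that by (intro le_less_trans[OF R(2) RnK]) simp
            qed
          qed
        qed
        have "?\<tau> \<le> e"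
        proof -
          have "card ?T \<le> card \<Delta>" by (rule card_mono[OF \<Delta>]) auto
          then have "2 * (2 * n r * ?K) + 1 + card ?T \<le> (3 + card \<Delta>) * r"
          proof -
            have "card \<Delta> * 1 \<le> card \<Delta> * r" using r(5) by (intro mult_le_mono2) simp
            then have "card \<Delta> \<le> card \<Delta> * r" by (simp only: mult_1_right)
            then have "2 * (2 * n r * ?K) + 1 + card ?T \<le> 3 * r + card \<Delta> * r"
              using \<open>card ?T \<le> card \<Delta>\<close> M r(5) by linarith
            then show ?thesis by (simp only: add_mult_distrib)
          qed
          then have "real (2 * (2 * n r * ?K) + 1 + card ?T) * \<rho> ?K \<le> real ((3 + card \<Delta>) * r) * (1 / real
              r ^ 6)"
            by (intro mult_mono P(4) rho_nonneg of_nat_mono) auto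
          also have "\<dots> = real (3 + card \<Delta>) / real r ^ 5"
            using r(5) power_Suc[of "real r" 5] by simp
          finally have "?\<tau> \<le> real (3 + card \<Delta>) / real r ^ 5 + 1 / real r ^ 6" using P(5) by linarith
          also have "1 / real r ^ 6 \<le> 1 / real r ^ 5"
            using r(5) by (intro divide_left_mono power_increasing) auto
          finally show ?thesis by (simp add: e_def E_def add_divide_distrib)
        qed
        then show ?thesis using main c0 by (elim influence_mono) auto
      qed
      then show "influence_le ?A \<eta> \<eta>' ?T (C0 / (1 + real r1) ^ (CARD('d) + 2) + e)" by (simp only: card2)
    qed
  qed
qed

end

theorem theorem4p4:
  fixes M :: "'w measure" and Y :: "int ^ 'd \<Rightarrow> 'w \<Rightarrow> 'b :: finite"
  assumes "prob_space M"
    and "\<And>i. Y i \<in> measurable M (count_space UNIV)"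
    and "shift_invariant (field_law M Y)"
    and "markov_random_field (field_law M Y)"
  shows "(exponential_strong_spatial_mixing (field_law M Y) \<longrightarrow>
            gaussian_concentration (field_law M Y)) \<and>
         (CARD('d) = 2 \<and> exponential_weak_spatial_mixing_for_squares (field_law M Y) \<and>
            no_hard_constraints (field_law M Y) \<longrightarrow>
            gaussian_concentration (field_law M Y))"
proof -
  have "(\<lambda>\<omega> i. Y i \<omega>) \<in> measurable M (pattern_space UNIV)"
    by (rule measurable_PiM_single') (use assms(2) in \<open>auto simp: space_PiM\<close>)
  then have "prob_space (field_law M Y)"
    unfolding field_law_def by (rule prob_space.prob_space_distr[OF assms(1)])
  then have "random_field (field_law M Y)"
    by (intro random_field.intro random_field_axioms.intro) (simp_all add: field_law_def)
  then interpret markov_field "field_law M Y"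
    by (intro markov_field.intro markov_field_axioms.intro assms(4))
  show ?thesis
  proof (intro conjI impI)
    assume "exponential_strong_spatial_mixing (field_law M Y)"
    then show "gaussian_concentration (field_law M Y)" by (rule gaussian_concentration_of_ssm)
  next
    assume a: "CARD('d) = 2 \<and> exponential_weak_spatial_mixing_for_squares (field_law M Y) \<and>
            no_hard_constraints (field_law M Y)"
    then obtain p q :: 'd where pq: "p \<noteq> q" "(UNIV :: 'd set) = {p, q}"
      by (auto simp: card_2_iff)
    obtain \<rho> where \<rho>: "weak_spatial_mixing squares (field_law M Y) \<rho>" "exponential_rate \<rho>"
      using a unfolding exponential_weak_spatial_mixing_for_squares_def by blast
    interpret full_markov_field "field_law M Y"
      by unfold_locales (use assms(3) a in auto)
    obtain \<epsilon> where \<epsilon>: "0 < \<epsilon>" "\<epsilon> \<le> 1" "\<And>i A \<eta> a. finite A \<Longrightarrow> i \<notin> A \<Longrightarrow> \<epsilon> \<le> cexp A \<eta> (indicator (cyl {i} a))"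
      using single_site_bound by blast
    interpret plane_field "field_law M Y" p q \<rho> \<epsilon>
      by unfold_locales (use pq \<rho> \<epsilon> in auto)
    show "gaussian_concentration (field_law M Y)"
      by (rule gaussian_concentration_of_plane_wsm[OF \<rho>(2)])
  qed
qed

end
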